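(* Let $l\in\{1,\dots,d\}$ be a fixed coordinate number and let $X^q=(X_1^q,\dots,X_d^q)$, $q=1,2$, be the solutions of the stochastic differential equations with random coefficients $$X^q(t) = X^q_0 + \int_0^t a^q(s,X^q(s))\,ds + \sum_{k=1}^m \int_0^t b_k(s,X^q_l(s))\,dW_k(s),\qquad t\ge 0,$$ in the setting described in the context (the coefficients $b_k$ are the same for both equations and depend on the space variable only through its $l$-th coordinate). Assume that (C1) $X^1_{0l}\le X^2_{0l}$ almost surely; (C2) for any $t\ge 0$ and any $x^1,x^2\in\mathbb{R}^d$ such that $x^1_l=x^2_l$, it holds that $a^1_l(t,x^1)\le a^2_l(t,x^2)$ almost surely. Then $\mathsf{P}(X^1_l(t)\le X^2_l(t)\text{ for all } t\ge 0)=1$.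
   Context: Here $|\cdot|$ is the absolute value or Euclidean norm, the subscript $l$ in $X^q_{0l}$, $X^q_l$, $x^q_l$, $a^q_l$ denotes the $l$-th coordinate, and the argument $\omega$ of the random coefficients is omitted. Setting. $(\Omega,\mathcal{F},\mathbb{F}=\{\mathcal{F}_t,t\ge0\},\mathsf{P})$ is a complete filtered probability space satisfying the usual assumptions; $W_1,\dots,W_m$ are independent standard $\mathbb{F}$-Wiener processes; $X_0^q=(X^q_{01},\dots,X^q_{0d})$, $q=1,2$, are bounded $\mathcal{F}_0$-measurable random vectors in $\mathbb{R}^d$. The coefficients $a^q:[0,\infty)\times\mathbb{R}^d\times\Omega\to\mathbb{R}^d$ and $b_k:[0,\infty)\times\mathbb{R}\times\Omega\to\mathbb{R}^d$, $k=1,\dots,m$, are measurable, and for each $q=1,2$ they satisfy the following with $a=a^q$, where $b_k$ is regarded as a function on $[0,\infty)\times\mathbb{R}^d\times\Omega$ via $b_k(t,x)=b_k(t,x_l)$, and $C$ is a non-random constant (the inequalities in (H3), (H4) holding almost surely): (H1) for each $t\ge 0$ the functions $a(t,\cdot)$ and $b_k(t,\cdot)$, $k=1,\dots,m$, are $\mathcal{B}(\mathbb{R}^d)\otimes\mathcal{F}_t$-measurable; (H2) almost surely, the functions $(t,x)\mapsto a(t,x,\omega)$ and $(t,x)\mapsto b_k(t,x,\omega)$, $k=1,\dots,m$, are jointly continuous on $[0,\infty)\times\mathbb{R}^d$; (H3) for any $t\ge 0$: $|a(t,0)|+\sum_{k=1}^m|b_k(t,0)|\le C$; (H4) for any $t\ge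 0$, $x,y\in\mathbb{R}^d$: $|a(t,x)-a(t,y)|+\sum_{k=1}^m|b_k(t,x)-b_k(t,y)|\le C|x-y|$. It is known that under these assumptions each equation has a unique solution in the class of adapted square integrable processes; $X^1,X^2$ denote these (continuous) solutions. *)

theory Defs
  imports "HOL-Probability.Probability"
begin

text \<open>Time is the set of reals \<open>t \<ge> 0\<close>; the values of filtrations, processes and coefficients at
  negative times are irrelevant. This is why the library locale \<open>filtration\<close>, which would constrain
  the sigma-algebras at all real indices, is not used.\<close>

locale usual_filtered_prob_space = prob_space M + complete_measure M
  for M :: "'a measure" +
  fixes F :: "real \<Rightarrow> 'a measure"
  assumes subalgebra_F: "0 \<le> t \<Longrightarrow> subalgebra M (F t)"
    and mono_F: "0 \<le> s \<Longrightarrow> s \<le> t \<Longrightarrow> sets (F s) \<subseteq> sets (F t)"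
    and right_continuous_F: "0 \<le> t \<Longrightarrow> (\<Inter>s\<in>{t<..}. sets (F s)) = sets (F t)"
    and null_sets_F: "null_sets M \<subseteq> sets (F 0)"

definition adapted :: "(real \<Rightarrow> 'a measure) \<Rightarrow> (real \<Rightarrow> 'a \<Rightarrow> 'v::topological_space) \<Rightarrow> bool" where
  "adapted F X \<longleftrightarrow> (\<forall>t\<ge>0. X t \<in> borel_measurable (F t))"

definition wiener_process ::
  "'a measure \<Rightarrow> (real \<Rightarrow> 'a measure) \<Rightarrow> (real \<Rightarrow> 'a \<Rightarrow> real) \<Rightarrow> bool" where
  "wiener_process M F W \<longleftrightarrow>
     adapted F W \<and>
     (AE \<omega> in M. W 0 \<omega> = 0) \<and>
     (AE \<omega> in M. continuous_on {0..} (\<lambda>t. W t \<omega>)) \<and>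
     (\<forall>s t. 0 \<le> s \<longrightarrow> s < t \<longrightarrow>
        distributed M lborel (\<lambda>\<omega>. W t \<omega> - W s \<omega>) (normal_density 0 (sqrt (t - s))) \<and>
        prob_space.indep_set M (sets (F s))
          (sets (vimage_algebra (space M) (\<lambda>\<omega>. W t \<omega> - W s \<omega>) borel)))"

text \<open>Independence of the processes as random elements of the path space with its product
  sigma-algebra.\<close>

definition independent_wiener_processes ::
  "'a measure \<Rightarrow> (real \<Rightarrow> 'a measure) \<Rightarrow> ('m::finite \<Rightarrow> real \<Rightarrow> 'a \<Rightarrow> real) \<Rightarrow> bool" where
  "independent_wiener_processes M F W \<longleftrightarrow>
     (\<forall>k. wiener_process M F (W k)) \<and>
     prob_space.indep_vars M (\<lambda>_. \<Pi>\<^sub>M t\<in>{0..}. borel) (\<lambda>k \<omega>. \<lambda>t\<in>{0..}. W k t \<omega>) UNIV"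

text \<open>The Ito integral is constructed as usual: elementary integrands are
  \<open>\<Sum>i<n. \<xi>\<^sub>i 1\<^bsub>(\<tau>\<^sub>i, \<tau>\<^sub>i\<^sub>+\<^sub>1]\<^esub>\<close> with bounded \<open>\<F>\<^bsub>\<tau>\<^sub>i\<^esub>\<close>-measurable \<open>\<xi>\<^sub>i\<close>, and the integral is extended by
  mean-square approximation. As the integral is determined only almost surely, it is rendered
  as a relation between the integrand and its integral.\<close>

definition elementary_integrand ::
  "'a measure \<Rightarrow> (real \<Rightarrow> 'a measure) \<Rightarrow> nat \<Rightarrow> (nat \<Rightarrow> real) \<Rightarrow>
    (nat \<Rightarrow> 'a \<Rightarrow> 'v::euclidean_space) \<Rightarrow> bool" where
  "elementary_integrand M F n \<tau> \<xi> \<longleftrightarrow>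
     0 \<le> \<tau> 0 \<and> (\<forall>i<n. \<tau> i \<le> \<tau> (Suc i)) \<and>
     (\<forall>i<n. \<xi> i \<in> borel_measurable (F (\<tau> i)) \<and> bounded (\<xi> i ` space M))"

definition elementary_process ::
  "nat \<Rightarrow> (nat \<Rightarrow> real) \<Rightarrow> (nat \<Rightarrow> 'a \<Rightarrow> 'v::euclidean_space) \<Rightarrow> real \<Rightarrow> 'a \<Rightarrow> 'v" where
  "elementary_process n \<tau> \<xi> s \<omega> = (\<Sum>i<n. indicator {\<tau> i<..\<tau> (Suc i)} s *\<^sub>R \<xi> i \<omega>)"

definition elementary_integral ::
  "(real \<Rightarrow> 'a \<Rightarrow> real) \<Rightarrow> nat \<Rightarrow> (nat \<Rightarrow> real) \<Rightarrow> (nat \<Rightarrow> 'a \<Rightarrow> 'v::euclidean_space) \<Rightarrow>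
    real \<Rightarrow> 'a \<Rightarrow> 'v" where
  "elementary_integral W n \<tau> \<xi> t \<omega> =
     (\<Sum>i<n. (W (min t (\<tau> (Suc i))) \<omega> - W (min t (\<tau> i)) \<omega>) *\<^sub>R \<xi> i \<omega>)"

text \<open>\<open>has_ito_integral M F W t H Y\<close>: the random variable \<open>Y\<close> is the integral of \<open>H\<close> with respect
  to \<open>W\<close> over \<open>[0, t]\<close>.\<close>

definition has_ito_integral ::
  "'a measure \<Rightarrow> (real \<Rightarrow> 'a measure) \<Rightarrow> (real \<Rightarrow> 'a \<Rightarrow> real) \<Rightarrow> real \<Rightarrow>
    (real \<Rightarrow> 'a \<Rightarrow> 'v::euclidean_space) \<Rightarrow> ('a \<Rightarrow> 'v) \<Rightarrow> bool" where
  "has_ito_integral M F W t H Y \<longleftrightarrow>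
     (\<lambda>(s, \<omega>). H s \<omega>) \<in> borel_measurable (restrict_space borel {0..t} \<Otimes>\<^sub>M M) \<and>
     Y \<in> borel_measurable M \<and>
     (\<exists>n \<tau> \<xi>.
        (\<forall>j. elementary_integrand M F (n j) (\<tau> j) (\<xi> j)) \<and>
        (\<lambda>j::nat. \<integral>\<^sup>+\<omega>. (\<integral>\<^sup>+s\<in>{0..t}.
           ennreal ((norm (H s \<omega> - elementary_process (n j) (\<tau> j) (\<xi> j) s \<omega>))\<^sup>2) \<partial>lborel) \<partial>M)
          \<longlonglongrightarrow> 0 \<and>
        (\<lambda>j. \<integral>\<^sup>+\<omega>. ennreal ((norm (Y \<omega> - elementary_integral W (n j) (\<tau> j) (\<xi> j) t \<omega>))\<^sup>2) \<partial>M)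
          \<longlonglongrightarrow> 0)"

definition coefficient_assumptions ::
  "'a measure \<Rightarrow> (real \<Rightarrow> 'a measure) \<Rightarrow> real \<Rightarrow>
    (real \<Rightarrow> real^'d \<Rightarrow> 'a \<Rightarrow> real^'d) \<Rightarrow>
    ('m::finite \<Rightarrow> real \<Rightarrow> real^'d \<Rightarrow> 'a \<Rightarrow> real^'d) \<Rightarrow> bool" where
  "coefficient_assumptions M F C a b \<longleftrightarrow>
     (\<forall>t\<ge>0. (\<lambda>(x, \<omega>). a t x \<omega>) \<in> borel_measurable (borel \<Otimes>\<^sub>M F t) \<and>
        (\<forall>k. (\<lambda>(x, \<omega>). b k t x \<omega>) \<in> borel_measurable (borel \<Otimes>\<^sub>M F t))) \<and>
     (AE \<omega> in M. continuous_on ({0..} \<times> UNIV) (\<lambda>(t, x). a t x \<omega>) \<and>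
        (\<forall>k. continuous_on ({0..} \<times> UNIV) (\<lambda>(t, x). b k t x \<omega>))) \<and>
     (\<forall>t\<ge>0. AE \<omega> in M. norm (a t 0 \<omega>) + (\<Sum>k\<in>UNIV. norm (b k t 0 \<omega>)) \<le> C) \<and>
     (\<forall>t\<ge>0. \<forall>x y. AE \<omega> in M.
        norm (a t x \<omega> - a t y \<omega>) + (\<Sum>k\<in>UNIV. norm (b k t x \<omega> - b k t y \<omega>)) \<le> C * norm (x - y))"

definition square_integrable_process ::
  "'a measure \<Rightarrow> (real \<Rightarrow> 'a \<Rightarrow> 'v::euclidean_space) \<Rightarrow> bool" where
  "square_integrable_process M X \<longleftrightarrow>
     (\<lambda>(t, \<omega>). X t \<omega>) \<in> borel_measurable (restrict_space borel {0..} \<Otimes>\<^sub>M M) \<and>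
     (\<forall>T\<ge>0. (\<integral>\<^sup>+\<omega>. (\<integral>\<^sup>+t\<in>{0..T}. ennreal ((norm (X t \<omega>))\<^sup>2) \<partial>lborel) \<partial>M) < \<infinity>)"

definition sde_solution ::
  "'a measure \<Rightarrow> (real \<Rightarrow> 'a measure) \<Rightarrow> ('m::finite \<Rightarrow> real \<Rightarrow> 'a \<Rightarrow> real) \<Rightarrow>
    (real \<Rightarrow> real^'d \<Rightarrow> 'a \<Rightarrow> real^'d) \<Rightarrow>
    ('m \<Rightarrow> real \<Rightarrow> real^'d \<Rightarrow> 'a \<Rightarrow> real^'d) \<Rightarrow>
    ('a \<Rightarrow> real^'d) \<Rightarrow> (real \<Rightarrow> 'a \<Rightarrow> real^'d) \<Rightarrow> bool" where
  "sde_solution M F W a b X0 X \<longleftrightarrow>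
     adapted F X \<and> square_integrable_process M X \<and>
     (AE \<omega> in M. continuous_on {0..} (\<lambda>t. X t \<omega>)) \<and>
     (\<exists>I. \<forall>t\<ge>0.
        (\<forall>k. has_ito_integral M F (W k) t (\<lambda>s \<omega>. b k s (X s \<omega>) \<omega>) (I k t)) \<and>
        (AE \<omega> in M. X t \<omega> = X0 \<omega> + (LBINT s:{0..t}. a s (X s \<omega>) \<omega>) + (\<Sum>k\<in>UNIV. I k t \<omega>)))"

end

theory Submission imports Defs begin

text \<open>
  Let \<open>Y = X1 $ l - X2 $ l\<close>. This real process has a drift \<open>A\<close> with \<open>A \<le> C \<bar>Y\<bar>\<close> and diffusion
  coefficients \<open>B\<^sub>k\<close> with \<open>\<bar>B\<^sub>k\<bar> \<le> C \<bar>Y\<bar>\<close>. The bound on \<open>B\<^sub>k\<close> is the Lipschitz condition, because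
  \<open>b k\<close> sees only the coordinate \<open>l\<close>. For the drift, give \<open>X2\<close> the \<open>l\<close>-th coordinate of \<open>X1\<close>: at the
  changed point (C2) compares the two drifts, and undoing the change costs at most \<open>C \<bar>Y\<bar>\<close>
  (\<open>drift_component_comparison\<close>). The claim follows once the excess \<open>f t = E (max 0 (Y t))\<^sup>2\<close>, which
  vanishes at time 0, is shown to satisfy \<open>f' \<le> K f\<close>.

  The function \<open>\<lambda>y. (max 0 y)\<^sup>2\<close> is not twice differentiable, and no Ito formula is used: the
  inequality is proved for upper right Dini derivatives, by expanding over one short step from
  \<open>t\<close> to \<open>s = t + h\<close>. Write \<open>Y s = y + D + Q + R\<close>, where \<open>y = Y t\<close>, \<open>D\<close> is the increment of the
  drift, \<open>Q = (\<Sum>k. B\<^sub>k t * (W\<^sub>k s - W\<^sub>k t))\<close> is the martingale increment with coefficients frozen at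
  \<open>t\<close>, and \<open>R\<close> is the error made by freezing. Then \<open>E D\<^sup>2 = o(h)\<close> because the drift is square
  integrable in time and probability, and \<open>E R\<^sup>2 = o(h)\<close> by the isometry, because the coefficients are
  mean-square continuous in time (\<open>residual_small\<close>). The expansion has two cases
  (\<open>sq_pos_part_step\<close>).

  \<^item> If \<open>y > 0\<close>, then \<open>(max 0 (Y s))\<^sup>2 \<le> (Y s)\<^sup>2\<close>. The term linear in \<open>Q + R\<close> has expectation 0, the term
    linear in \<open>D\<close> contributes at most \<open>O(h) f t + o(h)\<close> by \<open>A \<le> C \<bar>Y\<bar>\<close>, and \<open>E Q\<^sup>2\<close> on this event is
    again \<open>O(h) f t\<close>.

  \<^item> If \<open>y \<le> 0\<close>, then \<open>\<bar>Q\<bar> \<le> C \<bar>y\<bar> V\<close> with \<open>V = (\<Sum>k. \<bar>W\<^sub>k s - W\<^sub>k t\<bar>)\<close>, so \<open>Q\<close> alone can lift \<open>y\<close> above 0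
    only where \<open>C V > 1\<close>. On that event \<open>(C V - 1)\<^sup>2 \<le> (C V)^4\<close>, and \<open>E V^4 = O(h\<^sup>2)\<close> is negligible.

  This gives \<open>f (t + h) \<le> f t + (K f t + o(1)) h\<close> (\<open>excess_step\<close>), hence \<open>f = 0\<close> by \<open>dini_gronwall\<close>.
  So \<open>X1 $ l \<le> X2 $ l\<close> almost surely at each rational time, and continuity of the paths extends this
  to all times.

  Stochastic integrals enter through two facts about their increments: their mean square is
  controlled by that of the integrand (\<open>ito_increment_mean_square\<close>), and they are orthogonal to the
  past (\<open>ito_increment_orthogonal\<close>).
\<close>

section \<open>Square-integrable random variables\<close>

text \<open>The mean square takes values in \<open>ennreal\<close>, so that inequalities and limits can be stated before
  any finiteness is known.\<close>

definition mean_square :: "'a measure \<Rightarrow> ('a \<Rightarrow> real) \<Rightarrow> ennreal" where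
  "mean_square M X = (\<integral>\<^sup>+\<omega>. ennreal ((X \<omega>)\<^sup>2) \<partial>M)"

definition sq_integrable :: "'a measure \<Rightarrow> ('a \<Rightarrow> real) \<Rightarrow> bool" where
  "sq_integrable M X \<longleftrightarrow> X \<in> borel_measurable M \<and> mean_square M X < \<infinity>"

lemma sq_integrable_iff:
  "sq_integrable M X \<longleftrightarrow> X \<in> borel_measurable M \<and> integrable M (\<lambda>\<omega>. (X \<omega>)\<^sup>2)"
  unfolding sq_integrable_def mean_square_def by (auto simp: integrable_iff_bounded)

lemma mean_square_eq_integral:
  "sq_integrable M X \<Longrightarrow> mean_square M X = ennreal (\<integral>\<omega>. (X \<omega>)\<^sup>2 \<partial>M)"
  unfolding sq_integrable_iff mean_square_def by (intro nn_integral_eq_integral) auto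

lemma integral_square_le:
  assumes "X \<in> borel_measurable M" "mean_square M X \<le> ennreal c" "0 \<le> c"
  shows "sq_integrable M X" "(\<integral>\<omega>. (X \<omega>)\<^sup>2 \<partial>M) \<le> c"
proof -
  show *: "sq_integrable M X"
    using assms by (auto simp: sq_integrable_def intro: le_less_trans)
  show "(\<integral>\<omega>. (X \<omega>)\<^sup>2 \<partial>M) \<le> c"
    using mean_square_eq_integral[OF *] assms by (simp add: ennreal_le_iff)
qed

lemma square_add_le: "(x + y)\<^sup>2 \<le> 2 * x\<^sup>2 + 2 * (y::real)\<^sup>2"
  using sum_squares_ge_zero[of "x - y" 0] by (simp add: power2_eq_square algebra_simps)

lemma mean_square_mono:
  "(AE \<omega> in M. \<bar>X \<omega>\<bar> \<le> \<bar>Y \<omega>\<bar>) \<Longrightarrow> mean_square M X \<le> mean_square M Y"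
  unfolding mean_square_def by (intro nn_integral_mono_AE) (auto simp: abs_le_square_iff elim!: eventually_mono intro!: ennreal_leI)

lemma mean_square_cong:
  "(AE \<omega> in M. X \<omega> = Y \<omega>) \<Longrightarrow> mean_square M X = mean_square M Y"
  unfolding mean_square_def by (intro nn_integral_cong_AE) auto

lemma mean_square_cmult:
  assumes [measurable]: "X \<in> borel_measurable M"
  shows "mean_square M (\<lambda>\<omega>. c * X \<omega>) = ennreal (c\<^sup>2) * mean_square M X"
  unfolding mean_square_def
  by (subst nn_integral_cmult[symmetric]) (auto simp: power_mult_distrib ennreal_mult)

lemma mean_square_add:
  assumes [measurable]: "X \<in> borel_measurable M" "Y \<in> borel_measurable M"
  shows "mean_square M (\<lambda>\<omega>. X \<omega> + Y \<omega>) \<le> 2 * mean_square M X + 2 * mean_square M Y"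
proof -
  have "mean_square M (\<lambda>\<omega>. X \<omega> + Y \<omega>) \<le> (\<integral>\<^sup>+\<omega>. 2 * ennreal ((X \<omega>)\<^sup>2) + 2 * ennreal ((Y \<omega>)\<^sup>2) \<partial>M)"
    unfolding mean_square_def
  proof (intro nn_integral_mono)
    fix \<omega>
    have "ennreal ((X \<omega> + Y \<omega>)\<^sup>2) \<le> ennreal (2 * (X \<omega>)\<^sup>2 + 2 * (Y \<omega>)\<^sup>2)"
      by (intro ennreal_leI square_add_le)
    then show "ennreal ((X \<omega> + Y \<omega>)\<^sup>2) \<le> 2 * ennreal ((X \<omega>)\<^sup>2) + 2 * ennreal ((Y \<omega>)\<^sup>2)"
      by (simp add: ennreal_plus ennreal_mult)
  qed
  also have "\<dots> = 2 * mean_square M X + 2 * mean_square M Y"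
    unfolding mean_square_def by (simp add: nn_integral_add nn_integral_cmult)
  finally show ?thesis .
qed

lemma mean_square_uminus [simp]: "mean_square M (\<lambda>\<omega>. - X \<omega>) = mean_square M X"
  by (simp add: mean_square_def)

lemma mean_square_commute: "mean_square M (\<lambda>\<omega>. X \<omega> - Y \<omega>) = mean_square M (\<lambda>\<omega>. Y \<omega> - X \<omega>)"
  by (simp add: mean_square_def power2_commute)

lemma mean_square_diff:
  assumes [measurable]: "X \<in> borel_measurable M" "Y \<in> borel_measurable M"
  shows "mean_square M (\<lambda>\<omega>. X \<omega> - Y \<omega>) \<le> 2 * mean_square M X + 2 * mean_square M Y"
  using mean_square_add[of X M "\<lambda>\<omega>. - Y \<omega>"] by simp

lemma mean_square_sum:
  assumes [measurable]: "\<And>i. i \<in> I \<Longrightarrow> X i \<in> borel_measurable M" and "finite I"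
  shows "mean_square M (\<lambda>\<omega>. \<Sum>i\<in>I. X i \<omega>) \<le> of_nat (card I) * (\<Sum>i\<in>I. mean_square M (X i))"
proof -
  have "mean_square M (\<lambda>\<omega>. \<Sum>i\<in>I. X i \<omega>) \<le> (\<integral>\<^sup>+\<omega>. ennreal (card I) * (\<Sum>i\<in>I. ennreal ((X i \<omega>)\<^sup>2)) \<partial>M)"
    unfolding mean_square_def
  proof (intro nn_integral_mono)
    fix \<omega>
    have "(\<Sum>i\<in>I. X i \<omega>)\<^sup>2 \<le> (\<Sum>i\<in>I. (X i \<omega>)\<^sup>2) * card I"
      using Cauchy_Schwarz_ineq_sum[of "\<lambda>i. X i \<omega>" "\<lambda>_. 1" I] by simp
    then have "ennreal ((\<Sum>i\<in>I. X i \<omega>)\<^sup>2) \<le> ennreal (card I * (\<Sum>i\<in>I. (X i \<omega>)\<^sup>2))"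
      by (intro ennreal_leI) (simp add: mult.commute)
    then show "ennreal ((\<Sum>i\<in>I. X i \<omega>)\<^sup>2) \<le> ennreal (card I) * (\<Sum>i\<in>I. ennreal ((X i \<omega>)\<^sup>2))"
      by (subst sum_ennreal) (auto simp: ennreal_mult sum_nonneg)
  qed
  also have "\<dots> = of_nat (card I) * (\<Sum>i\<in>I. mean_square M (X i))"
    unfolding mean_square_def
    by (subst nn_integral_cmult, simp, subst nn_integral_sum) (auto simp: ennreal_of_nat_eq_real_of_nat simp del: sum_ennreal)
  finally show ?thesis .
qed

lemma ennreal_double_add: "0 \<le> a \<Longrightarrow> 2 * ennreal a + 2 * ennreal a = ennreal (4 * a)"
proof -
  assume a: "0 \<le> a"
  then have "2 * ennreal a = ennreal (2 * a)" using ennreal_mult[of 2 a] by simp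
  then show ?thesis using a ennreal_plus[of "2 * a" "2 * a"] by simp
qed

lemma ennreal_two_mult_less_top: "a < \<infinity> \<Longrightarrow> b < \<infinity> \<Longrightarrow> 2 * a + 2 * (b::ennreal) < \<infinity>"
  by (simp add: ennreal_mult_less_top)

lemma sq_integrable_add:
  "sq_integrable M X \<Longrightarrow> sq_integrable M Y \<Longrightarrow> sq_integrable M (\<lambda>\<omega>. X \<omega> + Y \<omega>)"
  unfolding sq_integrable_def
  using mean_square_add[of X M Y] ennreal_two_mult_less_top[of "mean_square M X" "mean_square M Y"]
  by (auto intro: le_less_trans)

lemma sq_integrable_cmult: "sq_integrable M X \<Longrightarrow> sq_integrable M (\<lambda>\<omega>. c * X \<omega>)"
  unfolding sq_integrable_iff by (auto simp: power_mult_distrib intro: borel_measurable_times)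

lemma sq_integrable_diff:
  "sq_integrable M X \<Longrightarrow> sq_integrable M Y \<Longrightarrow> sq_integrable M (\<lambda>\<omega>. X \<omega> - Y \<omega>)"
  using sq_integrable_add[of M X "\<lambda>\<omega>. (-1) * Y \<omega>"] sq_integrable_cmult[of M Y "-1"] by simp

lemma sq_integrable_zero: "sq_integrable M (\<lambda>\<omega>. 0)"
  by (simp add: sq_integrable_iff)

lemma sq_integrable_sum:
  "(\<And>i. i \<in> I \<Longrightarrow> sq_integrable M (X i)) \<Longrightarrow> sq_integrable M (\<lambda>\<omega>. \<Sum>i\<in>I. X i \<omega>)"
  by (induction I rule: infinite_finite_induct) (auto simp: sq_integrable_zero intro: sq_integrable_add)

lemma sq_integrable_bound:
  assumes "sq_integrable M Y" "X \<in> borel_measurable M" "AE \<omega> in M. \<bar>X \<omega>\<bar> \<le> \<bar>Y \<omega>\<bar>"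
  shows "sq_integrable M X"
  using assms mean_square_mono[OF assms(3)] by (auto simp: sq_integrable_def intro: le_less_trans)

lemma sq_integrable_abs:
  assumes "sq_integrable M X" shows "sq_integrable M (\<lambda>\<omega>. \<bar>X \<omega>\<bar>)"
proof -
  have [measurable]: "X \<in> borel_measurable M" using assms by (simp add: sq_integrable_def)
  show ?thesis by (rule sq_integrable_bound[OF assms]) auto
qed

lemma mean_square_diff_le:
  assumes X: "sq_integrable M X" "mean_square M X \<le> ennreal c" and Y: "sq_integrable M Y" "mean_square M Y \<le> ennreal c"
    and c: "0 \<le> c"
  shows "mean_square M (\<lambda>\<omega>. X \<omega> - Y \<omega>) \<le> ennreal (4 * c)"
    and "integrable M (\<lambda>\<omega>. (X \<omega> - Y \<omega>)\<^sup>2)" and "(\<integral>\<omega>. (X \<omega> - Y \<omega>)\<^sup>2 \<partial>M) \<le> 4 * c"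
proof -
  have m: "X \<in> borel_measurable M" "Y \<in> borel_measurable M" using X Y by (auto simp: sq_integrable_def)
  have "mean_square M (\<lambda>\<omega>. X \<omega> - Y \<omega>) \<le> 2 * mean_square M X + 2 * mean_square M Y"
    by (rule mean_square_diff[OF m])
  also have "\<dots> \<le> 2 * ennreal c + 2 * ennreal c" by (intro add_mono mult_left_mono X Y) auto
  also have "\<dots> = ennreal (4 * c)" by (rule ennreal_double_add[OF c])
  finally show *: "mean_square M (\<lambda>\<omega>. X \<omega> - Y \<omega>) \<le> ennreal (4 * c)" .
  show "integrable M (\<lambda>\<omega>. (X \<omega> - Y \<omega>)\<^sup>2)" using sq_integrable_diff[OF X(1) Y(1)] by (simp add: sq_integrable_iff)
  show "(\<integral>\<omega>. (X \<omega> - Y \<omega>)\<^sup>2 \<partial>M) \<le> 4 * c"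
    using integral_square_le(2)[OF borel_measurable_diff[OF m] *] c by simp
qed

lemma sq_integrable_mult:
  assumes "sq_integrable M X" "sq_integrable M Y"
  shows "integrable M (\<lambda>\<omega>. X \<omega> * Y \<omega>)"
proof (rule Bochner_Integration.integrable_bound)
  show "integrable M (\<lambda>\<omega>. (X \<omega>)\<^sup>2 + (Y \<omega>)\<^sup>2)" using assms by (simp add: sq_integrable_iff)
  show "(\<lambda>\<omega>. X \<omega> * Y \<omega>) \<in> borel_measurable M"
    using assms by (auto simp: sq_integrable_iff intro: borel_measurable_times)
  have "\<bar>x * y\<bar> \<le> x\<^sup>2 + y\<^sup>2" for x y :: real
  proof -
    have "2 * (\<bar>x\<bar> * \<bar>y\<bar>) \<le> x\<^sup>2 + y\<^sup>2"
      using zero_le_power2[of "\<bar>x\<bar> - \<bar>y\<bar>"] by (simp add: power2_diff)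
    moreover have "0 \<le> x\<^sup>2 + y\<^sup>2" by simp
    ultimately show ?thesis by (simp only: abs_mult)
  qed
  then show "AE \<omega> in M. norm (X \<omega> * Y \<omega>) \<le> norm ((X \<omega>)\<^sup>2 + (Y \<omega>)\<^sup>2)" by simp
qed

text \<open>The Cauchy-Schwarz inequality. It turns mean-square convergence of stochastic integrals
  into convergence of their correlations with a fixed random variable.\<close>

lemma integral_mult_square_le:
  assumes "sq_integrable M X" "sq_integrable M Y"
  shows "ennreal ((\<integral>\<omega>. X \<omega> * Y \<omega> \<partial>M)\<^sup>2) \<le> mean_square M X * mean_square M Y"
proof -
  have [measurable]: "X \<in> borel_measurable M" "Y \<in> borel_measurable M"
    using assms by (auto simp: sq_integrable_iff)
  have "ennreal \<bar>\<integral>\<omega>. X \<omega> * Y \<omega> \<partial>M\<bar> \<le> (\<integral>\<^sup>+\<omega>. ennreal \<bar>X \<omega>\<bar> * ennreal \<bar>Y \<omega>\<bar> \<partial>M)"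
    using integral_norm_bound_ennreal[OF sq_integrable_mult[OF assms]]
    by (simp add: abs_mult ennreal_mult)
  then have "ennreal \<bar>\<integral>\<omega>. X \<omega> * Y \<omega> \<partial>M\<bar> ^ 2 \<le> (\<integral>\<^sup>+\<omega>. ennreal \<bar>X \<omega>\<bar> * ennreal \<bar>Y \<omega>\<bar> \<partial>M) ^ 2"
    by (rule power_mono) simp
  also have "\<dots> \<le> mean_square M X * mean_square M Y"
    using Cauchy_Schwarz_nn_integral[of "\<lambda>\<omega>. ennreal \<bar>X \<omega>\<bar>" M "\<lambda>\<omega>. ennreal \<bar>Y \<omega>\<bar>"]
    by (simp add: mean_square_def ennreal_power)
  finally show ?thesis by (simp add: ennreal_power)
qed

section \<open>Wiener increments\<close>

context usual_filtered_prob_space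
begin

lemma measurable_F: "0 \<le> t \<Longrightarrow> f \<in> measurable (F t) N \<Longrightarrow> f \<in> measurable M N"
  using measurable_from_subalg[OF subalgebra_F] .

lemma measurable_F_mono:
  assumes "0 \<le> s" "s \<le> t" "f \<in> measurable (F s) N"
  shows "f \<in> measurable (F t) N"
proof -
  have "subalgebra (F t) (F s)"
    using subalgebra_F[of s] subalgebra_F[of t] mono_F[of s t] assms
    by (auto simp: subalgebra_def)
  from measurable_from_subalg[OF this assms(3)] show ?thesis .
qed

lemma wiener_adapted: "wiener_process M F W \<Longrightarrow> 0 \<le> t \<Longrightarrow> W t \<in> borel_measurable (F t)"
  by (simp add: wiener_process_def adapted_def)

lemma wiener_measurable: "wiener_process M F W \<Longrightarrow> 0 \<le> t \<Longrightarrow> W t \<in> borel_measurable M"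
  using measurable_F wiener_adapted by blast

lemma wiener_increment_moment:
  assumes W: "wiener_process M F W" and ab: "0 \<le> a" "a < b"
  shows "has_bochner_integral M (\<lambda>\<omega>. (W b \<omega> - W a \<omega>) ^ k)
           (\<integral>x. normal_density 0 (sqrt (b - a)) x * x ^ k \<partial>lborel)"
proof -
  have D: "distributed M lborel (\<lambda>\<omega>. W b \<omega> - W a \<omega>) (normal_density 0 (sqrt (b - a)))"
    using W ab by (auto simp: wiener_process_def)
  have "integrable lborel (\<lambda>x. normal_density 0 (sqrt (b - a)) x * (x - 0) ^ k)"
    using ab by (intro integrable_normal_moment) simp
  then have "integrable lborel (\<lambda>x. normal_density 0 (sqrt (b - a)) x * x ^ k)" by simp
  then have "integrable M (\<lambda>\<omega>. (W b \<omega> - W a \<omega>) ^ k)"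
    using distributed_integrable[OF D, of "\<lambda>x. x ^ k"] by simp
  moreover have "(\<integral>\<omega>. (W b \<omega> - W a \<omega>) ^ k \<partial>M)
      = (\<integral>x. normal_density 0 (sqrt (b - a)) x * x ^ k \<partial>lborel)"
    using distributed_integral[OF D, of "\<lambda>x. x ^ k"] by simp
  ultimately show ?thesis by (simp add: has_bochner_integral_iff)
qed

lemma wiener_increment_moments:
  assumes W: "wiener_process M F W" and ab: "0 \<le> a" "a \<le> b"
  shows "integrable M (\<lambda>\<omega>. (W b \<omega> - W a \<omega>) ^ k)"
    and "(\<integral>\<omega>. W b \<omega> - W a \<omega> \<partial>M) = 0"
    and "(\<integral>\<omega>. (W b \<omega> - W a \<omega>)\<^sup>2 \<partial>M) = b - a"
    and "(\<integral>\<omega>. (W b \<omega> - W a \<omega>) ^ 4 \<partial>M) = 3 * (b - a)\<^sup>2"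
proof -
  note m = has_bochner_integral_integral_eq[OF wiener_increment_moment[OF W ab(1)]]
  show "integrable M (\<lambda>\<omega>. (W b \<omega> - W a \<omega>) ^ k)"
    using wiener_increment_moment[OF W ab(1), of b k] ab
    by (cases "a = b") (auto simp: has_bochner_integral_iff)
  show "(\<integral>\<omega>. W b \<omega> - W a \<omega> \<partial>M) = 0"
    using m[of b 1] ab normal_moment_nz_1[of "sqrt (b - a)" 0]
    by (cases "a = b") (auto simp: has_bochner_integral_iff)
  show "(\<integral>\<omega>. (W b \<omega> - W a \<omega>)\<^sup>2 \<partial>M) = b - a"
    using m[of b 2] ab integral_normal_moment_even[of "sqrt (b - a)" 0 1]
    by (cases "a = b") (auto simp: has_bochner_integral_iff)
  show "(\<integral>\<omega>. (W b \<omega> - W a \<omega>) ^ 4 \<partial>M) = 3 * (b - a)\<^sup>2"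
    using m[of b 4] ab integral_normal_moment_even[of "sqrt (b - a)" 0 2]
    by (cases "a = b") (auto simp: has_bochner_integral_iff fact_numeral power2_eq_square field_simps)
qed

text \<open>Independence of sigma-algebras, put into the form of a product rule for expectations. The power \<open>k\<close>
  will be 1 for martingale terms, 2 for the isometry and 4 for the event that one step crosses
  zero.\<close>

lemma wiener_increment_indep:
  assumes W: "wiener_process M F W" and ab: "0 \<le> a" "a \<le> b"
    and U: "U \<in> borel_measurable (F a)" "integrable M U"
  shows "integrable M (\<lambda>\<omega>. U \<omega> * (W b \<omega> - W a \<omega>) ^ k)"
    and "(\<integral>\<omega>. U \<omega> * (W b \<omega> - W a \<omega>) ^ k \<partial>M)
           = (\<integral>\<omega>. U \<omega> \<partial>M) * (\<integral>\<omega>. (W b \<omega> - W a \<omega>) ^ k \<partial>M)"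
proof -
  have "integrable M (\<lambda>\<omega>. U \<omega> * (W b \<omega> - W a \<omega>) ^ k) \<and>
    (\<integral>\<omega>. U \<omega> * (W b \<omega> - W a \<omega>) ^ k \<partial>M)
           = (\<integral>\<omega>. U \<omega> \<partial>M) * (\<integral>\<omega>. (W b \<omega> - W a \<omega>) ^ k \<partial>M)"
  proof (cases "a = b")
    case True
    then show ?thesis using U by (simp add: prob_space)
  next
    case False
    define D where "D = (\<lambda>\<omega>. W b \<omega> - W a \<omega>)"
    have ind: "indep_set (sets (F a)) (sets (vimage_algebra (space M) D borel))"
      unfolding D_def using W ab False by (auto simp: wiener_process_def)
    have spF: "space (F a) = space M"
      using subalgebra_F[OF ab(1)] by (simp add: subalgebra_def)
    have [measurable]: "U \<in> borel_measurable M" "D \<in> borel_measurable M"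
      unfolding D_def
      using U wiener_measurable[OF W] ab by (auto intro!: borel_measurable_diff)
    have "indep_var borel U borel D"
      unfolding indep_var_eq
    proof (intro conjI)
      show "indep_set (sigma_sets (space M) {U -` A \<inter> space M |A. A \<in> sets borel})
        (sigma_sets (space M) {D -` A \<inter> space M |A. A \<in> sets borel})"
        unfolding indep_set_def
      proof (rule indep_sets_mono_sets[OF ind[unfolded indep_set_def]])
        fix i :: bool
        have "sigma_sets (space M) {U -` A \<inter> space M |A. A \<in> sets borel} \<subseteq> sets (F a)"
        proof -
          have "{U -` A \<inter> space M |A. A \<in> sets borel} \<subseteq> sets (F a)"
            using measurable_sets[OF U(1)] spF by auto
          from sets.sigma_sets_subset[OF this] show ?thesis by (simp add: spF)
        qed
        then show "(case i of True \<Rightarrow> sigma_sets (space M) {U -` A \<inter> space M |A. A \<in> sets borel}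
             | False \<Rightarrow> sigma_sets (space M) {D -` A \<inter> space M |A. A \<in> sets borel})
          \<subseteq> (case i of True \<Rightarrow> sets (F a) | False \<Rightarrow> sets (vimage_algebra (space M) D borel))"
          by (auto split: bool.split simp: sets_vimage_algebra)
      qed
    qed simp_all
    from indep_var_compose[OF this, of "\<lambda>x. x" borel "\<lambda>x. x ^ k" borel]
    have ind': "indep_var borel U borel (\<lambda>\<omega>. D \<omega> ^ k)" by (simp add: comp_def)
    have "integrable M (\<lambda>\<omega>. D \<omega> ^ k)"
      unfolding D_def by (rule wiener_increment_moments(1)[OF W ab])
    with indep_var_integrable[OF ind' U(2)] indep_var_lebesgue_integral[OF ind' U(2)]
    show ?thesis by (simp add: D_def)
  qed
  then show "integrable M (\<lambda>\<omega>. U \<omega> * (W b \<omega> - W a \<omega>) ^ k)"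
    "(\<integral>\<omega>. U \<omega> * (W b \<omega> - W a \<omega>) ^ k \<partial>M)
           = (\<integral>\<omega>. U \<omega> \<partial>M) * (\<integral>\<omega>. (W b \<omega> - W a \<omega>) ^ k \<partial>M)" by auto
qed

lemma wiener_power_sum_indep:
  assumes W: "\<And>k. wiener_process M F (W k)" and ab: "0 \<le> a" "a \<le> b"
    and U: "U \<in> borel_measurable (F a)" "integrable M U"
  shows "integrable M (\<lambda>\<omega>. U \<omega> * (\<Sum>k\<in>I. (W k b \<omega> - W k a \<omega>) ^ n))"
    and "(\<integral>\<omega>. U \<omega> * (\<Sum>k\<in>I. (W k b \<omega> - W k a \<omega>) ^ n) \<partial>M)
      = (\<Sum>k\<in>I. (\<integral>\<omega>. U \<omega> \<partial>M) * (\<integral>\<omega>. (W k b \<omega> - W k a \<omega>) ^ n \<partial>M))"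
proof -
  note ind = wiener_increment_indep[OF W ab U, of _ n]
  show "integrable M (\<lambda>\<omega>. U \<omega> * (\<Sum>k\<in>I. (W k b \<omega> - W k a \<omega>) ^ n))"
    unfolding sum_distrib_left using ind(1) by (intro Bochner_Integration.integrable_sum)
  show "(\<integral>\<omega>. U \<omega> * (\<Sum>k\<in>I. (W k b \<omega> - W k a \<omega>) ^ n) \<partial>M)
      = (\<Sum>k\<in>I. (\<integral>\<omega>. U \<omega> \<partial>M) * (\<integral>\<omega>. (W k b \<omega> - W k a \<omega>) ^ n \<partial>M))"
    unfolding sum_distrib_left Bochner_Integration.integral_sum[OF ind(1)] ind(2) ..
qed

text \<open>Measurability of the factor is required only if the interval is nondegenerate: truncating a
  partition at a time \<open>s\<close> leaves degenerate intervals whose coefficients belong to the future of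
  \<open>s\<close>, but these coefficients are multiplied by 0.\<close>

lemma sq_integrable_mult_wiener_increment:
  assumes W: "wiener_process M F W" and ab: "0 \<le> a" "a \<le> b"
    and U: "sq_integrable M U" "a < b \<Longrightarrow> U \<in> borel_measurable (F a)"
  shows "sq_integrable M (\<lambda>\<omega>. U \<omega> * (W b \<omega> - W a \<omega>))"
proof (cases "a = b")
  case True
  then show ?thesis by (simp add: sq_integrable_zero)
next
  case False
  then have "U \<in> borel_measurable (F a)" using U ab by simp
  then have "integrable M (\<lambda>\<omega>. (U \<omega>)\<^sup>2 * (W b \<omega> - W a \<omega>)\<^sup>2)"
    using U by (intro wiener_increment_indep[OF W ab]) (auto simp: sq_integrable_iff)
  then show ?thesis
    using U wiener_measurable[OF W] ab by (auto simp: sq_integrable_iff power_mult_distrib)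
qed

text \<open>An increment is uncorrelated with everything known at its left end point. Hence the part of the
  first increment before \<open>c\<close> contributes nothing, and neither does the part of the longer increment
  that extends beyond the common interval; what remains is the squared increment over the
  intersection.\<close>

lemma wiener_increment_covariance_ordered:
  assumes W: "wiener_process M F W" and ab: "0 \<le> a" "a \<le> b" and cd: "c \<le> d" and ac: "a \<le> c"
    and U: "sq_integrable M U" "a < b \<Longrightarrow> U \<in> borel_measurable (F a)"
    and V: "sq_integrable M V" "c < d \<Longrightarrow> V \<in> borel_measurable (F c)"
  shows "(\<integral>\<omega>. (U \<omega> * (W b \<omega> - W a \<omega>)) * (V \<omega> * (W d \<omega> - W c \<omega>)) \<partial>M)
    = (\<integral>\<omega>. U \<omega> * V \<omega> \<partial>M) * measure lborel ({a<..b} \<inter> {c<..d})"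
proof (cases "a < b \<and> c < d")
  case False
  then have "a = b \<or> c = d" using ab cd by auto
  then show ?thesis by auto
next
  case True
  have Um: "U \<in> borel_measurable (F a)" and Vm: "V \<in> borel_measurable (F c)"
    and c0: "0 \<le> c"
    using U V True ac ab by auto
  have Uc: "U \<in> borel_measurable (F c)"
    using measurable_F_mono[OF ab(1) ac Um] .
  define e where "e = min b c"
  have e: "a \<le> e" "e \<le> b" "e \<le> c" using True ac by (auto simp: e_def)
  \<comment> \<open>The part of the first increment before time \<open>c\<close> is uncorrelated with the second one.\<close>
  have sq1: "sq_integrable M (\<lambda>\<omega>. U \<omega> * (W e \<omega> - W a \<omega>))"
    by (rule sq_integrable_mult_wiener_increment[OF W ab(1) e(1) U(1)]) (rule Um)
  have m1: "(\<lambda>\<omega>. U \<omega> * (W e \<omega> - W a \<omega>) * V \<omega>) \<in> borel_measurable (F c)"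
  proof -
    have "W e \<in> borel_measurable (F c)" "W a \<in> borel_measurable (F c)"
      using e ab ac measurable_F_mono[OF _ _ wiener_adapted[OF W]] by auto
    then show ?thesis using Uc Vm by (intro borel_measurable_times borel_measurable_diff)
  qed
  have i1: "integrable M (\<lambda>\<omega>. U \<omega> * (W e \<omega> - W a \<omega>) * V \<omega>)"
    using sq_integrable_mult[OF sq1 V(1)] .
  note A = wiener_increment_indep[OF W c0 cd m1 i1, of 1]
  have A2: "(\<integral>\<omega>. U \<omega> * (W e \<omega> - W a \<omega>) * V \<omega> * (W d \<omega> - W c \<omega>) \<partial>M) = 0"
    using A(2) wiener_increment_moments(2)[OF W c0 cd] by simp
  have A1: "integrable M (\<lambda>\<omega>. U \<omega> * (W e \<omega> - W a \<omega>) * V \<omega> * (W d \<omega> - W c \<omega>))"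
    using A(1) by simp
  show ?thesis
  proof (cases "b \<le> c")
    case True
    then have 0: "{a<..b} \<inter> {c<..d} = {}" and eb: "e = b" by (auto simp: e_def)
    show ?thesis unfolding 0 using A2[unfolded eb] by (simp add: mult.assoc)
  next
    case False
    then have eb: "e = c" by (auto simp: e_def)
    define m where "m = min b d"
    define n where "n = max b d"
    have mn: "c \<le> m" "m \<le> n" using False cd by (auto simp: m_def n_def)
    have m0: "0 \<le> m" using mn c0 by simp
    have UV: "(\<lambda>\<omega>. U \<omega> * V \<omega>) \<in> borel_measurable (F c)"
      using Uc Vm by (rule borel_measurable_times)
    have UVi: "integrable M (\<lambda>\<omega>. U \<omega> * V \<omega>)" using sq_integrable_mult[OF U(1) V(1)] .
    note B = wiener_increment_indep[OF W c0 mn(1) UV UVi]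
    have m2: "(\<lambda>\<omega>. U \<omega> * V \<omega> * (W m \<omega> - W c \<omega>)) \<in> borel_measurable (F m)"
    proof -
      have "W m \<in> borel_measurable (F m)" "W c \<in> borel_measurable (F m)"
        using mn c0 m0 measurable_F_mono[OF _ _ wiener_adapted[OF W]] by auto
      then have "(\<lambda>\<omega>. W m \<omega> - W c \<omega>) \<in> borel_measurable (F m)"
        by (rule borel_measurable_diff)
      then show ?thesis using measurable_F_mono[OF c0 mn(1) UV] by (rule borel_measurable_times[rotated])
    qed
    have i2: "integrable M (\<lambda>\<omega>. U \<omega> * V \<omega> * (W m \<omega> - W c \<omega>))"
      using B(1)[of 1] by simp
    note D = wiener_increment_indep[OF W m0 mn(2) m2 i2, of 1]
    have D2: "(\<integral>\<omega>. U \<omega> * V \<omega> * (W m \<omega> - W c \<omega>) * (W n \<omega> - W m \<omega>) \<partial>M) = 0"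
      using D(2) wiener_increment_moments(2)[OF W m0 mn(2)] by simp
    have B2: "(\<integral>\<omega>. U \<omega> * V \<omega> * (W m \<omega> - W c \<omega>)\<^sup>2 \<partial>M) = (\<integral>\<omega>. U \<omega> * V \<omega> \<partial>M) * (m - c)"
      using B(2)[of 2] wiener_increment_moments(3)[OF W c0 mn(1)] by simp
    have "(U \<omega> * (W b \<omega> - W a \<omega>)) * (V \<omega> * (W d \<omega> - W c \<omega>)) =
       U \<omega> * (W e \<omega> - W a \<omega>) * V \<omega> * (W d \<omega> - W c \<omega>)
       + (U \<omega> * V \<omega> * (W m \<omega> - W c \<omega>)\<^sup>2 + U \<omega> * V \<omega> * (W m \<omega> - W c \<omega>) * (W n \<omega> - W m \<omega>))" for \<omega>
      unfolding eb m_def n_def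
      by (cases "b \<le> d") (simp_all add: algebra_simps power2_eq_square)
    then have "(\<integral>\<omega>. (U \<omega> * (W b \<omega> - W a \<omega>)) * (V \<omega> * (W d \<omega> - W c \<omega>)) \<partial>M)
      = (\<integral>\<omega>. U \<omega> * V \<omega> \<partial>M) * (m - c)"
      using A1 A2 B(1)[of 2] B2 D(1) D2 by simp
    moreover have "{a<..b} \<inter> {c<..d} = {c<..m}" using ac by (auto simp: m_def)
    ultimately show ?thesis using mn by simp
  qed
qed

lemma wiener_increment_covariance:
  assumes W: "wiener_process M F W" and ab: "0 \<le> a" "a \<le> b" and cd: "0 \<le> c" "c \<le> d"
    and U: "sq_integrable M U" "a < b \<Longrightarrow> U \<in> borel_measurable (F a)"
    and V: "sq_integrable M V" "c < d \<Longrightarrow> V \<in> borel_measurable (F c)"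
  shows "(\<integral>\<omega>. (U \<omega> * (W b \<omega> - W a \<omega>)) * (V \<omega> * (W d \<omega> - W c \<omega>)) \<partial>M)
    = (\<integral>\<omega>. U \<omega> * V \<omega> \<partial>M) * measure lborel ({a<..b} \<inter> {c<..d})"
proof (cases "a \<le> c")
  case True
  show ?thesis by (rule wiener_increment_covariance_ordered[OF W ab cd(2) True U V])
next
  case False
  then have "c \<le> a" by simp
  from wiener_increment_covariance_ordered[OF W cd ab(2) this V U]
  show ?thesis by (simp add: mult.commute Int_commute)
qed

text \<open>Both sides expand into double sums over pairs of intervals, and \<open>wiener_increment_covariance\<close>
  matches them term by term. Since the intervals may overlap arbitrarily, two elementary processes
  with different partitions can be joined into one family without a common refinement.\<close>

lemma ito_isometry_steps:
  fixes \<xi> :: "'i \<Rightarrow> 'a \<Rightarrow> real"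
  assumes W: "wiener_process M F W" and "finite I"
    and ab: "\<And>i. i \<in> I \<Longrightarrow> 0 \<le> a i" "\<And>i. i \<in> I \<Longrightarrow> a i \<le> b i"
    and sq: "\<And>i. i \<in> I \<Longrightarrow> sq_integrable M (\<xi> i)"
    and meas: "\<And>i. i \<in> I \<Longrightarrow> a i < b i \<Longrightarrow> \<xi> i \<in> borel_measurable (F (a i))"
  shows "mean_square M (\<lambda>\<omega>. \<Sum>i\<in>I. (W (b i) \<omega> - W (a i) \<omega>) * \<xi> i \<omega>)
    = (\<integral>\<^sup>+\<omega>. (\<integral>\<^sup>+s. ennreal ((\<Sum>i\<in>I. indicator {a i<..b i} s * \<xi> i \<omega>)\<^sup>2) \<partial>lborel) \<partial>M)"
proof -
  define Z where "Z = (\<lambda>i \<omega>. \<xi> i \<omega> * (W (b i) \<omega> - W (a i) \<omega>))"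
  define \<mu> where "\<mu> = (\<lambda>i j. measure lborel ({a i<..b i} \<inter> {a j<..b j}))"
  have Z: "sq_integrable M (Z i)" if "i \<in> I" for i
    unfolding Z_def using that
    by (intro sq_integrable_mult_wiener_increment[OF W] ab sq meas)
  have sq_expand: "(\<Sum>i\<in>I. h i)\<^sup>2 = (\<Sum>i\<in>I. \<Sum>j\<in>I. h i * h j)" for h :: "'i \<Rightarrow> real"
    by (simp add: power2_eq_square sum_product)
  have ZZ: "integrable M (\<lambda>\<omega>. Z i \<omega> * Z j \<omega>)" if "i \<in> I" "j \<in> I" for i j
    by (rule sq_integrable_mult[OF Z[OF that(1)] Z[OF that(2)]])
  have cov: "(\<integral>\<omega>. Z i \<omega> * Z j \<omega> \<partial>M) = (\<integral>\<omega>. \<xi> i \<omega> * \<xi> j \<omega> \<partial>M) * \<mu> i j" if "i \<in> I" "j \<in> I" for i j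
    unfolding Z_def \<mu>_def using that
    by (intro wiener_increment_covariance[OF W] ab sq meas)
  have \<xi>\<xi>: "integrable M (\<lambda>\<omega>. \<xi> i \<omega> * \<xi> j \<omega>)" if "i \<in> I" "j \<in> I" for i j
    using that by (intro sq_integrable_mult sq)
  have inner: "(\<integral>\<^sup>+s. ennreal ((\<Sum>i\<in>I. indicator {a i<..b i} s * \<xi> i \<omega>)\<^sup>2) \<partial>lborel)
      = ennreal (\<Sum>i\<in>I. \<Sum>j\<in>I. \<xi> i \<omega> * \<xi> j \<omega> * \<mu> i j)"
    and inner_nonneg: "0 \<le> (\<Sum>i\<in>I. \<Sum>j\<in>I. \<xi> i \<omega> * \<xi> j \<omega> * \<mu> i j)" for \<omega>
  proof -
    have eq: "(\<Sum>i\<in>I. indicator {a i<..b i} s * \<xi> i \<omega>)\<^sup>2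
      = (\<Sum>i\<in>I. \<Sum>j\<in>I. \<xi> i \<omega> * \<xi> j \<omega> * indicat_real ({a i<..b i} \<inter> {a j<..b j}) s)" for s
      unfolding sq_expand indicator_inter_arith by (simp add: mult_ac)
    have fin: "emeasure lborel ({a i<..b i} \<inter> {a j<..b j}) < \<infinity>" for i j
    proof -
      have "emeasure lborel ({a i<..b i} \<inter> {a j<..b j}) \<le> emeasure lborel {a i<..b i}"
        by (intro emeasure_mono) auto
      also have "\<dots> < \<infinity>" by (cases "a i \<le> b i") auto
      finally show ?thesis .
    qed
    have int1: "integrable lborel (indicat_real ({a i<..b i} \<inter> {a j<..b j}))" for i j
      using fin[of i j] by (intro integrable_real_indicator) auto
    have hb: "has_bochner_integral lborel (\<lambda>s. (\<Sum>i\<in>I. indicator {a i<..b i} s * \<xi> i \<omega>)\<^sup>2)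
      (\<Sum>i\<in>I. \<Sum>j\<in>I. \<xi> i \<omega> * \<xi> j \<omega> * \<mu> i j)"
      unfolding eq \<mu>_def
      by (intro has_bochner_integral_sum has_bochner_integral_mult_right)
         (use int1 in \<open>auto simp: has_bochner_integral_iff\<close>)
    show "(\<integral>\<^sup>+s. ennreal ((\<Sum>i\<in>I. indicator {a i<..b i} s * \<xi> i \<omega>)\<^sup>2) \<partial>lborel)
      = ennreal (\<Sum>i\<in>I. \<Sum>j\<in>I. \<xi> i \<omega> * \<xi> j \<omega> * \<mu> i j)"
      using hb by (subst nn_integral_eq_integral) (auto simp: has_bochner_integral_iff)
    have "0 \<le> (\<integral>s. (\<Sum>i\<in>I. indicator {a i<..b i} s * \<xi> i \<omega>)\<^sup>2 \<partial>lborel)" by simp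
    then show "0 \<le> (\<Sum>i\<in>I. \<Sum>j\<in>I. \<xi> i \<omega> * \<xi> j \<omega> * \<mu> i j)"
      using hb by (simp only: has_bochner_integral_iff)
  qed
  have "mean_square M (\<lambda>\<omega>. \<Sum>i\<in>I. (W (b i) \<omega> - W (a i) \<omega>) * \<xi> i \<omega>) = mean_square M (\<lambda>\<omega>. \<Sum>i\<in>I. Z i \<omega>)"
    by (simp add: Z_def mult.commute)
  also have "\<dots> = ennreal (\<integral>\<omega>. (\<Sum>i\<in>I. Z i \<omega>)\<^sup>2 \<partial>M)"
    by (intro mean_square_eq_integral sq_integrable_sum Z)
  also have "(\<integral>\<omega>. (\<Sum>i\<in>I. Z i \<omega>)\<^sup>2 \<partial>M) = (\<Sum>i\<in>I. \<Sum>j\<in>I. (\<integral>\<omega>. \<xi> i \<omega> * \<xi> j \<omega> \<partial>M) * \<mu> i j)"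
    unfolding sq_expand using ZZ by (simp add: Bochner_Integration.integral_sum cov)
  also have "\<dots> = (\<integral>\<omega>. (\<Sum>i\<in>I. \<Sum>j\<in>I. \<xi> i \<omega> * \<xi> j \<omega> * \<mu> i j) \<partial>M)"
    using \<xi>\<xi> by (simp add: Bochner_Integration.integral_sum)
  also have "ennreal \<dots> = (\<integral>\<^sup>+\<omega>. ennreal (\<Sum>i\<in>I. \<Sum>j\<in>I. \<xi> i \<omega> * \<xi> j \<omega> * \<mu> i j) \<partial>M)"
    using \<xi>\<xi> inner_nonneg by (intro nn_integral_eq_integral[symmetric]) auto
  finally show ?thesis unfolding inner .
qed

end

section \<open>Mean squares over time intervals\<close>

definition mean_square_on ::
  "'a measure \<Rightarrow> real \<Rightarrow> real \<Rightarrow> (real \<Rightarrow> 'a \<Rightarrow> real) \<Rightarrow> ennreal" where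
  "mean_square_on M t s H = (\<integral>\<^sup>+\<omega>. (\<integral>\<^sup>+r\<in>{t..s}. ennreal ((H r \<omega>)\<^sup>2) \<partial>lborel) \<partial>M)"

definition jointly_measurable_on :: "real \<Rightarrow> 'a measure \<Rightarrow> (real \<Rightarrow> 'a \<Rightarrow> real) \<Rightarrow> bool" where
  "jointly_measurable_on T M H \<longleftrightarrow>
     (\<lambda>(s, \<omega>). H s \<omega>) \<in> borel_measurable (restrict_space borel {0..T} \<Otimes>\<^sub>M M)"

lemma jointly_measurable_onI:
  assumes "(\<lambda>(s, \<omega>). H s \<omega>) \<in> borel_measurable (borel \<Otimes>\<^sub>M M)"
  shows "jointly_measurable_on T M H"
proof -
  have "(\<lambda>p. (fst p, snd p)) \<in> restrict_space borel {0..T} \<Otimes>\<^sub>M M \<rightarrow>\<^sub>M borel \<Otimes>\<^sub>M M"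
    by (intro measurable_Pair measurable_fst'' measurable_snd measurable_restrict_space1) simp_all
  from measurable_compose[OF this assms] show ?thesis
    by (simp add: jointly_measurable_on_def split_beta')
qed

text \<open>Freezing the clock outside \<open>{0..T}\<close> extends a process to all real times without changing it on
  \<open>{0..T}\<close>, so that measurability on the full product space becomes applicable.\<close>

lemma jointly_measurable_on_clamp:
  assumes "jointly_measurable_on T M H" "0 \<le> T"
  shows "(\<lambda>(s, \<omega>). H (max 0 (min T s)) \<omega>) \<in> borel_measurable (borel \<Otimes>\<^sub>M M)"
proof -
  have "(\<lambda>p. (max 0 (min T (fst p)), snd p)) \<in> borel \<Otimes>\<^sub>M M \<rightarrow>\<^sub>M restrict_space borel {0..T} \<Otimes>\<^sub>M M"
    using assms(2)
    by (intro measurable_Pair measurable_snd measurable_restrict_space2) auto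
  from measurable_compose[OF this assms(1)[unfolded jointly_measurable_on_def]] show ?thesis
    by (simp add: split_beta')
qed

lemma jointly_measurable_on_diff:
  "jointly_measurable_on T M H \<Longrightarrow> jointly_measurable_on T M K \<Longrightarrow>
    jointly_measurable_on T M (\<lambda>s \<omega>. H s \<omega> - K s \<omega>)"
  unfolding jointly_measurable_on_def split_beta' by (rule borel_measurable_diff)

lemma jointly_measurable_on_add:
  "jointly_measurable_on T M H \<Longrightarrow> jointly_measurable_on T M K \<Longrightarrow>
    jointly_measurable_on T M (\<lambda>s \<omega>. H s \<omega> + K s \<omega>)"
  unfolding jointly_measurable_on_def split_beta' by (rule borel_measurable_add)

lemma jointly_measurable_on_const:
  assumes "X \<in> borel_measurable M" shows "jointly_measurable_on T M (\<lambda>s. X)"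
  unfolding jointly_measurable_on_def split_beta' by (intro measurable_compose[OF measurable_snd assms])

lemma mean_square_on_measurable:
  assumes "jointly_measurable_on T M H" "0 \<le> t" "t \<le> s" "s \<le> T"
  shows "(\<lambda>\<omega>. \<integral>\<^sup>+r\<in>{t..s}. ennreal ((H r \<omega>)\<^sup>2) \<partial>lborel) \<in> borel_measurable M"
proof -
  have [measurable]: "(\<lambda>(r, \<omega>). H (max 0 (min T r)) \<omega>) \<in> borel_measurable (borel \<Otimes>\<^sub>M M)"
    using assms by (intro jointly_measurable_on_clamp[OF assms(1)]) simp
  have "(\<lambda>\<omega>. \<integral>\<^sup>+r\<in>{t..s}. ennreal ((H (max 0 (min T r)) \<omega>)\<^sup>2) \<partial>lborel) \<in> borel_measurable M"
    by measurable
  moreover have "(\<integral>\<^sup>+r\<in>{t..s}. ennreal ((H (max 0 (min T r)) \<omega>)\<^sup>2) \<partial>lborel)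
    = (\<integral>\<^sup>+r\<in>{t..s}. ennreal ((H r \<omega>)\<^sup>2) \<partial>lborel)" for \<omega>
    using assms by (intro nn_integral_cong) (auto simp: indicator_def)
  ultimately show ?thesis by simp
qed

lemma mean_square_on_section_measurable:
  assumes "jointly_measurable_on T M H" "0 \<le> t" "t \<le> s" "s \<le> T" "\<omega> \<in> space M"
  shows "(\<lambda>r. ennreal ((H r \<omega>)\<^sup>2) * indicator {t..s} r) \<in> borel_measurable lborel"
proof -
  have [measurable]: "(\<lambda>(r, \<omega>). H (max 0 (min T r)) \<omega>) \<in> borel_measurable (borel \<Otimes>\<^sub>M M)"
    using assms by (intro jointly_measurable_on_clamp[OF assms(1)]) simp
  have "(\<lambda>r. ennreal ((H (max 0 (min T r)) \<omega>)\<^sup>2) * indicator {t..s} r) \<in> borel_measurable lborel"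
    using assms(5) by measurable
  moreover have "(\<lambda>r. ennreal ((H (max 0 (min T r)) \<omega>)\<^sup>2) * indicator {t..s} r)
    = (\<lambda>r. ennreal ((H r \<omega>)\<^sup>2) * indicator {t..s} r)"
    using assms by (auto simp: indicator_def)
  ultimately show ?thesis by simp
qed

lemma mean_square_on_add:
  assumes H: "jointly_measurable_on T M H" and K: "jointly_measurable_on T M K"
    and ts: "0 \<le> t" "t \<le> s" "s \<le> T"
  shows "mean_square_on M t s (\<lambda>r \<omega>. H r \<omega> + K r \<omega>)
    \<le> 2 * mean_square_on M t s H + 2 * mean_square_on M t s K"
proof -
  have "mean_square_on M t s (\<lambda>r \<omega>. H r \<omega> + K r \<omega>)
    \<le> (\<integral>\<^sup>+\<omega>. 2 * (\<integral>\<^sup>+r\<in>{t..s}. ennreal ((H r \<omega>)\<^sup>2) \<partial>lborel)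
          + 2 * (\<integral>\<^sup>+r\<in>{t..s}. ennreal ((K r \<omega>)\<^sup>2) \<partial>lborel) \<partial>M)"
    unfolding mean_square_on_def
  proof (intro nn_integral_mono)
    fix \<omega> assume \<omega>: "\<omega> \<in> space M"
    note [measurable] = mean_square_on_section_measurable[OF H ts \<omega>]
      mean_square_on_section_measurable[OF K ts \<omega>]
    have "(\<integral>\<^sup>+r\<in>{t..s}. ennreal ((H r \<omega> + K r \<omega>)\<^sup>2) \<partial>lborel)
      \<le> (\<integral>\<^sup>+r. 2 * (ennreal ((H r \<omega>)\<^sup>2) * indicator {t..s} r)
           + 2 * (ennreal ((K r \<omega>)\<^sup>2) * indicator {t..s} r) \<partial>lborel)"
    proof (intro nn_integral_mono)
      fix r
      have "ennreal ((H r \<omega> + K r \<omega>)\<^sup>2) \<le> ennreal (2 * (H r \<omega>)\<^sup>2 + 2 * (K r \<omega>)\<^sup>2)"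
        by (intro ennreal_leI square_add_le)
      then show "ennreal ((H r \<omega> + K r \<omega>)\<^sup>2) * indicator {t..s} r \<le>
         2 * (ennreal ((H r \<omega>)\<^sup>2) * indicator {t..s} r)
           + 2 * (ennreal ((K r \<omega>)\<^sup>2) * indicator {t..s} r)"
        by (auto simp: ennreal_plus ennreal_mult indicator_def)
    qed
    also have "\<dots> = 2 * (\<integral>\<^sup>+r\<in>{t..s}. ennreal ((H r \<omega>)\<^sup>2) \<partial>lborel)
          + 2 * (\<integral>\<^sup>+r\<in>{t..s}. ennreal ((K r \<omega>)\<^sup>2) \<partial>lborel)"
      by (subst nn_integral_add) (auto simp: nn_integral_cmult)
    finally show "(\<integral>\<^sup>+r\<in>{t..s}. ennreal ((H r \<omega> + K r \<omega>)\<^sup>2) \<partial>lborel) \<le>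
      2 * (\<integral>\<^sup>+r\<in>{t..s}. ennreal ((H r \<omega>)\<^sup>2) \<partial>lborel)
          + 2 * (\<integral>\<^sup>+r\<in>{t..s}. ennreal ((K r \<omega>)\<^sup>2) \<partial>lborel)" .
  qed
  also have "\<dots> = 2 * mean_square_on M t s H + 2 * mean_square_on M t s K"
    unfolding mean_square_on_def
    using mean_square_on_measurable[OF H ts] mean_square_on_measurable[OF K ts]
    by (simp add: nn_integral_add nn_integral_cmult)
  finally show ?thesis .
qed

lemma mean_square_on_cmult:
  assumes H: "jointly_measurable_on T M H" and ts: "0 \<le> t" "t \<le> s" "s \<le> T"
  shows "mean_square_on M t s (\<lambda>r \<omega>. c * H r \<omega>) = ennreal (c\<^sup>2) * mean_square_on M t s H"
proof -
  have "mean_square_on M t s (\<lambda>r \<omega>. c * H r \<omega>)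
    = (\<integral>\<^sup>+\<omega>. ennreal (c\<^sup>2) * (\<integral>\<^sup>+r\<in>{t..s}. ennreal ((H r \<omega>)\<^sup>2) \<partial>lborel) \<partial>M)"
    unfolding mean_square_on_def
  proof (intro nn_integral_cong)
    fix \<omega> assume \<omega>: "\<omega> \<in> space M"
    have "(\<integral>\<^sup>+r\<in>{t..s}. ennreal ((c * H r \<omega>)\<^sup>2) \<partial>lborel)
      = (\<integral>\<^sup>+r. ennreal (c\<^sup>2) * (ennreal ((H r \<omega>)\<^sup>2) * indicator {t..s} r) \<partial>lborel)"
      by (simp add: power_mult_distrib ennreal_mult mult.assoc)
    also have "\<dots> = ennreal (c\<^sup>2) * (\<integral>\<^sup>+r\<in>{t..s}. ennreal ((H r \<omega>)\<^sup>2) \<partial>lborel)"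
      by (rule nn_integral_cmult[OF mean_square_on_section_measurable[OF H ts \<omega>]])
    finally show "(\<integral>\<^sup>+r\<in>{t..s}. ennreal ((c * H r \<omega>)\<^sup>2) \<partial>lborel)
      = ennreal (c\<^sup>2) * (\<integral>\<^sup>+r\<in>{t..s}. ennreal ((H r \<omega>)\<^sup>2) \<partial>lborel)" .
  qed
  also have "\<dots> = ennreal (c\<^sup>2) * mean_square_on M t s H"
    unfolding mean_square_on_def by (rule nn_integral_cmult) (rule mean_square_on_measurable[OF H ts])
  finally show ?thesis .
qed

lemma mean_square_on_commute:
  "mean_square_on M t s (\<lambda>r \<omega>. H r \<omega> - K r \<omega>) = mean_square_on M t s (\<lambda>r \<omega>. K r \<omega> - H r \<omega>)"
  by (simp add: mean_square_on_def power2_commute)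

lemma mean_square_on_triangle:
  assumes H: "jointly_measurable_on T M H" and K: "jointly_measurable_on T M K"
    and L: "jointly_measurable_on T M L" and ts: "0 \<le> t" "t \<le> s" "s \<le> T"
  shows "mean_square_on M t s (\<lambda>r \<omega>. H r \<omega> - L r \<omega>)
    \<le> 2 * mean_square_on M t s (\<lambda>r \<omega>. H r \<omega> - K r \<omega>) + 2 * mean_square_on M t s (\<lambda>r \<omega>. K r \<omega> - L r \<omega>)"
  using mean_square_on_add[OF jointly_measurable_on_diff[OF H K] jointly_measurable_on_diff[OF K L] ts]
  by simp

lemma mean_square_on_mono_interval:
  assumes "t' \<le> t" "s \<le> s'"
  shows "mean_square_on M t s H \<le> mean_square_on M t' s' H"
  unfolding mean_square_on_def
  by (intro nn_integral_mono) (use assms in \<open>auto simp: indicator_def\<close>)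

lemma mean_square_on_mono:
  assumes "AE \<omega> in M. \<forall>r\<in>{t..s}. \<bar>H r \<omega>\<bar> \<le> \<bar>K r \<omega>\<bar>"
  shows "mean_square_on M t s H \<le> mean_square_on M t s K"
  unfolding mean_square_on_def
proof (rule nn_integral_mono_AE)
  show "AE \<omega> in M. (\<integral>\<^sup>+r\<in>{t..s}. ennreal ((H r \<omega>)\<^sup>2) \<partial>lborel) \<le> (\<integral>\<^sup>+r\<in>{t..s}. ennreal ((K r \<omega>)\<^sup>2) \<partial>lborel)"
    using assms
    by eventually_elim
       (auto intro!: nn_integral_mono ennreal_leI simp: indicator_def abs_le_square_iff)
qed

lemma (in sigma_finite_measure) mean_square_on_Fubini:
  assumes H: "jointly_measurable_on T M H" and ts: "0 \<le> t" "t \<le> s" "s \<le> T"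
  shows "mean_square_on M t s H = (\<integral>\<^sup>+r\<in>{t..s}. mean_square M (H r) \<partial>lborel)"
proof -
  have [measurable]: "(\<lambda>(r, \<omega>). H (max 0 (min T r)) \<omega>) \<in> borel_measurable (borel \<Otimes>\<^sub>M M)"
    using ts by (intro jointly_measurable_on_clamp[OF H]) simp
  interpret P: pair_sigma_finite M lborel ..
  have "mean_square_on M t s H
    = (\<integral>\<^sup>+\<omega>. (\<integral>\<^sup>+r\<in>{t..s}. ennreal ((H (max 0 (min T r)) \<omega>)\<^sup>2) \<partial>lborel) \<partial>M)"
    unfolding mean_square_on_def
    using ts by (intro nn_integral_cong) (auto simp: indicator_def)
  also have "\<dots> = (\<integral>\<^sup>+r. (\<integral>\<^sup>+\<omega>. ennreal ((H (max 0 (min T r)) \<omega>)\<^sup>2) * indicator {t..s} r \<partial>M) \<partial>lborel)"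
    by (subst P.Fubini'[symmetric]) measurable
  also have "\<dots> = (\<integral>\<^sup>+r\<in>{t..s}. mean_square M (H r) \<partial>lborel)"
    unfolding mean_square_def using ts
    by (intro nn_integral_cong) (auto simp: indicator_def)
  finally show ?thesis .
qed

section \<open>Elementary integrals\<close>

text \<open>The coefficients are square integrable rather than bounded, in order to include the process
  \<open>\<xi> 1\<^bsub>(t, s]\<^esub>\<close> whose coefficient \<open>\<xi>\<close> is the value at time \<open>t\<close> of an integrand of linear growth.\<close>

definition sq_elementary ::
  "'a measure \<Rightarrow> (real \<Rightarrow> 'a measure) \<Rightarrow> nat \<Rightarrow> (nat \<Rightarrow> real) \<Rightarrow> (nat \<Rightarrow> 'a \<Rightarrow> real) \<Rightarrow> bool" where
  "sq_elementary M F n \<tau> \<xi> \<longleftrightarrow>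
     0 \<le> \<tau> 0 \<and> (\<forall>i<n. \<tau> i \<le> \<tau> (Suc i)) \<and>
     (\<forall>i<n. \<xi> i \<in> borel_measurable (F (\<tau> i)) \<and> sq_integrable M (\<xi> i))"

lemma sq_elementary_times:
  assumes "sq_elementary M F n \<tau> \<xi>" "i \<le> n"
  shows "0 \<le> \<tau> i"
  using assms(2)
proof (induction i)
  case 0 then show ?case using assms(1) by (simp add: sq_elementary_def)
next
  case (Suc i) 
  then have "\<tau> i \<le> \<tau> (Suc i)" using assms(1) by (simp add: sq_elementary_def)
  then show ?case using Suc by simp
qed

context usual_filtered_prob_space
begin

lemma elementary_integrand_imp_sq:
  assumes "elementary_integrand M F n \<tau> \<xi>"
  shows "sq_elementary M F n \<tau> \<xi>"
proof -
  have *: "0 \<le> \<tau> i" if "i \<le> n" for i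
    using that
  proof (induction i)
    case 0 then show ?case using assms(1) by (simp add: elementary_integrand_def)
  next
    case (Suc i) 
    then have "\<tau> i \<le> \<tau> (Suc i)" using assms(1) by (simp add: elementary_integrand_def)
    then show ?case using Suc by simp
  qed
  have "sq_integrable M (\<xi> i)" if "i < n" for i
  proof -
    have [measurable]: "\<xi> i \<in> borel_measurable M"
      using assms that *[of i] measurable_F[of "\<tau> i" "\<xi> i"] by (simp add: elementary_integrand_def)
    have "bounded (\<xi> i ` space M)" using assms that by (simp add: elementary_integrand_def)
    then obtain B where "\<forall>\<omega>\<in>space M. \<bar>\<xi> i \<omega>\<bar> \<le> B" by (auto simp: bounded_iff)
    then have "\<And>\<omega>. \<omega> \<in> space M \<Longrightarrow> \<bar>\<xi> i \<omega>\<bar> \<le> \<bar>B\<bar>" by fastforce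
    then have "AE \<omega> in M. norm ((\<xi> i \<omega>)\<^sup>2) \<le> B\<^sup>2"
      by (intro AE_I2) (simp add: abs_le_square_iff)
    then have "integrable M (\<lambda>\<omega>. (\<xi> i \<omega>)\<^sup>2)"
      by (intro integrable_const_bound) auto
    then show ?thesis by (simp add: sq_integrable_iff)
  qed
  with assms show ?thesis by (auto simp: sq_elementary_def elementary_integrand_def)
qed

lemma elementary_process_measurable:
  assumes "sq_elementary M F n \<tau> \<xi>"
  shows "jointly_measurable_on T M (elementary_process n \<tau> \<xi>)"
proof (rule jointly_measurable_onI)
  have [measurable]: "\<xi> i \<in> borel_measurable M" if "i < n" for i
    using assms that by (auto simp: sq_elementary_def sq_integrable_iff)
  show "(\<lambda>(s, \<omega>). elementary_process n \<tau> \<xi> s \<omega>) \<in> borel_measurable (borel \<Otimes>\<^sub>M M)"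
    unfolding elementary_process_def by measurable
qed

lemma elementary_integral_measurable:
  assumes "wiener_process M F W" "sq_elementary M F n \<tau> \<xi>" "0 \<le> t"
  shows "elementary_integral W n \<tau> \<xi> t \<in> borel_measurable M"
proof -
  have "\<xi> i \<in> borel_measurable M" "W (min t (\<tau> i)) \<in> borel_measurable M"
     "W (min t (\<tau> (Suc i))) \<in> borel_measurable M" if "i < n" for i
    using assms that sq_elementary_times[OF assms(2), of i] sq_elementary_times[OF assms(2), of "Suc i"]
    by (auto simp: sq_elementary_def sq_integrable_iff intro!: wiener_measurable)
  then show ?thesis unfolding elementary_integral_def
    by (intro borel_measurable_sum borel_measurable_scaleR borel_measurable_diff) auto
qed

lemma elementary_integral_0:
  assumes "sq_elementary M F n \<tau> \<xi>"
  shows "elementary_integral W n \<tau> \<xi> 0 \<omega> = 0"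
  using sq_elementary_times[OF assms] unfolding elementary_integral_def
  by (intro sum.neutral) (auto simp: min_def)

text \<open>Clamping the partition points to \<open>{t..s}\<close> writes an increment as a sum over the same index set,
  with the intervals before \<open>t\<close> and after \<open>s\<close> made degenerate.\<close>

lemma elementary_integral_increment:
  assumes "t \<le> s"
  shows "elementary_integral W n \<tau> \<xi> s \<omega> - elementary_integral W n \<tau> (\<xi> :: nat \<Rightarrow> 'a \<Rightarrow> real) t \<omega>
    = (\<Sum>i<n. (W (max t (min s (\<tau> (Suc i)))) \<omega> - W (max t (min s (\<tau> i))) \<omega>) * \<xi> i \<omega>)"
proof -
  have *: "W (min s r) \<omega> - W (min t r) \<omega> = W (max t (min s r)) \<omega> - W t \<omega>" for r
    using assms by (cases "r \<le> t") (auto simp: min_def max_def)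
  have "(W (min s r) \<omega> - W (min s q) \<omega>) * x - (W (min t r) \<omega> - W (min t q) \<omega>) * x
    = (W (max t (min s r)) \<omega> - W (max t (min s q)) \<omega>) * x" for r q x
    using *[of r] *[of q] by (simp add: left_diff_distrib[symmetric])
  then show ?thesis
    unfolding elementary_integral_def sum_subtractf[symmetric] by simp
qed

text \<open>The isometry for the difference of two elementary integrals: the two families of steps are indexed
  by a disjoint sum, the second one with reversed sign.\<close>

lemma elementary_isometry:
  assumes W: "wiener_process M F W"
    and e: "sq_elementary M F n \<tau> \<xi>" and e': "sq_elementary M F n' \<tau>' \<xi>'"
    and ts: "0 \<le> t" "t \<le> s"
  shows "mean_square M (\<lambda>\<omega>. (elementary_integral W n \<tau> \<xi> s \<omega> - elementary_integral W n \<tau> \<xi> t \<omega>)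
            - (elementary_integral W n' \<tau>' \<xi>' s \<omega> - elementary_integral W n' \<tau>' \<xi>' t \<omega>))
    = mean_square_on M t s (\<lambda>r \<omega>. elementary_process n \<tau> \<xi> r \<omega> - elementary_process n' \<tau>' \<xi>' r \<omega>)"
proof -
  define cl where "cl = (\<lambda>r. max t (min s r))"
  have cl_mono: "x \<le> y \<Longrightarrow> cl x \<le> cl y" and cl0: "0 \<le> cl x" for x y
    using ts by (auto simp: cl_def)
  have cl_ge: "cl x < cl y \<Longrightarrow> x \<le> cl x" for x y
    using ts by (auto simp: cl_def)
  define I where "I = {..<n} <+> {..<n'}"
  define a where "a = case_sum (\<lambda>i. cl (\<tau> i)) (\<lambda>i. cl (\<tau>' i))"
  define b where "b = case_sum (\<lambda>i. cl (\<tau> (Suc i))) (\<lambda>i. cl (\<tau>' (Suc i)))"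
  define z where "z = case_sum \<xi> (\<lambda>i \<omega>. - \<xi>' i \<omega>)"
  have z_meas: "z i \<in> borel_measurable (F (a i))" if "i \<in> I" "a i < b i" for i
  proof (cases i)
    case (Inl j)
    then have "j < n" "cl (\<tau> j) < cl (\<tau> (Suc j))" using that by (auto simp: I_def a_def b_def)
    then show ?thesis using e sq_elementary_times[OF e, of j] cl_ge
      by (auto simp: Inl z_def a_def sq_elementary_def intro: measurable_F_mono[of "\<tau> j"])
  next
    case (Inr j)
    then have "j < n'" "cl (\<tau>' j) < cl (\<tau>' (Suc j))" using that by (auto simp: I_def a_def b_def)
    then show ?thesis using e' sq_elementary_times[OF e', of j] cl_ge
      by (auto simp: Inr z_def a_def sq_elementary_def
          intro!: borel_measurable_uminus intro: measurable_F_mono[of "\<tau>' j"])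
  qed
  have z_sq: "sq_integrable M (z i)" if "i \<in> I" for i
    using that e e' sq_integrable_cmult[where c = "-1" and M = M]
    by (auto simp: I_def z_def sq_elementary_def)
  have ab: "0 \<le> a i" "a i \<le> b i" if "i \<in> I" for i
    using that e e' cl0 cl_mono by (auto simp: I_def a_def b_def sq_elementary_def)
  have fin: "finite I" by (simp add: I_def)
  have sum_I: "(\<Sum>i\<in>I. h i) = (\<Sum>i<n. h (Inl i)) + (\<Sum>i<n'. h (Inr i))" for h :: "nat + nat \<Rightarrow> real"
    by (simp add: I_def sum.Plus)
  have int: "(elementary_integral W n \<tau> \<xi> s \<omega> - elementary_integral W n \<tau> \<xi> t \<omega>)
            - (elementary_integral W n' \<tau>' \<xi>' s \<omega> - elementary_integral W n' \<tau>' \<xi>' t \<omega>)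
      = (\<Sum>i\<in>I. (W (b i) \<omega> - W (a i) \<omega>) * z i \<omega>)" for \<omega>
    unfolding sum_I elementary_integral_increment[OF ts(2)]
    by (simp add: a_def b_def z_def cl_def sum_negf)
  have pro: "(\<Sum>i\<in>I. indicator {a i<..b i} r * z i \<omega>)
      = indicator {t<..s} r * (elementary_process n \<tau> \<xi> r \<omega> - elementary_process n' \<tau>' \<xi>' r \<omega>)" for r \<omega>
  proof -
    have ind: "indicator {cl x<..cl y} r = indicator {x<..y} r * (indicator {t<..s} r :: real)" for x y
      using ts by (auto simp: cl_def indicator_def)
    show ?thesis
      unfolding sum_I elementary_process_def
      by (simp add: a_def b_def z_def ind sum_negf right_diff_distrib sum_distrib_left mult_ac
          del: indicator_simps sum_mult_indicator sum_indicator_mult)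
  qed
  have "mean_square M (\<lambda>\<omega>. (elementary_integral W n \<tau> \<xi> s \<omega> - elementary_integral W n \<tau> \<xi> t \<omega>)
            - (elementary_integral W n' \<tau>' \<xi>' s \<omega> - elementary_integral W n' \<tau>' \<xi>' t \<omega>))
     = (\<integral>\<^sup>+\<omega>. (\<integral>\<^sup>+r. ennreal ((\<Sum>i\<in>I. indicator {a i<..b i} r * z i \<omega>)\<^sup>2) \<partial>lborel) \<partial>M)"
    unfolding int by (rule ito_isometry_steps[OF W fin ab z_sq z_meas])
  also have "\<dots> = mean_square_on M t s (\<lambda>r \<omega>. elementary_process n \<tau> \<xi> r \<omega> - elementary_process n' \<tau>' \<xi>' r \<omega>)"
    unfolding mean_square_on_def pro
  proof (rule nn_integral_cong, rule nn_integral_cong_AE)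
    fix \<omega>
    have "AE r in lborel. r \<noteq> t" by (rule AE_lborel_singleton)
    then show "AE r in lborel. ennreal ((indicator {t<..s} r * (elementary_process n \<tau> \<xi> r \<omega> - elementary_process n' \<tau>' \<xi>' r \<omega>))\<^sup>2)
       = ennreal ((elementary_process n \<tau> \<xi> r \<omega> - elementary_process n' \<tau>' \<xi>' r \<omega>)\<^sup>2) * indicator {t..s} r"
      by eventually_elim (auto simp: indicator_def)
  qed
  finally show ?thesis .
qed

lemma elementary_integral_increment_orthogonal:
  assumes W: "wiener_process M F W" and e: "sq_elementary M F n \<tau> \<xi>" and ts: "0 \<le> t" "t \<le> s"
  defines "D \<equiv> \<lambda>\<omega>. elementary_integral W n \<tau> \<xi> s \<omega> - elementary_integral W n \<tau> \<xi> t \<omega>"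
  shows "sq_integrable M D"
    and "Z \<in> borel_measurable (F t) \<Longrightarrow> sq_integrable M Z \<Longrightarrow> (\<integral>\<omega>. Z \<omega> * D \<omega> \<partial>M) = 0"
proof -
  define p where "p = (\<lambda>i. max t (min s (\<tau> i)))"
  have p: "0 \<le> p i" "t \<le> p i" "i < n \<Longrightarrow> p i \<le> p (Suc i)" for i
    using ts e by (auto simp: p_def sq_elementary_def le_max_iff_disj)
  have De: "D \<omega> = (\<Sum>i<n. \<xi> i \<omega> * (W (p (Suc i)) \<omega> - W (p i) \<omega>))" for \<omega>
    unfolding D_def elementary_integral_increment[OF ts(2)] p_def by (simp add: mult.commute)
  have \<xi>m: "\<xi> i \<in> borel_measurable (F (p i))" if "i < n" "p i < p (Suc i)" for i
  proof -
    have "\<tau> i \<le> p i" using that ts by (auto simp: p_def)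
    with that e sq_elementary_times[OF e, of i] show ?thesis
      by (auto simp: sq_elementary_def intro: measurable_F_mono[of "\<tau> i"])
  qed
  have \<xi>s: "sq_integrable M (\<xi> i)" if "i < n" for i
    using e that by (auto simp: sq_elementary_def)
  have \<xi>W: "sq_integrable M (\<lambda>\<omega>. \<xi> i \<omega> * (W (p (Suc i)) \<omega> - W (p i) \<omega>))" if "i < n" for i
    by (rule sq_integrable_mult_wiener_increment[OF W p(1) p(3) \<xi>s \<xi>m]) (use that in auto)
  then show "sq_integrable M D" unfolding De by (intro sq_integrable_sum) auto
  assume Z: "Z \<in> borel_measurable (F t)" "sq_integrable M Z"
  have zero: "(\<integral>\<omega>. Z \<omega> * (\<xi> i \<omega> * (W (p (Suc i)) \<omega> - W (p i) \<omega>)) \<partial>M) = 0" if "i < n" for i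
  proof (cases "p i < p (Suc i)")
    case False
    then have eq: "p (Suc i) = p i" using p(3)[OF that] by simp
    show ?thesis unfolding eq by simp
  next
    case True
    have m: "(\<lambda>\<omega>. Z \<omega> * \<xi> i \<omega>) \<in> borel_measurable (F (p i))"
      using measurable_F_mono[OF ts(1) p(2) Z(1)] \<xi>m[OF that True] by (rule borel_measurable_times)
    have ii: "integrable M (\<lambda>\<omega>. Z \<omega> * \<xi> i \<omega>)" by (rule sq_integrable_mult[OF Z(2) \<xi>s[OF that]])
    show ?thesis
      using wiener_increment_indep(2)[OF W p(1) p(3)[OF that] m ii, of 1]
        wiener_increment_moments(2)[OF W p(1) p(3)[OF that]]
      by (simp add: mult.assoc)
  qed
  have "integrable M (\<lambda>\<omega>. Z \<omega> * (\<xi> i \<omega> * (W (p (Suc i)) \<omega> - W (p i) \<omega>)))" if "i < n" for i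
    by (rule sq_integrable_mult[OF Z(2) \<xi>W[OF that]])
  then show "(\<integral>\<omega>. Z \<omega> * D \<omega> \<partial>M) = 0"
    unfolding De sum_distrib_left by (subst Bochner_Integration.integral_sum) (auto simp: zero)
qed

section \<open>Increments of the Ito integral\<close>

text \<open>The integrals at \<open>t\<close> and at \<open>s\<close> come with unrelated approximating sequences. The sequence for the
  later time \<open>s\<close> also works at \<open>t\<close>: on \<open>{0..t}\<close> both sequences of elementary processes converge to
  \<open>H\<close>, so by the isometry their integrals at \<open>t\<close> have the same limit.\<close>

lemma ito_increment_approximation:
  fixes H :: "real \<Rightarrow> 'a \<Rightarrow> real"
  assumes W: "wiener_process M F W" and ts: "0 \<le> t" "t \<le> s"
    and t: "has_ito_integral M F W t H Yt" and s: "has_ito_integral M F W s H Ys"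
  obtains n \<tau> \<xi> where "\<And>j::nat. sq_elementary M F (n j) (\<tau> j) (\<xi> j)"
    and "(\<lambda>j. mean_square_on M 0 s (\<lambda>r \<omega>. H r \<omega> - elementary_process (n j) (\<tau> j) (\<xi> j) r \<omega>)) \<longlonglongrightarrow> 0"
    and "(\<lambda>j. mean_square M (\<lambda>\<omega>. (Ys \<omega> - Yt \<omega>) -
      (elementary_integral W (n j) (\<tau> j) (\<xi> j) s \<omega> - elementary_integral W (n j) (\<tau> j) (\<xi> j) t \<omega>))) \<longlonglongrightarrow> 0"
proof -
  from s obtain n \<tau> \<xi> where e: "\<And>j. elementary_integrand M F (n j) (\<tau> j) (\<xi> j)"
    and p: "(\<lambda>j. mean_square_on M 0 s (\<lambda>r \<omega>. H r \<omega> - elementary_process (n j) (\<tau> j) (\<xi> j) r \<omega>)) \<longlonglongrightarrow> 0"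
    and i: "(\<lambda>j. mean_square M (\<lambda>\<omega>. Ys \<omega> - elementary_integral W (n j) (\<tau> j) (\<xi> j) s \<omega>)) \<longlonglongrightarrow> 0"
    unfolding has_ito_integral_def mean_square_def mean_square_on_def by auto
  from t obtain n' \<tau>' \<xi>' where e': "\<And>j. elementary_integrand M F (n' j) (\<tau>' j) (\<xi>' j)"
    and p': "(\<lambda>j. mean_square_on M 0 t (\<lambda>r \<omega>. H r \<omega> - elementary_process (n' j) (\<tau>' j) (\<xi>' j) r \<omega>)) \<longlonglongrightarrow> 0"
    and i': "(\<lambda>j. mean_square M (\<lambda>\<omega>. Yt \<omega> - elementary_integral W (n' j) (\<tau>' j) (\<xi>' j) t \<omega>)) \<longlonglongrightarrow> 0"
    unfolding has_ito_integral_def mean_square_def mean_square_on_def by auto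
  note e = elementary_integrand_imp_sq[OF e] and e' = elementary_integrand_imp_sq[OF e']
  let ?E = "\<lambda>j. elementary_process (n j) (\<tau> j) (\<xi> j)" and ?E' = "\<lambda>j. elementary_process (n' j) (\<tau>' j) (\<xi>' j)"
  let ?I = "\<lambda>j. elementary_integral W (n j) (\<tau> j) (\<xi> j)" and ?I' = "\<lambda>j. elementary_integral W (n' j) (\<tau>' j) (\<xi>' j)"
  have [measurable]: "Yt \<in> borel_measurable M" "Ys \<in> borel_measurable M"
    using t s by (auto simp: has_ito_integral_def)
  have [measurable]: "?I j t \<in> borel_measurable M" "?I j s \<in> borel_measurable M" "?I' j t \<in> borel_measurable M" for j
    using elementary_integral_measurable[OF W e] elementary_integral_measurable[OF W e'] ts by auto
  have H: "jointly_measurable_on t M H"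
    using t by (simp add: has_ito_integral_def jointly_measurable_on_def)
  define u where "u = (\<lambda>j. 2 * mean_square_on M 0 s (\<lambda>r \<omega>. H r \<omega> - ?E j r \<omega>)
                          + 2 * mean_square_on M 0 t (\<lambda>r \<omega>. H r \<omega> - ?E' j r \<omega>))"
  have 1: "mean_square M (\<lambda>\<omega>. ?I j t \<omega> - ?I' j t \<omega>) \<le> u j" for j
  proof -
    have "mean_square M (\<lambda>\<omega>. ?I j t \<omega> - ?I' j t \<omega>)
      = mean_square_on M 0 t (\<lambda>r \<omega>. ?E j r \<omega> - ?E' j r \<omega>)"
      using elementary_isometry[OF W e e' order_refl ts(1), of j j]
      by (simp add: elementary_integral_0[OF e] elementary_integral_0[OF e'])
    also have "\<dots> \<le> 2 * mean_square_on M 0 t (\<lambda>r \<omega>. ?E j r \<omega> - H r \<omega>)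
      + 2 * mean_square_on M 0 t (\<lambda>r \<omega>. H r \<omega> - ?E' j r \<omega>)"
      using ts by (intro mean_square_on_triangle[OF elementary_process_measurable[OF e] H
          elementary_process_measurable[OF e']]) auto
    also have "\<dots> \<le> u j"
      unfolding u_def mean_square_on_commute[of M 0 t "?E j"]
      using ts by (intro add_mono mult_left_mono order_refl mean_square_on_mono_interval) auto
    finally show ?thesis .
  qed
  define v where "v = (\<lambda>j. 2 * mean_square M (\<lambda>\<omega>. Ys \<omega> - ?I j s \<omega>) +
     2 * (2 * mean_square M (\<lambda>\<omega>. Yt \<omega> - ?I' j t \<omega>) + 2 * u j))"
  have le: "mean_square M (\<lambda>\<omega>. (Ys \<omega> - Yt \<omega>) - (?I j s \<omega> - ?I j t \<omega>)) \<le> v j" for j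
  proof -
    have "mean_square M (\<lambda>\<omega>. Yt \<omega> - ?I j t \<omega>)
      = mean_square M (\<lambda>\<omega>. (Yt \<omega> - ?I' j t \<omega>) - (?I j t \<omega> - ?I' j t \<omega>))"
      by (intro mean_square_cong) auto
    also have "\<dots> \<le> 2 * mean_square M (\<lambda>\<omega>. Yt \<omega> - ?I' j t \<omega>) + 2 * mean_square M (\<lambda>\<omega>. ?I j t \<omega> - ?I' j t \<omega>)"
      by (intro mean_square_diff) auto
    also have "\<dots> \<le> 2 * mean_square M (\<lambda>\<omega>. Yt \<omega> - ?I' j t \<omega>) + 2 * u j"
      by (intro add_mono mult_left_mono order_refl 1) simp
    finally have 2: "mean_square M (\<lambda>\<omega>. Yt \<omega> - ?I j t \<omega>)
      \<le> 2 * mean_square M (\<lambda>\<omega>. Yt \<omega> - ?I' j t \<omega>) + 2 * u j" .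
    have "mean_square M (\<lambda>\<omega>. (Ys \<omega> - Yt \<omega>) - (?I j s \<omega> - ?I j t \<omega>))
      = mean_square M (\<lambda>\<omega>. (Ys \<omega> - ?I j s \<omega>) - (Yt \<omega> - ?I j t \<omega>))"
      by (intro mean_square_cong) auto
    also have "\<dots> \<le> 2 * mean_square M (\<lambda>\<omega>. Ys \<omega> - ?I j s \<omega>) + 2 * mean_square M (\<lambda>\<omega>. Yt \<omega> - ?I j t \<omega>)"
      by (intro mean_square_diff) auto
    also have "\<dots> \<le> v j"
      unfolding v_def by (intro add_mono mult_left_mono order_refl 2) simp
    finally show ?thesis .
  qed
  have lim: "v \<longlonglongrightarrow> 2 * 0 + 2 * (2 * 0 + 2 * (2 * 0 + 2 * 0))"
    unfolding v_def u_def 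
    by (intro tendsto_add ennreal_tendsto_cmult p p' i i') simp_all
  have "(\<lambda>j. mean_square M (\<lambda>\<omega>. (Ys \<omega> - Yt \<omega>) - (?I j s \<omega> - ?I j t \<omega>))) \<longlonglongrightarrow> 0"
  proof (rule tendsto_sandwich[where f = "\<lambda>_. 0" and h = v])
    show "v \<longlonglongrightarrow> 0" using lim by simp
  qed (simp_all add: le)
  from that[OF e p this] show thesis .
qed

text \<open>The isometry up to a factor 4, which comes from using \<open>(x + y)\<^sup>2 \<le> 2 x\<^sup>2 + 2 y\<^sup>2\<close> twice in the
  passage to the limit; later only orders of magnitude matter. With \<open>\<xi> = 0\<close> it bounds increments, and
  with \<open>\<xi>\<close> equal to the integrand at time \<open>t\<close> it bounds the error of freezing the integrand.\<close>

lemma ito_increment_mean_square: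
  fixes H :: "real \<Rightarrow> 'a \<Rightarrow> real"
  assumes W: "wiener_process M F W" and ts: "0 \<le> t" "t \<le> s"
    and t: "has_ito_integral M F W t H Yt" and s: "has_ito_integral M F W s H Ys"
    and \<xi>: "\<xi> \<in> borel_measurable (F t)" "sq_integrable M \<xi>"
  shows "mean_square M (\<lambda>\<omega>. Ys \<omega> - Yt \<omega> - \<xi> \<omega> * (W s \<omega> - W t \<omega>))
    \<le> 4 * mean_square_on M t s (\<lambda>r \<omega>. H r \<omega> - \<xi> \<omega>)"
proof -
  obtain n \<tau> z where e: "\<And>j::nat. sq_elementary M F (n j) (\<tau> j) (z j)"
    and p: "(\<lambda>j. mean_square_on M 0 s (\<lambda>r \<omega>. H r \<omega> - elementary_process (n j) (\<tau> j) (z j) r \<omega>)) \<longlonglongrightarrow> 0"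
    and i: "(\<lambda>j. mean_square M (\<lambda>\<omega>. (Ys \<omega> - Yt \<omega>) -
      (elementary_integral W (n j) (\<tau> j) (z j) s \<omega> - elementary_integral W (n j) (\<tau> j) (z j) t \<omega>))) \<longlonglongrightarrow> 0"
    by (rule ito_increment_approximation[OF W ts t s]) (rule that)
  let ?E = "\<lambda>j. elementary_process (n j) (\<tau> j) (z j)"
  let ?D = "\<lambda>j \<omega>. elementary_integral W (n j) (\<tau> j) (z j) s \<omega> - elementary_integral W (n j) (\<tau> j) (z j) t \<omega>"
  define \<tau>1 where "\<tau>1 = (\<lambda>i::nat. if i = 0 then t else s)"
  have e1: "sq_elementary M F 1 \<tau>1 (\<lambda>_. \<xi>)"
    using ts \<xi> by (simp add: sq_elementary_def \<tau>1_def)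
  have I1: "elementary_integral W 1 \<tau>1 (\<lambda>_. \<xi>) s \<omega> - elementary_integral W 1 \<tau>1 (\<lambda>_. \<xi>) t \<omega>
    = \<xi> \<omega> * (W s \<omega> - W t \<omega>)" for \<omega>
    using ts by (simp add: elementary_integral_def \<tau>1_def min_absorb2)
  have \<xi>M [measurable]: "\<xi> \<in> borel_measurable M" using \<xi> by (simp add: sq_integrable_iff)
  have [measurable]: "Yt \<in> borel_measurable M" "Ys \<in> borel_measurable M"
     "W t \<in> borel_measurable M" "W s \<in> borel_measurable M"
    using t s ts by (simp_all add: has_ito_integral_def wiener_measurable[OF W])
  have [measurable]: "?D j \<in> borel_measurable M" for j
    using elementary_integral_measurable[OF W e] ts by (intro borel_measurable_diff) auto
  have H: "jointly_measurable_on s M H"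
    using s by (simp add: has_ito_integral_def jointly_measurable_on_def)
  define c where "c = mean_square_on M t s (\<lambda>r \<omega>. H r \<omega> - \<xi> \<omega>)"
  define u where "u = (\<lambda>j. 2 * mean_square M (\<lambda>\<omega>. (Ys \<omega> - Yt \<omega>) - ?D j \<omega>)
     + 2 * (2 * mean_square_on M 0 s (\<lambda>r \<omega>. H r \<omega> - ?E j r \<omega>) + 2 * c))"
  have le: "mean_square M (\<lambda>\<omega>. Ys \<omega> - Yt \<omega> - \<xi> \<omega> * (W s \<omega> - W t \<omega>)) \<le> u j" for j
  proof -
    have "mean_square M (\<lambda>\<omega>. ?D j \<omega> - \<xi> \<omega> * (W s \<omega> - W t \<omega>))
      = mean_square_on M t s (\<lambda>r \<omega>. ?E j r \<omega> - elementary_process 1 \<tau>1 (\<lambda>_. \<xi>) r \<omega>)"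
      using elementary_isometry[OF W e e1 ts, of j] unfolding I1 .
    also have "\<dots> = mean_square_on M t s (\<lambda>r \<omega>. ?E j r \<omega> - \<xi> \<omega>)"
      unfolding mean_square_on_def
    proof (rule nn_integral_cong, rule nn_integral_cong_AE)
      fix \<omega>
      have "AE r in lborel. r \<noteq> t" by (rule AE_lborel_singleton)
      then show "AE r in lborel.
        ennreal ((?E j r \<omega> - elementary_process 1 \<tau>1 (\<lambda>_. \<xi>) r \<omega>)\<^sup>2) * indicator {t..s} r
        = ennreal ((?E j r \<omega> - \<xi> \<omega>)\<^sup>2) * indicator {t..s} r"
        by eventually_elim (auto simp: elementary_process_def \<tau>1_def indicator_def)
    qed
    also have "\<dots> \<le> 2 * mean_square_on M t s (\<lambda>r \<omega>. ?E j r \<omega> - H r \<omega>) + 2 * c"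
      unfolding c_def
      by (rule mean_square_on_triangle[OF elementary_process_measurable[OF e] H
          jointly_measurable_on_const[OF \<xi>M] ts order_refl])
    also have "\<dots> \<le> 2 * mean_square_on M 0 s (\<lambda>r \<omega>. H r \<omega> - ?E j r \<omega>) + 2 * c"
      unfolding mean_square_on_commute[of M t s "?E j"]
      using ts by (intro add_mono mult_left_mono order_refl mean_square_on_mono_interval) auto
    finally have 1: "mean_square M (\<lambda>\<omega>. ?D j \<omega> - \<xi> \<omega> * (W s \<omega> - W t \<omega>))
      \<le> 2 * mean_square_on M 0 s (\<lambda>r \<omega>. H r \<omega> - ?E j r \<omega>) + 2 * c" .
    have "mean_square M (\<lambda>\<omega>. Ys \<omega> - Yt \<omega> - \<xi> \<omega> * (W s \<omega> - W t \<omega>))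
      = mean_square M (\<lambda>\<omega>. ((Ys \<omega> - Yt \<omega>) - ?D j \<omega>) + (?D j \<omega> - \<xi> \<omega> * (W s \<omega> - W t \<omega>)))"
      by (intro mean_square_cong) auto
    also have "\<dots> \<le> 2 * mean_square M (\<lambda>\<omega>. (Ys \<omega> - Yt \<omega>) - ?D j \<omega>)
        + 2 * mean_square M (\<lambda>\<omega>. ?D j \<omega> - \<xi> \<omega> * (W s \<omega> - W t \<omega>))"
      by (intro mean_square_add) auto
    also have "\<dots> \<le> u j"
      unfolding u_def by (intro add_mono mult_left_mono order_refl 1) simp
    finally show ?thesis .
  qed
  have lim: "u \<longlonglongrightarrow> 2 * 0 + 2 * (2 * 0 + 2 * c)"
    unfolding u_def 
    by (intro tendsto_add ennreal_tendsto_cmult tendsto_const p i) simp_all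
  have "mean_square M (\<lambda>\<omega>. Ys \<omega> - Yt \<omega> - \<xi> \<omega> * (W s \<omega> - W t \<omega>)) \<le> 2 * 0 + 2 * (2 * 0 + 2 * c)"
    by (rule LIMSEQ_le_const[OF lim]) (use le in blast)
  then show ?thesis by (simp add: c_def mult.assoc[symmetric])
qed

lemma ito_integral_sq_integrable:
  fixes H :: "real \<Rightarrow> 'a \<Rightarrow> real"
  assumes W: "wiener_process M F W" and t: "0 \<le> t" "has_ito_integral M F W t H Y"
  shows "sq_integrable M Y"
proof -
  from t obtain n \<tau> \<xi> where e: "\<And>j. elementary_integrand M F (n j) (\<tau> j) (\<xi> j)"
    and i: "(\<lambda>j::nat. mean_square M (\<lambda>\<omega>. Y \<omega> - elementary_integral W (n j) (\<tau> j) (\<xi> j) t \<omega>)) \<longlonglongrightarrow> 0"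
    unfolding has_ito_integral_def mean_square_def by auto
  have Y [measurable]: "Y \<in> borel_measurable M" using t by (simp add: has_ito_integral_def)
  have "eventually (\<lambda>j. mean_square M (\<lambda>\<omega>. Y \<omega> - elementary_integral W (n j) (\<tau> j) (\<xi> j) t \<omega>) < 1) sequentially"
    using order_tendstoD(2)[OF i, of 1] by simp
  then obtain j where j: "mean_square M (\<lambda>\<omega>. Y \<omega> - elementary_integral W (n j) (\<tau> j) (\<xi> j) t \<omega>) < 1"
    by (auto simp: eventually_sequentially)
  note ej = elementary_integrand_imp_sq[OF e, of j]
  have Im: "elementary_integral W (n j) (\<tau> j) (\<xi> j) t \<in> borel_measurable M"
    by (rule elementary_integral_measurable[OF W ej t(1)])
  have "sq_integrable M (\<lambda>\<omega>. Y \<omega> - elementary_integral W (n j) (\<tau> j) (\<xi> j) t \<omega>)"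
    using j Im by (auto simp: sq_integrable_def intro: less_trans)
  moreover have "sq_integrable M (elementary_integral W (n j) (\<tau> j) (\<xi> j) t)"
    using elementary_integral_increment_orthogonal(1)[OF W ej order_refl t(1)]
    by (simp add: elementary_integral_0[OF ej])
  ultimately have "sq_integrable M (\<lambda>\<omega>. (Y \<omega> - elementary_integral W (n j) (\<tau> j) (\<xi> j) t \<omega>)
     + elementary_integral W (n j) (\<tau> j) (\<xi> j) t \<omega>)" by (rule sq_integrable_add)
  then show ?thesis by simp
qed

text \<open>The martingale property, tested against a random variable known at time \<open>t\<close>. It holds for
  elementary integrals and passes to the mean-square limit by the Cauchy-Schwarz inequality.\<close>

lemma ito_increment_orthogonal:
  fixes H :: "real \<Rightarrow> 'a \<Rightarrow> real"
  assumes W: "wiener_process M F W" and ts: "0 \<le> t" "t \<le> s"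
    and t: "has_ito_integral M F W t H Yt" and s: "has_ito_integral M F W s H Ys"
    and Z: "Z \<in> borel_measurable (F t)" "sq_integrable M Z"
  shows "(\<integral>\<omega>. Z \<omega> * (Ys \<omega> - Yt \<omega>) \<partial>M) = 0"
proof -
  obtain n \<tau> z where e: "\<And>j::nat. sq_elementary M F (n j) (\<tau> j) (z j)"
    and "(\<lambda>j. mean_square_on M 0 s (\<lambda>r \<omega>. H r \<omega> - elementary_process (n j) (\<tau> j) (z j) r \<omega>)) \<longlonglongrightarrow> 0"
    and i: "(\<lambda>j. mean_square M (\<lambda>\<omega>. (Ys \<omega> - Yt \<omega>) -
      (elementary_integral W (n j) (\<tau> j) (z j) s \<omega> - elementary_integral W (n j) (\<tau> j) (z j) t \<omega>))) \<longlonglongrightarrow> 0"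
    by (rule ito_increment_approximation[OF W ts t s]) (rule that)
  let ?D = "\<lambda>j \<omega>. elementary_integral W (n j) (\<tau> j) (z j) s \<omega> - elementary_integral W (n j) (\<tau> j) (z j) t \<omega>"
  have Y: "sq_integrable M (\<lambda>\<omega>. Ys \<omega> - Yt \<omega>)"
    using ts by (intro sq_integrable_diff ito_integral_sq_integrable[OF W _ t] ito_integral_sq_integrable[OF W _ s]) auto
  note D = elementary_integral_increment_orthogonal(1)[OF W e ts]
  note D0 = elementary_integral_increment_orthogonal(2)[OF W e ts Z]
  have le: "ennreal ((\<integral>\<omega>. Z \<omega> * (Ys \<omega> - Yt \<omega>) \<partial>M)\<^sup>2)
     \<le> mean_square M Z * mean_square M (\<lambda>\<omega>. (Ys \<omega> - Yt \<omega>) - ?D j \<omega>)" for j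
  proof -
    have "(\<integral>\<omega>. Z \<omega> * ((Ys \<omega> - Yt \<omega>) - ?D j \<omega>) \<partial>M) = (\<integral>\<omega>. Z \<omega> * (Ys \<omega> - Yt \<omega>) - Z \<omega> * ?D j \<omega> \<partial>M)"
      by (simp add: right_diff_distrib)
    also have "\<dots> = (\<integral>\<omega>. Z \<omega> * (Ys \<omega> - Yt \<omega>) \<partial>M)"
      using sq_integrable_mult[OF Z(2) Y] sq_integrable_mult[OF Z(2) D] D0
      by (subst Bochner_Integration.integral_diff) auto
    finally have "(\<integral>\<omega>. Z \<omega> * ((Ys \<omega> - Yt \<omega>) - ?D j \<omega>) \<partial>M) = (\<integral>\<omega>. Z \<omega> * (Ys \<omega> - Yt \<omega>) \<partial>M)" .
    with integral_mult_square_le[OF Z(2) sq_integrable_diff[OF Y D[of j]]] show ?thesis by metis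
  qed
  have "(\<lambda>j. mean_square M Z * mean_square M (\<lambda>\<omega>. (Ys \<omega> - Yt \<omega>) - ?D j \<omega>)) \<longlonglongrightarrow> mean_square M Z * 0"
    using Z(2) by (intro ennreal_tendsto_cmult i) (simp add: sq_integrable_def)
  from LIMSEQ_le_const[OF this] le
  have "ennreal ((\<integral>\<omega>. Z \<omega> * (Ys \<omega> - Yt \<omega>) \<partial>M)\<^sup>2) \<le> mean_square M Z * 0" by blast
  then show ?thesis by (simp add: ennreal_eq_0_iff)
qed

end

section \<open>Short time intervals\<close>

text \<open>Absolute continuity of the integral: \<open>g\<close> exceeds its truncation at a high level \<open>N\<close> only by a
  function of small integral, and the truncation contributes at most \<open>N (s - t)\<close>.\<close>

lemma nn_integral_interval_small:
  fixes g :: "real \<Rightarrow> ennreal"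
  assumes [measurable]: "g \<in> borel_measurable borel"
    and fin: "(\<integral>\<^sup>+r\<in>{a..b}. g r \<partial>lborel) < \<infinity>" and "0 < (\<epsilon>::real)"
  shows "\<exists>\<delta>>0. \<forall>t s. a \<le> t \<longrightarrow> t \<le> s \<longrightarrow> s \<le> b \<longrightarrow> s - t < \<delta> \<longrightarrow> (\<integral>\<^sup>+r\<in>{t..s}. g r \<partial>lborel) \<le> ennreal \<epsilon>"
proof -
  have "(\<lambda>N. \<integral>\<^sup>+r. (g r - min (g r) (of_nat N)) * indicator {a..b} r \<partial>lborel) \<longlonglongrightarrow> (\<integral>\<^sup>+(r::real). 0 \<partial>lborel)"
  proof (rule nn_integral_dominated_convergence[where w = "\<lambda>r. g r * indicator {a..b} r"])
    show "AE r in lborel. (g r - min (g r) (of_nat N)) * indicator {a..b} r \<le> g r * indicator {a..b} r" for N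
      by (intro AE_I2 mult_right_mono) (auto simp: diff_le_self_ennreal)
    show "AE r in lborel. (\<lambda>N. (g r - min (g r) (of_nat N)) * indicator {a..b} r) \<longlonglongrightarrow> 0"
    proof -
      have "AE r in lborel. g r * indicator {a..b} r \<noteq> \<infinity>"
        using fin by (intro nn_integral_PInf_AE) auto
      then show ?thesis
      proof eventually_elim
        case (elim r)
        show ?case
        proof (cases "r \<in> {a..b}")
          case True
          then have "g r < top" using elim by (simp add: less_top)
          then obtain n where "g r \<le> of_nat n"
            by (metis ennreal_Ex_less_of_nat less_imp_le)
          then have "g r - min (g r) (of_nat N) = 0" if "N \<ge> n" for N
          proof -
            have "g r \<le> of_nat N" using \<open>g r \<le> of_nat n\<close> that by (meson of_nat_mono order_trans)
            then show ?thesis using \<open>g r < top\<close> by (simp add: min_absorb1 ennreal_minus_eq_0)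
          qed
          then have "eventually (\<lambda>N. (g r - min (g r) (of_nat N)) * indicator {a..b} r = 0) sequentially"
            by (auto simp: eventually_sequentially)
          then show ?thesis by (rule tendsto_eventually)
        qed simp
      qed
    qed
    show "(\<integral>\<^sup>+r. g r * indicator {a..b} r \<partial>lborel) < \<infinity>" by (rule fin)
  qed measurable
  then have "(\<lambda>N. \<integral>\<^sup>+r. (g r - min (g r) (of_nat N)) * indicator {a..b} r \<partial>lborel) \<longlonglongrightarrow> 0" by simp
  from order_tendstoD(2)[OF this, of "ennreal (\<epsilon> / 2)"] \<open>0 < \<epsilon>\<close>
  obtain N where N: "(\<integral>\<^sup>+r. (g r - min (g r) (of_nat N)) * indicator {a..b} r \<partial>lborel) < ennreal (\<epsilon> / 2)"
    by (auto simp: eventually_sequentially)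
  have "(\<integral>\<^sup>+r\<in>{t..s}. g r \<partial>lborel) \<le> ennreal \<epsilon>"
    if "a \<le> t" "t \<le> s" "s \<le> b" "s - t < \<epsilon> / (2 * (real N + 1))" for t s
  proof -
    have "(\<integral>\<^sup>+r\<in>{t..s}. g r \<partial>lborel)
      \<le> (\<integral>\<^sup>+r. of_nat N * indicator {t..s} r + (g r - min (g r) (of_nat N)) * indicator {a..b} r \<partial>lborel)"
    proof (intro nn_integral_mono)
      fix r
      have "g r \<le> of_nat N + (g r - min (g r) (of_nat N))"
        by (cases "g r \<le> of_nat N") (auto simp: min_def ennreal_minus_eq_0 add_increasing2 add_diff_inverse_ennreal)
      then show "g r * indicator {t..s} r \<le> of_nat N * indicator {t..s} r + (g r - min (g r) (of_nat N)) * indicator {a..b} r"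
        using that by (auto simp: indicator_def)
    qed
    also have "\<dots> = of_nat N * ennreal (s - t) + (\<integral>\<^sup>+r. (g r - min (g r) (of_nat N)) * indicator {a..b} r \<partial>lborel)"
      using that by (subst nn_integral_add) (auto simp: nn_integral_cmult)
    also have "\<dots> \<le> ennreal (\<epsilon> / 2) + ennreal (\<epsilon> / 2)"
    proof (intro add_mono)
      have "real N * (s - t) \<le> (real N + 1) * (\<epsilon> / (2 * (real N + 1)))"
        using that by (intro mult_mono) auto
      also have "\<dots> = \<epsilon> / 2" by (simp add: field_simps)
      finally show "of_nat N * ennreal (s - t) \<le> ennreal (\<epsilon> / 2)"
        using that by (simp add: ennreal_of_nat_eq_real_of_nat ennreal_mult[symmetric] ennreal_leI)
      show "(\<integral>\<^sup>+r. (g r - min (g r) (of_nat N)) * indicator {a..b} r \<partial>lborel) \<le> ennreal (\<epsilon> / 2)"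
        using N by simp
    qed
    also have "\<dots> = ennreal \<epsilon>" using \<open>0 < \<epsilon>\<close> by (simp flip: ennreal_plus)
    finally show ?thesis .
  qed
  moreover have "0 < \<epsilon> / (2 * (real N + 1))" using \<open>0 < \<epsilon>\<close> by simp
  ultimately show ?thesis by blast
qed

lemma (in sigma_finite_measure) mean_square_on_small:
  assumes H: "jointly_measurable_on T M H" and T: "0 \<le> T"
    and fin: "mean_square_on M 0 T H < \<infinity>" and "0 < (\<epsilon>::real)"
  shows "\<exists>\<delta>>0. \<forall>t s. 0 \<le> t \<longrightarrow> t \<le> s \<longrightarrow> s \<le> T \<longrightarrow> s - t < \<delta> \<longrightarrow> mean_square_on M t s H \<le> ennreal \<epsilon>"
proof -
  define g where "g = (\<lambda>r. mean_square M (H (max 0 (min T r))))"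
  have [measurable]: "(\<lambda>(r, \<omega>). H (max 0 (min T r)) \<omega>) \<in> borel_measurable (borel \<Otimes>\<^sub>M M)"
    using T by (intro jointly_measurable_on_clamp[OF H])
  have g[measurable]: "g \<in> borel_measurable borel" unfolding g_def mean_square_def by measurable
  have eq: "mean_square_on M t s H = (\<integral>\<^sup>+r\<in>{t..s}. g r \<partial>lborel)" if "0 \<le> t" "t \<le> s" "s \<le> T" for t s
    unfolding mean_square_on_Fubini[OF H that] g_def
    using that by (intro nn_integral_cong) (auto simp: indicator_def)
  have "(\<integral>\<^sup>+r\<in>{0..T}. g r \<partial>lborel) < \<infinity>" using fin eq[of 0 T] T by simp
  from nn_integral_interval_small[OF g this \<open>0 < \<epsilon>\<close>] show ?thesis using eq by metis
qed

lemma (in sigma_finite_measure) mean_square_on_le: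
  assumes H: "jointly_measurable_on T M H" and ts: "0 \<le> t" "t \<le> s" "s \<le> T"
    and le: "\<And>r. t \<le> r \<Longrightarrow> r \<le> s \<Longrightarrow> mean_square M (H r) \<le> ennreal c" and c: "0 \<le> c"
  shows "mean_square_on M t s H \<le> ennreal (c * (s - t))"
proof -
  have "mean_square_on M t s H \<le> (\<integral>\<^sup>+r. ennreal c * indicator {t..s} r \<partial>lborel)"
    unfolding mean_square_on_Fubini[OF H ts]
    by (intro nn_integral_mono) (auto simp: indicator_def le)
  also have "\<dots> = ennreal (c * (s - t))"
    using ts c by (simp add: nn_integral_cmult ennreal_mult)
  finally show ?thesis .
qed

lemma mean_square_tendsto_0_at_right:
  fixes g :: "real \<Rightarrow> 'a \<Rightarrow> real"
  assumes g: "\<And>r. t < r \<Longrightarrow> g r \<in> borel_measurable M" and U: "sq_integrable M U"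
    and le: "AE \<omega> in M. \<forall>r>t. \<bar>g r \<omega>\<bar> \<le> \<bar>U \<omega>\<bar>"
    and lim: "AE \<omega> in M. ((\<lambda>r. g r \<omega>) \<longlongrightarrow> 0) (at_right t)"
  shows "((\<lambda>r. mean_square M (g r)) \<longlongrightarrow> 0) (at_right t)"
proof (rule tendsto_at_right_sequentially[of t "t + 1"])
  fix S :: "nat \<Rightarrow> real"
  assume S: "\<And>n. t < S n" "S \<longlonglongrightarrow> t"
  have Um[measurable]: "U \<in> borel_measurable M" using U by (simp add: sq_integrable_iff)
  have [measurable]: "g (S n) \<in> borel_measurable M" for n using g S by simp
  have S': "filterlim S (at_right t) sequentially"
    using S by (auto simp: filterlim_at less_imp_neq[symmetric])
  have "(\<lambda>n. \<integral>\<^sup>+\<omega>. ennreal ((g (S n) \<omega>)\<^sup>2) \<partial>M) \<longlonglongrightarrow> (\<integral>\<^sup>+\<omega>. 0 \<partial>M)"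
  proof (rule nn_integral_dominated_convergence[where w = "\<lambda>\<omega>. ennreal ((U \<omega>)\<^sup>2)"])
    show "AE \<omega> in M. ennreal ((g (S n) \<omega>)\<^sup>2) \<le> ennreal ((U \<omega>)\<^sup>2)" for n
      using le by eventually_elim (use S in \<open>auto intro!: ennreal_leI simp: abs_le_square_iff[symmetric]\<close>)
    show "(\<integral>\<^sup>+\<omega>. ennreal ((U \<omega>)\<^sup>2) \<partial>M) < \<infinity>" using U by (simp add: sq_integrable_def mean_square_def)
    show "AE \<omega> in M. (\<lambda>n. ennreal ((g (S n) \<omega>)\<^sup>2)) \<longlonglongrightarrow> 0"
      using lim
    proof eventually_elim
      case (elim \<omega>)
      have "(\<lambda>n. g (S n) \<omega>) \<longlonglongrightarrow> 0" using filterlim_compose[OF elim S'] .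
      then have "(\<lambda>n. (g (S n) \<omega>)\<^sup>2) \<longlonglongrightarrow> 0\<^sup>2" by (intro tendsto_power)
      then have "(\<lambda>n. ennreal ((g (S n) \<omega>)\<^sup>2)) \<longlonglongrightarrow> ennreal (0\<^sup>2)" by (rule tendsto_ennrealI)
      then show ?case by simp
    qed
  qed measurable
  then show "(\<lambda>n. mean_square M (g (S n))) \<longlonglongrightarrow> 0" by (simp add: mean_square_def)
qed simp

section \<open>Ito processes\<close>

lemma (in usual_filtered_prob_space) ito_integral_at_0:
  fixes H :: "real \<Rightarrow> 'a \<Rightarrow> real"
  assumes W: "wiener_process M F W" and Y: "has_ito_integral M F W 0 H Y"
  shows "AE \<omega> in M. Y \<omega> = 0"
proof -
  from Y obtain n \<tau> \<xi> where e: "\<And>j. elementary_integrand M F (n j) (\<tau> j) (\<xi> j)"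
    and i: "(\<lambda>j::nat. mean_square M (\<lambda>\<omega>. Y \<omega> - elementary_integral W (n j) (\<tau> j) (\<xi> j) 0 \<omega>)) \<longlonglongrightarrow> 0"
    unfolding has_ito_integral_def mean_square_def by auto
  have [measurable]: "Y \<in> borel_measurable M" using Y by (simp add: has_ito_integral_def)
  have "(\<lambda>j::nat. mean_square M Y) \<longlonglongrightarrow> 0"
    using i by (simp add: elementary_integral_0[OF elementary_integrand_imp_sq[OF e]])
  then have "mean_square M Y = 0" by (simp add: LIMSEQ_const_iff)
  then have "AE \<omega> in M. ennreal ((Y \<omega>)\<^sup>2) = 0"
    unfolding mean_square_def by (subst (asm) nn_integral_0_iff_AE) auto
  then show ?thesis by eventually_elim (simp add: ennreal_eq_0_iff)
qed

text \<open>The process \<open>G\<close> dominates both coefficients. For one coordinate of a system it is \<open>C + C |X|\<close> with the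
  whole vector \<open>X\<close>, since the drift of that coordinate may depend on all the others.\<close>

locale ito_process = usual_filtered_prob_space M F for M :: "'a measure" and F +
  fixes W :: "'m::finite \<Rightarrow> real \<Rightarrow> 'a \<Rightarrow> real"
    and x :: "real \<Rightarrow> 'a \<Rightarrow> real" and x0 :: "'a \<Rightarrow> real"
    and \<alpha> :: "real \<Rightarrow> 'a \<Rightarrow> real" and B :: "'m \<Rightarrow> real \<Rightarrow> 'a \<Rightarrow> real"
    and J :: "'m \<Rightarrow> real \<Rightarrow> 'a \<Rightarrow> real" and G :: "real \<Rightarrow> 'a \<Rightarrow> real"
  assumes wiener: "\<And>k. wiener_process M F (W k)"
    and adapted: "0 \<le> t \<Longrightarrow> x t \<in> borel_measurable (F t)"
    and paths_continuous: "AE \<omega> in M. continuous_on {0..} (\<lambda>t. x t \<omega>)"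
    and x_jointly_measurable: "0 \<le> T \<Longrightarrow> jointly_measurable_on T M x"
    and initial: "sq_integrable M x0"
    and ito: "0 \<le> t \<Longrightarrow> has_ito_integral M F (W k) t (B k) (J k t)"
    and equation: "0 \<le> t \<Longrightarrow> AE \<omega> in M. x t \<omega> = x0 \<omega> + (LBINT s:{0..t}. \<alpha> s \<omega>) + (\<Sum>k\<in>UNIV. J k t \<omega>)"
    and drift_continuous: "AE \<omega> in M. continuous_on {0..} (\<lambda>t. \<alpha> t \<omega>)"
    and bound_measurable: "0 \<le> T \<Longrightarrow> jointly_measurable_on T M G"
    and bound_finite: "0 \<le> T \<Longrightarrow> mean_square_on M 0 T G < \<infinity>"
    and drift_bound: "AE \<omega> in M. \<forall>t\<ge>0. \<bar>\<alpha> t \<omega>\<bar> \<le> G t \<omega>"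
    and diffusion_bound: "AE \<omega> in M. \<forall>t\<ge>0. \<bar>B k t \<omega>\<bar> \<le> G t \<omega>"
begin

lemma x_measurable: "0 \<le> t \<Longrightarrow> x t \<in> borel_measurable M"
  using adapted measurable_F by blast

lemma J_sq_integrable: "0 \<le> t \<Longrightarrow> sq_integrable M (J k t)"
  by (rule ito_integral_sq_integrable[OF wiener _ ito])

lemma J_measurable: "0 \<le> t \<Longrightarrow> J k t \<in> borel_measurable M"
  using J_sq_integrable by (simp add: sq_integrable_iff)

lemma drift_integrable:
  assumes "continuous_on {0..} (\<lambda>t. \<alpha> t \<omega>)" "0 \<le> t"
  shows "set_integrable lborel {t..s} (\<lambda>r. \<alpha> r \<omega>)"
proof -
  have "continuous_on {t..s} (\<lambda>r. \<alpha> r \<omega>)"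
    by (rule continuous_on_subset[OF assms(1)]) (use assms(2) in auto)
  then show ?thesis by (rule borel_integrable_atLeastAtMost')
qed

text \<open>The Cauchy-Schwarz inequality in time produces the factor \<open>s - t\<close>. Together with the smallness of
  the second factor it makes the drift increment \<open>o(s - t)\<close> in mean square.\<close>

lemma drift_integral_mean_square:
  assumes ts: "0 \<le> t" "t \<le> s" and D: "AE \<omega> in M. D \<omega> = (LBINT r:{t..s}. \<alpha> r \<omega>)"
  shows "mean_square M D \<le> ennreal (s - t) * mean_square_on M t s G"
proof -
  have s: "0 \<le> s" using ts by simp
  have G: "jointly_measurable_on s M G" using bound_measurable s by simp
  have "mean_square M D \<le> (\<integral>\<^sup>+\<omega>. ennreal (s - t) * (\<integral>\<^sup>+r\<in>{t..s}. ennreal ((G r \<omega>)\<^sup>2) \<partial>lborel) \<partial>M)"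
    unfolding mean_square_def
  proof (rule nn_integral_mono_AE)
    show "AE \<omega> in M. ennreal ((D \<omega>)\<^sup>2) \<le> ennreal (s - t) * (\<integral>\<^sup>+r\<in>{t..s}. ennreal ((G r \<omega>)\<^sup>2) \<partial>lborel)"
      using D drift_continuous drift_bound AE_space
    proof eventually_elim
      case (elim \<omega>)
      have "(\<lambda>r. indicator {t..s} r *\<^sub>R \<alpha> r \<omega>) \<in> borel_measurable lborel"
        using drift_integrable[OF elim(2) ts(1), of s] unfolding set_integrable_def
        by (rule borel_measurable_integrable)
      then have [measurable]: "(\<lambda>r. indicator {t..s} r * \<alpha> r \<omega>) \<in> borel_measurable lborel"
        by simp
      have [measurable]: "(\<lambda>r. ennreal \<bar>indicator {t..s} r * \<alpha> r \<omega>\<bar>) \<in> borel_measurable lborel"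
        by measurable
      have "ennreal \<bar>D \<omega>\<bar> \<le> (\<integral>\<^sup>+r. ennreal \<bar>indicator {t..s} r * \<alpha> r \<omega>\<bar> \<partial>lborel)"
        using integral_norm_bound_ennreal[OF drift_integrable[OF elim(2) ts(1), of s, unfolded set_integrable_def]]
        by (simp add: elim(1) set_lebesgue_integral_def)
      also have "\<dots> = (\<integral>\<^sup>+r. ennreal \<bar>indicator {t..s} r * \<alpha> r \<omega>\<bar> * indicator {t..s} r \<partial>lborel)"
        by (intro nn_integral_cong) (auto simp: indicator_def)
      finally have "ennreal \<bar>D \<omega>\<bar> ^ 2 \<le> (\<integral>\<^sup>+r. ennreal \<bar>indicator {t..s} r * \<alpha> r \<omega>\<bar> * indicator {t..s} r \<partial>lborel) ^ 2"
        by (rule power_mono) simp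
      also have "\<dots> \<le> (\<integral>\<^sup>+r. (ennreal \<bar>indicator {t..s} r * \<alpha> r \<omega>\<bar>)\<^sup>2 \<partial>lborel) * (\<integral>\<^sup>+r. (indicator {t..s} r)\<^sup>2 \<partial>lborel)"
        by (rule Cauchy_Schwarz_nn_integral) auto
      also have "\<dots> \<le> (\<integral>\<^sup>+r\<in>{t..s}. ennreal ((G r \<omega>)\<^sup>2) \<partial>lborel) * ennreal (s - t)"
      proof (rule mult_mono)
        show "(\<integral>\<^sup>+r. (ennreal \<bar>indicator {t..s} r * \<alpha> r \<omega>\<bar>)\<^sup>2 \<partial>lborel) \<le> (\<integral>\<^sup>+r\<in>{t..s}. ennreal ((G r \<omega>)\<^sup>2) \<partial>lborel)"
        proof (intro nn_integral_mono)
          fix r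
          have "\<bar>\<alpha> r \<omega>\<bar> ^ 2 \<le> G r \<omega> ^ 2" if "r \<in> {t..s}"
            using elim(3) that ts by (intro power_mono) auto
          then show "(ennreal \<bar>indicator {t..s} r * \<alpha> r \<omega>\<bar>)\<^sup>2 \<le> ennreal ((G r \<omega>)\<^sup>2) * indicator {t..s} r"
            by (auto simp: ennreal_power indicator_def intro!: ennreal_leI)
        qed
        have "(\<integral>\<^sup>+r. (indicator {t..s} r)\<^sup>2 \<partial>lborel) = (\<integral>\<^sup>+r. indicator {t..s} r \<partial>lborel)"
          by (intro nn_integral_cong) (auto simp: indicator_def)
        then show "(\<integral>\<^sup>+r. (indicator {t..s} r)\<^sup>2 \<partial>lborel) \<le> ennreal (s - t)" using ts by simp
      qed simp_all
      finally show ?case by (simp add: ennreal_power mult.commute)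
    qed
  qed
  also have "\<dots> = ennreal (s - t) * mean_square_on M t s G"
    unfolding mean_square_on_def
    by (rule nn_integral_cmult) (rule mean_square_on_measurable[OF G ts order_refl])
  finally show ?thesis .
qed

lemma x_sq_integrable:
  assumes t: "0 \<le> t"
  shows "sq_integrable M (x t)"
proof -
  define D where "D = (\<lambda>\<omega>. x t \<omega> - (x0 \<omega> + (\<Sum>k\<in>UNIV. J k t \<omega>)))"
  have SJ: "sq_integrable M (\<lambda>\<omega>. x0 \<omega> + (\<Sum>k\<in>UNIV. J k t \<omega>))"
    using t by (intro sq_integrable_add initial sq_integrable_sum J_sq_integrable)
  have Dm: "D \<in> borel_measurable M"
    unfolding D_def using x_measurable[OF t] SJ by (intro borel_measurable_diff) (auto simp: sq_integrable_iff)
  have "mean_square M D \<le> ennreal (t - 0) * mean_square_on M 0 t G"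
    using equation[OF t] by (intro drift_integral_mean_square) (use t in \<open>auto simp: D_def\<close>)
  also have "\<dots> < \<infinity>" using bound_finite[OF t] by (simp add: ennreal_mult_less_top)
  finally have "sq_integrable M D" using Dm by (simp add: sq_integrable_def)
  from sq_integrable_add[OF this SJ] show ?thesis by (simp add: D_def)
qed

lemma x_at_0: "AE \<omega> in M. x 0 \<omega> = x0 \<omega>"
proof -
  have "AE \<omega> in M. \<forall>k. J k 0 \<omega> = 0"
    unfolding AE_all_countable using ito_integral_at_0[OF wiener ito[OF order_refl]] by blast
  with equation[OF order_refl] drift_continuous show ?thesis
  proof eventually_elim
    case (elim \<omega>)
    have "(LBINT s:{0..0}. \<alpha> s \<omega>) = 0"
      using set_borel_integral_eq_integral(2)[OF drift_integrable[OF elim(2) order_refl, of 0]] by simp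
    then show ?case using elim(1,3) by simp
  qed
qed

text \<open>Defined as what is left of the increment after removing the stochastic integrals, this is a random
  variable by construction; it agrees with the time integral of \<open>\<alpha>\<close> almost surely.\<close>

definition drift_increment :: "real \<Rightarrow> real \<Rightarrow> 'a \<Rightarrow> real" where
  "drift_increment t s \<omega> = x s \<omega> - x t \<omega> - (\<Sum>k\<in>UNIV. J k s \<omega> - J k t \<omega>)"

lemma drift_increment_eq:
  assumes ts: "0 \<le> t" "t \<le> s"
  shows "AE \<omega> in M. drift_increment t s \<omega> = (LBINT r:{t..s}. \<alpha> r \<omega>)"
proof -
  have s: "0 \<le> s" using ts by simp
  show ?thesis
    using equation[OF ts(1)] equation[OF s] drift_continuous
  proof eventually_elim
    case (elim \<omega>)
    have "(LBINT r:{0..s}. \<alpha> r \<omega>) = (LBINT r:{0..t} \<union> {t<..s}. \<alpha> r \<omega>)"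
      using ts by (intro arg_cong2[where f = "set_lebesgue_integral lborel"]) auto
    also have "\<dots> = (LBINT r:{0..t}. \<alpha> r \<omega>) + (LBINT r:{t<..s}. \<alpha> r \<omega>)"
    proof (rule set_integral_Un)
      show "set_integrable lborel {0..t} (\<lambda>r. \<alpha> r \<omega>)" by (rule drift_integrable[OF elim(3)]) simp
      show "set_integrable lborel {t<..s} (\<lambda>r. \<alpha> r \<omega>)"
        by (rule set_integrable_subset[OF drift_integrable[OF elim(3) ts(1), of s]]) auto
    qed auto
    also have "(LBINT r:{t<..s}. \<alpha> r \<omega>) = (LBINT r:{t..s}. \<alpha> r \<omega>)"
    proof -
      have "AE r in lborel. r \<noteq> t" by (rule AE_lborel_singleton)
      then have ae: "AE r in lborel. indicator {t<..s} r *\<^sub>R \<alpha> r \<omega> = indicator {t..s} r *\<^sub>R \<alpha> r \<omega>"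
        by eventually_elim (auto simp: indicator_def)
      have m: "(\<lambda>r. indicator {t..s} r *\<^sub>R \<alpha> r \<omega>) \<in> borel_measurable lborel"
        using drift_integrable[OF elim(3) ts(1), of s] by (simp add: set_integrable_def)
      have m': "(\<lambda>r. indicator {t<..s} r *\<^sub>R \<alpha> r \<omega>) \<in> borel_measurable lborel"
      proof -
        have "set_integrable lborel {t<..s} (\<lambda>r. \<alpha> r \<omega>)"
          by (rule set_integrable_subset[OF drift_integrable[OF elim(3) ts(1), of s]]) auto
        then show ?thesis unfolding set_integrable_def by (rule borel_measurable_integrable)
      qed
      show ?thesis unfolding set_lebesgue_integral_def by (rule integral_cong_AE[OF m' m ae])
    qed
    finally show ?case using elim(1,2) by (simp add: drift_increment_def sum_subtractf)
  qed
qed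

lemma drift_increment_sq_integrable:
  assumes "0 \<le> t" "t \<le> s"
  shows "sq_integrable M (drift_increment t s)"
  unfolding drift_increment_def[abs_def] using assms
  by (intro sq_integrable_diff sq_integrable_sum x_sq_integrable J_sq_integrable) auto

lemma drift_increment_mean_square:
  assumes "0 \<le> t" "t \<le> s"
  shows "mean_square M (drift_increment t s) \<le> ennreal (s - t) * mean_square_on M t s G"
  by (rule drift_integral_mean_square[OF assms drift_increment_eq[OF assms]])

lemma drift_increment_small:
  assumes t: "0 \<le> t" and \<epsilon>: "0 < (\<epsilon>::real)"
  shows "\<exists>\<delta>>0. \<forall>s. t \<le> s \<longrightarrow> s < t + \<delta> \<longrightarrow> mean_square M (drift_increment t s) \<le> ennreal (\<epsilon> * (s - t))"
proof -
  have T: "0 \<le> t + 1" using t by simp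
  obtain \<delta> where \<delta>: "0 < \<delta>" "\<And>s. t \<le> s \<Longrightarrow> s \<le> t + 1 \<Longrightarrow> s - t < \<delta> \<Longrightarrow> mean_square_on M t s G \<le> ennreal \<epsilon>"
    using mean_square_on_small[OF bound_measurable[OF T] T bound_finite[OF T] \<epsilon>] t by blast
  have "mean_square M (drift_increment t s) \<le> ennreal (\<epsilon> * (s - t))" if s: "t \<le> s" "s < t + min \<delta> 1" for s
  proof -
    have "mean_square M (drift_increment t s) \<le> ennreal (s - t) * mean_square_on M t s G"
      by (rule drift_increment_mean_square[OF t s(1)])
    also have "\<dots> \<le> ennreal (s - t) * ennreal \<epsilon>" using s by (intro mult_left_mono \<delta>) auto
    also have "\<dots> = ennreal (\<epsilon> * (s - t))" using s \<epsilon> ennreal_mult[of "s - t" \<epsilon>] by (simp add: mult.commute)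
    finally show ?thesis .
  qed
  then show ?thesis using \<delta>(1) by (intro exI[of _ "min \<delta> 1"]) auto
qed

lemma diffusion_increment_orthogonal:
  assumes ts: "0 \<le> t" "t \<le> s" and Z: "Z \<in> borel_measurable (F t)" "sq_integrable M Z"
  shows "integrable M (\<lambda>\<omega>. Z \<omega> * (\<Sum>k\<in>UNIV. J k s \<omega> - J k t \<omega>))"
    and "(\<integral>\<omega>. Z \<omega> * (\<Sum>k\<in>UNIV. J k s \<omega> - J k t \<omega>) \<partial>M) = 0"
proof -
  have s: "0 \<le> s" using ts by simp
  have i: "integrable M (\<lambda>\<omega>. Z \<omega> * (J k s \<omega> - J k t \<omega>))" for k
    by (intro sq_integrable_mult Z(2) sq_integrable_diff J_sq_integrable s ts(1))
  have "(\<integral>\<omega>. Z \<omega> * (J k s \<omega> - J k t \<omega>) \<partial>M) = 0" for k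
    by (rule ito_increment_orthogonal[OF wiener ts ito[OF ts(1)] ito[OF s] Z])
  then show "(\<integral>\<omega>. Z \<omega> * (\<Sum>k\<in>UNIV. J k s \<omega> - J k t \<omega>) \<partial>M) = 0"
    unfolding sum_distrib_left Bochner_Integration.integral_sum[OF i] by simp
  show "integrable M (\<lambda>\<omega>. Z \<omega> * (\<Sum>k\<in>UNIV. J k s \<omega> - J k t \<omega>))"
    unfolding sum_distrib_left by (intro Bochner_Integration.integrable_sum i)
qed

lemma diffusion_increment_mean_square:
  assumes ts: "0 \<le> t" "t \<le> s"
  shows "mean_square M (\<lambda>\<omega>. J k s \<omega> - J k t \<omega>) \<le> 4 * mean_square_on M t s G"
proof -
  have s: "0 \<le> s" using ts by simp
  have "mean_square M (\<lambda>\<omega>. J k s \<omega> - J k t \<omega>) \<le> 4 * mean_square_on M t s (B k)"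
    using ito_increment_mean_square[OF wiener[of k] ts ito[OF ts(1), of k] ito[OF s, of k], of "\<lambda>_. 0"]
    by (simp add: sq_integrable_zero)
  also have "\<dots> \<le> 4 * mean_square_on M t s G"
  proof (rule mult_left_mono[OF mean_square_on_mono])
    show "AE \<omega> in M. \<forall>r\<in>{t..s}. \<bar>B k r \<omega>\<bar> \<le> \<bar>G r \<omega>\<bar>"
      using diffusion_bound[of k] by eventually_elim (use ts in \<open>auto intro: order_trans[OF _ abs_ge_self]\<close>)
  qed simp
  finally show ?thesis .
qed

lemma increment_mean_square:
  assumes ts: "0 \<le> t" "t \<le> s" "s \<le> t + 1"
  shows "mean_square M (\<lambda>\<omega>. x s \<omega> - x t \<omega>)
    \<le> ennreal (2 + 8 * (real CARD('m))\<^sup>2) * mean_square_on M t s G"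
proof -
  define g where "g = mean_square_on M t s G"
  have s: "0 \<le> s" using ts by simp
  have Jm: "(\<lambda>\<omega>. J k s \<omega> - J k t \<omega>) \<in> borel_measurable M" for k
    using J_measurable ts s by (intro borel_measurable_diff) auto
  have Dm: "drift_increment t s \<in> borel_measurable M"
    using drift_increment_sq_integrable[OF ts(1,2)] by (simp add: sq_integrable_iff)
  have "mean_square M (drift_increment t s) \<le> ennreal (s - t) * g"
    unfolding g_def by (rule drift_increment_mean_square[OF ts(1,2)])
  also have "\<dots> \<le> 1 * g" using ts by (intro mult_right_mono) (auto intro: ennreal_leI[of _ 1, simplified])
  finally have D: "mean_square M (drift_increment t s) \<le> g" by simp
  have "mean_square M (\<lambda>\<omega>. \<Sum>k\<in>UNIV. J k s \<omega> - J k t \<omega>)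
      \<le> of_nat CARD('m) * (\<Sum>k\<in>(UNIV::'m set). mean_square M (\<lambda>\<omega>. J k s \<omega> - J k t \<omega>))"
    by (rule mean_square_sum[OF Jm]) simp
  also have "\<dots> \<le> of_nat CARD('m) * (\<Sum>k\<in>(UNIV::'m set). 4 * g)"
    unfolding g_def by (intro mult_left_mono sum_mono diffusion_increment_mean_square[OF ts(1,2)]) simp
  also have "\<dots> = ennreal (4 * (real CARD('m))\<^sup>2) * g"
    by (simp add: ennreal_mult power2_eq_square mult_ac ennreal_of_nat_eq_real_of_nat)
  finally have J: "mean_square M (\<lambda>\<omega>. \<Sum>k\<in>UNIV. J k s \<omega> - J k t \<omega>) \<le> ennreal (4 * (real CARD('m))\<^sup>2) * g" .
  have "mean_square M (\<lambda>\<omega>. x s \<omega> - x t \<omega>)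
    = mean_square M (\<lambda>\<omega>. drift_increment t s \<omega> + (\<Sum>k\<in>UNIV. J k s \<omega> - J k t \<omega>))"
    by (simp add: drift_increment_def)
  also have "\<dots> \<le> 2 * mean_square M (drift_increment t s) + 2 * mean_square M (\<lambda>\<omega>. \<Sum>k\<in>UNIV. J k s \<omega> - J k t \<omega>)"
    by (rule mean_square_add[OF Dm]) (intro borel_measurable_sum Jm)
  also have "\<dots> \<le> 2 * g + 2 * (ennreal (4 * (real CARD('m))\<^sup>2) * g)"
    by (intro add_mono mult_left_mono D J) simp_all
  also have "\<dots> = ennreal (2 + 8 * (real CARD('m))\<^sup>2) * g"
  proof -
    have "ennreal (2 + 8 * (real CARD('m))\<^sup>2) = 2 + 2 * ennreal (4 * (real CARD('m))\<^sup>2)"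
    proof -
      have "2 + 8 * (real CARD('m))\<^sup>2 = 2 + 2 * (4 * (real CARD('m))\<^sup>2)" by simp
      then show ?thesis by (simp only:) (subst ennreal_plus, simp_all add: ennreal_mult)
    qed
    then show ?thesis by (simp add: distrib_right mult.assoc)
  qed
  finally show ?thesis by (simp add: g_def)
qed

lemma increment_small:
  assumes T: "0 \<le> T" and \<epsilon>: "0 < (\<epsilon>::real)"
  shows "\<exists>\<delta>>0. \<forall>t s. 0 \<le> t \<longrightarrow> t \<le> s \<longrightarrow> s \<le> T \<longrightarrow> s - t < \<delta> \<longrightarrow>
    mean_square M (\<lambda>\<omega>. x s \<omega> - x t \<omega>) \<le> ennreal \<epsilon>"
proof -
  define K where "K = 2 + 8 * (real CARD('m))\<^sup>2"
  have K: "0 < K" unfolding K_def by (simp add: add_pos_nonneg)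
  obtain \<delta> where \<delta>: "0 < \<delta>" "\<And>t s. 0 \<le> t \<Longrightarrow> t \<le> s \<Longrightarrow> s \<le> T \<Longrightarrow> s - t < \<delta> \<Longrightarrow> mean_square_on M t s G \<le> ennreal (\<epsilon> / K)"
    using mean_square_on_small[OF bound_measurable[OF T] T bound_finite[OF T], of "\<epsilon> / K"] K \<epsilon> by auto
  have "mean_square M (\<lambda>\<omega>. x s \<omega> - x t \<omega>) \<le> ennreal \<epsilon>"
    if "0 \<le> t" "t \<le> s" "s \<le> T" "s - t < min \<delta> 1" for t s
  proof -
    have "mean_square M (\<lambda>\<omega>. x s \<omega> - x t \<omega>) \<le> ennreal K * mean_square_on M t s G"
      unfolding K_def using that by (intro increment_mean_square) auto
    also have "\<dots> \<le> ennreal K * ennreal (\<epsilon> / K)"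
      using that by (intro mult_left_mono \<delta>) auto
    also have "\<dots> = ennreal \<epsilon>" using K \<epsilon> by (simp add: ennreal_mult[symmetric])
    finally show ?thesis .
  qed
  then show ?thesis using \<delta>(1) by (intro exI[of _ "min \<delta> 1"]) auto
qed

end

section \<open>Two deterministic inequalities\<close>

text \<open>The barrier \<open>u\<close> grows at rate \<open>K + 1\<close>. At the last time \<open>t\<close> with \<open>f t \<le> u t\<close>, the hypothesis with
  \<open>\<epsilon> = u t\<close> keeps \<open>f\<close> below the barrier a little longer, which is impossible before \<open>T\<close>.\<close>

lemma dini_gronwall:
  fixes f :: "real \<Rightarrow> real"
  assumes cont: "continuous_on {0..} f" and f0: "f 0 \<le> 0" and K: "0 \<le> K"
    and step: "\<And>t \<epsilon>. 0 \<le> t \<Longrightarrow> 0 < \<epsilon> \<Longrightarrow> \<exists>\<delta>>0. \<forall>h. 0 < h \<longrightarrow> h < \<delta> \<longrightarrow> f (t + h) \<le> f t + (K * f t + \<epsilon>) * h"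
    and T: "0 \<le> T"
  shows "f T \<le> 0"
proof (rule field_le_epsilon)
  fix e :: real assume e: "0 < e"
  define c where "c = e * exp (- ((K + 1) * T))"
  define u where "u = (\<lambda>t. c * exp ((K + 1) * t))"
  have c: "0 < c" using e by (simp add: c_def)
  have u: "0 < u t" for t using c by (simp add: u_def)
  have ucont: "continuous_on S u" for S unfolding u_def by (intro continuous_intros)
  have "f T \<le> u T"
  proof (rule ccontr)
    assume "\<not> f T \<le> u T"
    define S where "S = {t \<in> {0..T}. f t \<le> u t}"
    have cT: "continuous_on {0..T} f" by (rule continuous_on_subset[OF cont]) auto
    have "closed S" unfolding S_def
      by (rule continuous_on_closed_Collect_le[OF cT ucont]) simp
    have S0: "0 \<in> S" using T f0 u[of 0] by (auto simp: S_def)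
    have bdd: "bdd_above S" by (rule bdd_aboveI[of _ T]) (auto simp: S_def)
    define t where "t = Sup S"
    have tS: "t \<in> S" unfolding t_def by (rule closed_contains_Sup) (use S0 bdd \<open>closed S\<close> in auto)
    then have t: "0 \<le> t" "t \<le> T" "f t \<le> u t" by (auto simp: S_def)
    have "t < T" using t \<open>\<not> f T \<le> u T\<close> by (metis le_less)
    obtain \<delta> where \<delta>: "0 < \<delta>" "\<And>h. 0 < h \<Longrightarrow> h < \<delta> \<Longrightarrow> f (t + h) \<le> f t + (K * f t + u t) * h"
      using step[OF t(1) u[of t]] by auto
    define h where "h = min (\<delta> / 2) (T - t)"
    have h: "0 < h" "h < \<delta>" "t + h \<le> T" using \<delta> \<open>t < T\<close> by (auto simp: h_def min_less_iff_disj)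
    have "f (t + h) \<le> f t + (K * f t + u t) * h" using \<delta>(2)[OF h(1,2)] .
    also have "\<dots> \<le> u t + (K * u t + u t) * h"
      using t h K by (intro add_mono mult_right_mono mult_left_mono) auto
    also have "\<dots> = u t * (1 + (K + 1) * h)" by (simp add: algebra_simps)
    also have "\<dots> \<le> u t * exp ((K + 1) * h)"
      using u[of t] by (intro mult_left_mono exp_ge_add_one_self) auto
    also have "\<dots> = u (t + h)" by (simp add: u_def exp_add[symmetric] algebra_simps)
    finally have "t + h \<in> S" using h t by (auto simp: S_def)
    then have "t + h \<le> t" unfolding t_def using bdd by (rule cSup_upper)
    then show False using h by simp
  qed
  also have "u T = e" by (simp add: u_def c_def exp_minus)
  finally show "f T \<le> 0 + e" by simp
qed

text \<open>This replaces a second-order Taylor expansion of \<open>(max 0 y)\<^sup>2\<close>. For \<open>y \<ge> 0\<close> drop the positive part and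
  expand the square. For \<open>y < 0\<close> the hypothesis on \<open>Q\<close> gives \<open>y + Q \<le> \<bar>y\<bar> (C V - 1)\<close>, whose positive part
  squared is at most \<open>y\<^sup>2 (C V)^4\<close>: it vanishes unless \<open>C V > 1\<close>. The fourth power is what makes this
  term of order \<open>h\<^sup>2\<close> in expectation.\<close>

lemma sq_pos_part_step:
  fixes y Q D R C V p :: real
  assumes Q: "\<bar>Q\<bar> \<le> C * \<bar>y\<bar> * V" and CV: "0 \<le> C" "0 \<le> V" and p: "p = max 0 y"
  shows "(max 0 (y + D + Q + R))\<^sup>2
    \<le> p\<^sup>2 + 2 * (p * (D + (Q + R))) + 3 * C\<^sup>2 * (p\<^sup>2 * V\<^sup>2) + 2 * C ^ 4 * (y\<^sup>2 * V ^ 4) + 4 * D\<^sup>2 + 4 * R\<^sup>2"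
proof (cases "0 \<le> y")
  case True
  then have py: "p = y" using p by simp
  have "(max 0 (y + D + Q + R))\<^sup>2 \<le> (y + (D + Q + R))\<^sup>2"
    by (subst abs_le_square_iff[symmetric]) auto
  also have "\<dots> = y\<^sup>2 + 2 * (y * (D + (Q + R))) + (D + Q + R)\<^sup>2"
    by (simp add: power2_eq_square algebra_simps)
  also have "(D + Q + R)\<^sup>2 \<le> 3 * D\<^sup>2 + 3 * Q\<^sup>2 + 3 * R\<^sup>2"
  proof -
    have "0 \<le> (D - Q)\<^sup>2 + (D - R)\<^sup>2 + (Q - R)\<^sup>2" by simp
    then show ?thesis by (simp add: power2_eq_square algebra_simps)
  qed
  also have "Q\<^sup>2 \<le> C\<^sup>2 * (y\<^sup>2 * V\<^sup>2)"
  proof -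
    have "\<bar>Q\<bar>\<^sup>2 \<le> (C * \<bar>y\<bar> * V)\<^sup>2" using Q by (intro power_mono) auto
    then show ?thesis by (simp add: power_mult_distrib)
  qed
  finally have "(max 0 (y + D + Q + R))\<^sup>2 \<le>
    y\<^sup>2 + 2 * (y * (D + (Q + R))) + (3 * D\<^sup>2 + 3 * (C\<^sup>2 * (y\<^sup>2 * V\<^sup>2)) + 3 * R\<^sup>2)" by simp
  moreover have "0 \<le> C ^ 4 * (y\<^sup>2 * V ^ 4)" by simp
  moreover have "0 \<le> D\<^sup>2" "0 \<le> R\<^sup>2" by simp_all
  ultimately show ?thesis unfolding py by linarith
next
  case False
  then have py: "p = 0" using p by simp
  define z where "z = \<bar>y\<bar> * max 0 (C * V - 1)"
  have z0: "0 \<le> z" by (simp add: z_def)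
  have "y + Q \<le> z"
  proof -
    have "y + Q \<le> - \<bar>y\<bar> + C * \<bar>y\<bar> * V" using Q False by linarith
    also have "\<dots> = \<bar>y\<bar> * (C * V - 1)" by (simp add: algebra_simps)
    also have "\<dots> \<le> z" unfolding z_def by (intro mult_left_mono) auto
    finally show ?thesis .
  qed
  then have "max 0 (y + D + Q + R) \<le> z + \<bar>D + R\<bar>" using z0 by linarith
  then have "(max 0 (y + D + Q + R))\<^sup>2 \<le> (z + \<bar>D + R\<bar>)\<^sup>2" by (intro power_mono) auto
  also have "\<dots> \<le> 2 * z\<^sup>2 + 2 * \<bar>D + R\<bar>\<^sup>2" by (rule square_add_le)
  also have "\<bar>D + R\<bar>\<^sup>2 \<le> 2 * D\<^sup>2 + 2 * R\<^sup>2" using square_add_le[of D R] by simp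
  also have "z\<^sup>2 \<le> C ^ 4 * (y\<^sup>2 * V ^ 4)"
  proof -
    have "(max 0 (C * V - 1))\<^sup>2 \<le> (C * V) ^ 4"
    proof (cases "C * V \<le> 1")
      case False
      have "max 0 (C * V - 1) \<le> C * V" using False by simp
      then have "(max 0 (C * V - 1))\<^sup>2 \<le> (C * V)\<^sup>2" by (intro power_mono) auto
      also have "\<dots> \<le> (C * V) ^ 4" using False by (intro power_increasing) auto
      finally show ?thesis .
    qed simp
    then have "y\<^sup>2 * (max 0 (C * V - 1))\<^sup>2 \<le> y\<^sup>2 * (C * V) ^ 4" by (intro mult_left_mono) auto
    then show ?thesis by (simp add: z_def power_mult_distrib mult_ac)
  qed
  finally have "(max 0 (y + D + Q + R))\<^sup>2 \<le> 2 * (C ^ 4 * (y\<^sup>2 * V ^ 4)) + 2 * (2 * D\<^sup>2 + 2 * R\<^sup>2)" by simp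
  then show ?thesis unfolding py by simp
qed

section \<open>Freezing the diffusion coefficients\<close>

lemma (in usual_filtered_prob_space) coefficient_frozen_measurable:
  assumes \<beta>: "\<And>r. 0 \<le> r \<Longrightarrow> (\<lambda>(z, \<omega>). \<beta> r z \<omega>) \<in> borel_measurable (borel \<Otimes>\<^sub>M F r)"
    and x: "x \<in> borel_measurable (F t)" and t: "0 \<le> t" "t \<le> r"
  shows "(\<lambda>\<omega>. \<beta> r (x \<omega>) \<omega>) \<in> borel_measurable (F r)"
proof -
  have "(\<lambda>\<omega>. (x \<omega>, \<omega>)) \<in> F r \<rightarrow>\<^sub>M borel \<Otimes>\<^sub>M F r"
    using measurable_F_mono[OF t x] by (intro measurable_Pair) auto
  from measurable_compose[OF this \<beta>] t show ?thesis by simp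
qed

locale diffusion_equation =
  ito_process M F W x x0 \<alpha> "\<lambda>k t \<omega>. \<beta> k t (x t \<omega>) \<omega>" J G
  for M :: "'a measure" and F and W :: "'m::finite \<Rightarrow> real \<Rightarrow> 'a \<Rightarrow> real"
    and x x0 \<alpha> and \<beta> :: "'m \<Rightarrow> real \<Rightarrow> real \<Rightarrow> 'a \<Rightarrow> real" and J G +
  fixes C :: real
  assumes C_nonneg: "0 \<le> C"
    and \<beta>_adapted: "0 \<le> t \<Longrightarrow> (\<lambda>(z, \<omega>). \<beta> k t z \<omega>) \<in> borel_measurable (borel \<Otimes>\<^sub>M F t)"
    and \<beta>_continuous: "AE \<omega> in M. \<forall>z. continuous_on {0..} (\<lambda>t. \<beta> k t z \<omega>)"
    and \<beta>_0: "AE \<omega> in M. \<forall>t\<ge>0. \<bar>\<beta> k t 0 \<omega>\<bar> \<le> C"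
    and \<beta>_lipschitz: "AE \<omega> in M. \<forall>t\<ge>0. \<forall>z z'. \<bar>\<beta> k t z \<omega> - \<beta> k t z' \<omega>\<bar> \<le> C * \<bar>z - z'\<bar>"
begin

text \<open>Two effects add up: the state moves from \<open>x t\<close> to \<open>x r\<close>, which is controlled by the Lipschitz
  condition and the mean-square continuity of \<open>x\<close>; and the random coefficient changes with time at
  the fixed state \<open>x t\<close>, where dominated convergence applies because of linear growth. The second
  effect comes without any rate, which is why the estimates are of the form \<open>o(s - t)\<close>.\<close>

lemma coefficient_increment_small:
  assumes t: "0 \<le> t" and \<epsilon>: "0 < (\<epsilon>::real)"
  shows "\<exists>\<delta>>0. \<forall>r. t \<le> r \<longrightarrow> r < t + \<delta> \<longrightarrow> mean_square M (\<lambda>\<omega>. \<beta> k r (x r \<omega>) \<omega> - \<beta> k t (x t \<omega>) \<omega>) \<le> ennreal \<epsilon>"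
proof -
  have xm [measurable]: "x r \<in> borel_measurable M" if "0 \<le> r" for r using x_measurable[OF that] .
  have bm: "(\<lambda>\<omega>. \<beta> k r (x t \<omega>) \<omega>) \<in> borel_measurable M" if "t \<le> r" for r
    using coefficient_frozen_measurable[of "\<beta> k", OF \<beta>_adapted adapted[OF t] t that] measurable_F[of r] that t by auto
  have bm': "(\<lambda>\<omega>. \<beta> k r (x r \<omega>) \<omega>) \<in> borel_measurable M" if "0 \<le> r" for r
    using coefficient_frozen_measurable[of "\<beta> k", OF \<beta>_adapted adapted[OF that] that order_refl] measurable_F[of r] that by auto
  define U where "U = (\<lambda>\<omega>. 2 * (C + C * \<bar>x t \<omega>\<bar>))"
  have U: "sq_integrable M U"
  proof -
    have "sq_integrable M (\<lambda>\<omega>. \<bar>x t \<omega>\<bar>)" by (rule sq_integrable_abs[OF x_sq_integrable[OF t]])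
    moreover have "sq_integrable M (\<lambda>\<omega>. C)" by (simp add: sq_integrable_iff)
    ultimately show ?thesis unfolding U_def by (intro sq_integrable_cmult sq_integrable_add)
  qed
  have "((\<lambda>r. mean_square M (\<lambda>\<omega>. \<beta> k r (x t \<omega>) \<omega> - \<beta> k t (x t \<omega>) \<omega>)) \<longlongrightarrow> 0) (at_right t)"
  proof (rule mean_square_tendsto_0_at_right[OF _ U])
    show "(\<lambda>\<omega>. \<beta> k r (x t \<omega>) \<omega> - \<beta> k t (x t \<omega>) \<omega>) \<in> borel_measurable M" if "t < r" for r
      using bm[of r] bm[of t] that by (intro borel_measurable_diff) auto
    show "AE \<omega> in M. \<forall>r>t. \<bar>\<beta> k r (x t \<omega>) \<omega> - \<beta> k t (x t \<omega>) \<omega>\<bar> \<le> \<bar>U \<omega>\<bar>"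
      using \<beta>_0[of k] \<beta>_lipschitz[of k]
    proof eventually_elim
      case (elim \<omega>)
      have "\<bar>\<beta> k r z \<omega>\<bar> \<le> C + C * \<bar>z\<bar>" if "0 \<le> r" for r z
      proof -
        have "\<bar>\<beta> k r z \<omega> - \<beta> k r 0 \<omega>\<bar> \<le> C * \<bar>z - 0\<bar>" "\<bar>\<beta> k r 0 \<omega>\<bar> \<le> C" using elim that by blast+
        then show ?thesis by simp
      qed
      from this[of _ "x t \<omega>"] t show ?case unfolding U_def
        by (smt (verit, best) less_eq_real_def)
    qed
    show "AE \<omega> in M. ((\<lambda>r. \<beta> k r (x t \<omega>) \<omega> - \<beta> k t (x t \<omega>) \<omega>) \<longlongrightarrow> 0) (at_right t)"
      using \<beta>_continuous[of k]
    proof eventually_elim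
      case (elim \<omega>)
      have "continuous_on {t..} (\<lambda>r. \<beta> k r (x t \<omega>) \<omega>)"
        by (rule continuous_on_subset[of "{0..}"]) (use elim t in auto)
      then have "((\<lambda>r. \<beta> k r (x t \<omega>) \<omega>) \<longlongrightarrow> \<beta> k t (x t \<omega>) \<omega>) (at t within {t..})"
        by (auto simp: continuous_on_def)
      then have "((\<lambda>r. \<beta> k r (x t \<omega>) \<omega>) \<longlongrightarrow> \<beta> k t (x t \<omega>) \<omega>) (at_right t)"
        by (rule tendsto_within_subset) auto
      then show ?case by (simp add: LIM_zero_iff)
    qed
  qed
  from order_tendstoD(2)[OF this, of "ennreal (\<epsilon> / 4)"] \<epsilon>
  obtain d where d: "t < d" "\<And>r. t < r \<Longrightarrow> r < d \<Longrightarrow> mean_square M (\<lambda>\<omega>. \<beta> k r (x t \<omega>) \<omega> - \<beta> k t (x t \<omega>) \<omega>) < ennreal (\<epsilon> / 4)"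
    by (auto simp: eventually_at_right_field)
  \<comment> \<open>The summand 1 covers the case \<open>C = 0\<close>.\<close>
  define \<eta> where "\<eta> = \<epsilon> / (4 * (C\<^sup>2 + 1))"
  have \<eta>: "0 < \<eta>" "C\<^sup>2 * \<eta> \<le> \<epsilon> / 4"
  proof -
    have "0 < C\<^sup>2 + 1" by (simp add: add_nonneg_pos)
    then show "0 < \<eta>" "C\<^sup>2 * \<eta> \<le> \<epsilon> / 4" using \<epsilon> by (auto simp: \<eta>_def field_simps)
  qed
  obtain d' where d': "0 < d'" "\<And>u s. 0 \<le> u \<Longrightarrow> u \<le> s \<Longrightarrow> s \<le> t + 1 \<Longrightarrow> s - u < d' \<Longrightarrow>
      mean_square M (\<lambda>\<omega>. x s \<omega> - x u \<omega>) \<le> ennreal \<eta>"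
    using increment_small[of "t + 1", OF _ \<eta>(1)] t by auto
  have "mean_square M (\<lambda>\<omega>. \<beta> k r (x r \<omega>) \<omega> - \<beta> k t (x t \<omega>) \<omega>) \<le> ennreal \<epsilon>"
    if r: "t \<le> r" "r < t + min (min (d - t) d') 1" for r
  proof -
    have r0: "0 \<le> r" using r t by simp
    have "mean_square M (\<lambda>\<omega>. \<beta> k r (x r \<omega>) \<omega> - \<beta> k t (x t \<omega>) \<omega>)
      = mean_square M (\<lambda>\<omega>. (\<beta> k r (x r \<omega>) \<omega> - \<beta> k r (x t \<omega>) \<omega>) + (\<beta> k r (x t \<omega>) \<omega> - \<beta> k t (x t \<omega>) \<omega>))"
      by simp
    also have "\<dots> \<le> 2 * mean_square M (\<lambda>\<omega>. \<beta> k r (x r \<omega>) \<omega> - \<beta> k r (x t \<omega>) \<omega>)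
       + 2 * mean_square M (\<lambda>\<omega>. \<beta> k r (x t \<omega>) \<omega> - \<beta> k t (x t \<omega>) \<omega>)"
      using r r0 t bm bm' by (intro mean_square_add borel_measurable_diff) auto
    also have "\<dots> \<le> 2 * ennreal (\<epsilon> / 4) + 2 * ennreal (\<epsilon> / 4)"
    proof (intro add_mono mult_left_mono)
      show "mean_square M (\<lambda>\<omega>. \<beta> k r (x t \<omega>) \<omega> - \<beta> k t (x t \<omega>) \<omega>) \<le> ennreal (\<epsilon> / 4)"
      proof (cases "r = t")
        case True then show ?thesis by (simp add: mean_square_def)
      next
        case False
        then show ?thesis using r by (intro less_imp_le d(2)) auto
      qed
      have "mean_square M (\<lambda>\<omega>. \<beta> k r (x r \<omega>) \<omega> - \<beta> k r (x t \<omega>) \<omega>) \<le> mean_square M (\<lambda>\<omega>. C * (x r \<omega> - x t \<omega>))"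
      proof (rule mean_square_mono)
        show "AE \<omega> in M. \<bar>\<beta> k r (x r \<omega>) \<omega> - \<beta> k r (x t \<omega>) \<omega>\<bar> \<le> \<bar>C * (x r \<omega> - x t \<omega>)\<bar>"
          using \<beta>_lipschitz[of k] by eventually_elim (use r0 C_nonneg in \<open>auto simp: abs_mult\<close>)
      qed
      also have "\<dots> = ennreal (C\<^sup>2) * mean_square M (\<lambda>\<omega>. x r \<omega> - x t \<omega>)"
        using xm[OF r0] xm[OF t] by (intro mean_square_cmult borel_measurable_diff)
      also have "\<dots> \<le> ennreal (C\<^sup>2) * ennreal \<eta>"
        using r t by (intro mult_left_mono d') auto
      also have "\<dots> \<le> ennreal (\<epsilon> / 4)" using \<eta> by (simp add: ennreal_mult[symmetric] ennreal_leI)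
      finally show "mean_square M (\<lambda>\<omega>. \<beta> k r (x r \<omega>) \<omega> - \<beta> k r (x t \<omega>) \<omega>) \<le> ennreal (\<epsilon> / 4)" .
    qed simp_all
    also have "\<dots> = ennreal \<epsilon>" using \<epsilon> by (simp add: ennreal_double_add)
    finally show ?thesis .
  qed
  then show ?thesis using d(1) d'(1) by (intro exI[of _ "min (min (d - t) d') 1"]) auto
qed

lemma linearised_increment_small:
  assumes t: "0 \<le> t" and \<epsilon>: "0 < (\<epsilon>::real)"
  shows "\<exists>\<delta>>0. \<forall>s. t \<le> s \<longrightarrow> s < t + \<delta> \<longrightarrow>
    mean_square M (\<lambda>\<omega>. J k s \<omega> - J k t \<omega> - \<beta> k t (x t \<omega>) \<omega> * (W k s \<omega> - W k t \<omega>)) \<le> ennreal (\<epsilon> * (s - t))"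
proof -
  obtain \<delta> where \<delta>: "0 < \<delta>" "\<And>r. t \<le> r \<Longrightarrow> r < t + \<delta> \<Longrightarrow> mean_square M (\<lambda>\<omega>. \<beta> k r (x r \<omega>) \<omega> - \<beta> k t (x t \<omega>) \<omega>) \<le> ennreal (\<epsilon> / 4)"
    using coefficient_increment_small[OF t, of "\<epsilon> / 4" k] \<epsilon> by auto
  have BF: "(\<lambda>\<omega>. \<beta> k t (x t \<omega>) \<omega>) \<in> borel_measurable (F t)"
    using coefficient_frozen_measurable[of "\<beta> k", OF \<beta>_adapted adapted[OF t] t order_refl] by auto
  have BM: "(\<lambda>\<omega>. \<beta> k t (x t \<omega>) \<omega>) \<in> borel_measurable M" using measurable_F[OF t BF] .
  have Bsq: "sq_integrable M ((\<lambda>\<omega>. \<beta> k t (x t \<omega>) \<omega>))"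
  proof (rule sq_integrable_bound[OF _ BM])
    have "sq_integrable M (\<lambda>\<omega>. \<bar>x t \<omega>\<bar>)" by (rule sq_integrable_abs[OF x_sq_integrable[OF t]])
    moreover have "sq_integrable M (\<lambda>\<omega>. C)" by (simp add: sq_integrable_iff)
    ultimately show "sq_integrable M (\<lambda>\<omega>. C + C * \<bar>x t \<omega>\<bar>)" by (intro sq_integrable_cmult sq_integrable_add)
    show "AE \<omega> in M. \<bar>\<beta> k t (x t \<omega>) \<omega>\<bar> \<le> \<bar>C + C * \<bar>x t \<omega>\<bar>\<bar>"
      using \<beta>_0[of k] \<beta>_lipschitz[of k]
    proof eventually_elim
      case (elim \<omega>)
      have "\<bar>\<beta> k t (x t \<omega>) \<omega> - \<beta> k t 0 \<omega>\<bar> \<le> C * \<bar>x t \<omega> - 0\<bar>" "\<bar>\<beta> k t 0 \<omega>\<bar> \<le> C" using elim t by blast+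
      then show ?case by simp
    qed
  qed
  have "mean_square M (\<lambda>\<omega>. J k s \<omega> - J k t \<omega> - \<beta> k t (x t \<omega>) \<omega> * (W k s \<omega> - W k t \<omega>)) \<le> ennreal (\<epsilon> * (s - t))"
    if s: "t \<le> s" "s < t + \<delta>" for s
  proof -
    have s0: "0 \<le> s" using s t by simp
    have Bj: "jointly_measurable_on s M (\<lambda>r \<omega>. \<beta> k r (x r \<omega>) \<omega>)"
      using ito[OF s0, of k] by (simp add: has_ito_integral_def jointly_measurable_on_def)
    have "mean_square M (\<lambda>\<omega>. J k s \<omega> - J k t \<omega> - \<beta> k t (x t \<omega>) \<omega> * (W k s \<omega> - W k t \<omega>))
      \<le> 4 * mean_square_on M t s (\<lambda>r \<omega>. \<beta> k r (x r \<omega>) \<omega> - \<beta> k t (x t \<omega>) \<omega>)"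
      by (rule ito_increment_mean_square[OF wiener t s(1) ito[OF t] ito[OF s0] BF Bsq])
    also have "\<dots> \<le> 4 * ennreal (\<epsilon> / 4 * (s - t))"
    proof (rule mult_left_mono[OF mean_square_on_le[OF _ t s(1) order_refl]])
      show "jointly_measurable_on s M (\<lambda>r \<omega>. \<beta> k r (x r \<omega>) \<omega> - \<beta> k t (x t \<omega>) \<omega>)"
        by (intro jointly_measurable_on_diff Bj jointly_measurable_on_const BM)
    qed (use \<delta> s \<epsilon> in auto)
    also have "\<dots> = ennreal (\<epsilon> * (s - t))"
      using \<epsilon> s ennreal_mult[of 4 "\<epsilon> / 4 * (s - t)"] by simp
    finally show ?thesis .
  qed
  then show ?thesis using \<delta>(1) by blast
qed

text \<open>The error made over the step from \<open>t\<close> to \<open>s\<close> when all integrands are frozen at time \<open>t\<close>.\<close>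

definition residual :: "real \<Rightarrow> real \<Rightarrow> 'a \<Rightarrow> real" where
  "residual t s \<omega> =
     (\<Sum>k\<in>UNIV. J k s \<omega> - J k t \<omega> - \<beta> k t (x t \<omega>) \<omega> * (W k s \<omega> - W k t \<omega>))"

lemma residual_small:
  assumes t: "0 \<le> t" and \<epsilon>: "0 < (\<epsilon>::real)"
  shows "\<exists>\<delta>>0. \<forall>s. t \<le> s \<longrightarrow> s < t + \<delta> \<longrightarrow>
    sq_integrable M (residual t s) \<and> mean_square M (residual t s) \<le> ennreal (\<epsilon> * (s - t))"
proof -
  define m where "m = real CARD('m)"
  have m: "0 < m" by (simp add: m_def)
  define R where "R = (\<lambda>k s \<omega>. J k s \<omega> - J k t \<omega> - \<beta> k t (x t \<omega>) \<omega> * (W k s \<omega> - W k t \<omega>))"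
  have "\<forall>k. \<exists>\<delta>>0. \<forall>s. t \<le> s \<longrightarrow> s < t + \<delta> \<longrightarrow> mean_square M (R k s) \<le> ennreal (\<epsilon> / m\<^sup>2 * (s - t))"
    unfolding R_def using m \<epsilon> by (intro allI linearised_increment_small[OF t]) simp
  then obtain d where d: "\<And>k. 0 < d k"
    "\<And>k s. t \<le> s \<Longrightarrow> s < t + d k \<Longrightarrow> mean_square M (R k s) \<le> ennreal (\<epsilon> / m\<^sup>2 * (s - t))"
    by metis
  have "0 < Min (range d)" using d(1) by (subst Min_gr_iff) auto
  moreover have "sq_integrable M (residual t s) \<and> mean_square M (residual t s) \<le> ennreal (\<epsilon> * (s - t))"
    if s: "t \<le> s" "s < t + Min (range d)" for s
  proof -
    have s0: "0 \<le> s" using s t by simp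
    have "Min (range d) \<le> d k" for k by (intro Min_le) auto
    then have sd: "s < t + d k" for k using s(2) by (meson add_left_mono less_le_trans)
    have \<beta>m: "(\<lambda>\<omega>. \<beta> k t (x t \<omega>) \<omega>) \<in> borel_measurable M" for k
      using coefficient_frozen_measurable[of "\<beta> k", OF \<beta>_adapted adapted[OF t] t order_refl]
      by (auto intro: measurable_F[OF t])
    have Rm: "R k s \<in> borel_measurable M" for k
      unfolding R_def
      by (intro borel_measurable_diff[where f = "\<lambda>\<omega>. J k s \<omega> - J k t \<omega>"] borel_measurable_diff[of "J k s"]
          borel_measurable_diff[of "W k s"] borel_measurable_times \<beta>m J_measurable wiener_measurable[OF wiener] s0 t)
    have r: "residual t s = (\<lambda>\<omega>. \<Sum>k\<in>UNIV. R k s \<omega>)" by (simp add: residual_def R_def fun_eq_iff)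
    have "mean_square M (residual t s) \<le> of_nat CARD('m) * (\<Sum>k\<in>(UNIV::'m set). mean_square M (R k s))"
      unfolding r by (rule mean_square_sum[OF Rm]) simp
    also have "\<dots> \<le> of_nat CARD('m) * (\<Sum>k\<in>(UNIV::'m set). ennreal (\<epsilon> / m\<^sup>2 * (s - t)))"
      by (intro mult_left_mono sum_mono d(2) s(1) sd) simp
    also have "\<dots> = ennreal (m\<^sup>2 * (\<epsilon> / m\<^sup>2 * (s - t)))"
    proof -
      define c where "c = \<epsilon> / m\<^sup>2 * (s - t)"
      have "0 \<le> c" using \<epsilon> s by (simp add: c_def)
      then have "ennreal m * (ennreal m * ennreal c) = ennreal (m\<^sup>2 * c)"
        using m by (simp add: ennreal_mult[symmetric] power2_eq_square mult.assoc)
      then show ?thesis unfolding c_def by (simp add: m_def ennreal_of_nat_eq_real_of_nat)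
    qed
    also have "m\<^sup>2 * (\<epsilon> / m\<^sup>2 * (s - t)) = \<epsilon> * (s - t)" using m by simp
    finally have le: "mean_square M (residual t s) \<le> ennreal (\<epsilon> * (s - t))" .
    have "residual t s \<in> borel_measurable M" unfolding r using Rm by (intro borel_measurable_sum)
    with le show ?thesis by (auto simp: sq_integrable_def intro: le_less_trans)
  qed
  ultimately show ?thesis by blast
qed

end

section \<open>Comparison of two real equations with common diffusion coefficients\<close>

locale comparison_pair =
  p1: diffusion_equation M F W x1 x01 \<alpha>1 \<beta> J1 G1 C +
  p2: diffusion_equation M F W x2 x02 \<alpha>2 \<beta> J2 G2 C
  for M :: "'a measure" and F and W :: "'m::finite \<Rightarrow> real \<Rightarrow> 'a \<Rightarrow> real"
    and x1 x01 \<alpha>1 J1 G1 x2 x02 \<alpha>2 J2 G2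
    and \<beta> :: "'m \<Rightarrow> real \<Rightarrow> real \<Rightarrow> 'a \<Rightarrow> real" and C +
  assumes drift_le: "AE \<omega> in M. \<forall>t\<ge>0. \<alpha>1 t \<omega> - \<alpha>2 t \<omega> \<le> C * \<bar>x1 t \<omega> - x2 t \<omega>\<bar>"
    and initial_le: "AE \<omega> in M. x01 \<omega> \<le> x02 \<omega>"

context comparison_pair
begin

definition gap :: "real \<Rightarrow> 'a \<Rightarrow> real" where "gap t \<omega> = x1 t \<omega> - x2 t \<omega>"

lemma gap_adapted: "0 \<le> t \<Longrightarrow> gap t \<in> borel_measurable (F t)"
  unfolding gap_def[abs_def] using p1.adapted p2.adapted by (intro borel_measurable_diff)

lemma gap_measurable: "0 \<le> t \<Longrightarrow> gap t \<in> borel_measurable M"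
  using gap_adapted p1.measurable_F by blast

lemma gap_sq_integrable: "0 \<le> t \<Longrightarrow> sq_integrable M (gap t)"
  unfolding gap_def[abs_def] using p1.x_sq_integrable p2.x_sq_integrable by (intro sq_integrable_diff)

lemma gap_jointly_measurable: "0 \<le> T \<Longrightarrow> jointly_measurable_on T M gap"
  unfolding gap_def[abs_def] using p1.x_jointly_measurable p2.x_jointly_measurable by (intro jointly_measurable_on_diff)

lemma gap_increment_small:
  assumes T: "0 \<le> T" and \<epsilon>: "0 < (\<epsilon>::real)"
  shows "\<exists>\<delta>>0. \<forall>t s. 0 \<le> t \<longrightarrow> t \<le> s \<longrightarrow> s \<le> T \<longrightarrow> s - t < \<delta> \<longrightarrow>
    mean_square M (\<lambda>\<omega>. gap s \<omega> - gap t \<omega>) \<le> ennreal \<epsilon>"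
proof -
  have \<epsilon>4: "0 < \<epsilon> / 4" using \<epsilon> by simp
  obtain d1 where d1: "0 < d1" "\<And>t s. 0 \<le> t \<Longrightarrow> t \<le> s \<Longrightarrow> s \<le> T \<Longrightarrow> s - t < d1 \<Longrightarrow>
      mean_square M (\<lambda>\<omega>. x1 s \<omega> - x1 t \<omega>) \<le> ennreal (\<epsilon> / 4)"
    using p1.increment_small[OF T \<epsilon>4] by auto
  obtain d2 where d2: "0 < d2" "\<And>t s. 0 \<le> t \<Longrightarrow> t \<le> s \<Longrightarrow> s \<le> T \<Longrightarrow> s - t < d2 \<Longrightarrow>
      mean_square M (\<lambda>\<omega>. x2 s \<omega> - x2 t \<omega>) \<le> ennreal (\<epsilon> / 4)"
    using p2.increment_small[OF T \<epsilon>4] by auto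
  have "mean_square M (\<lambda>\<omega>. gap s \<omega> - gap t \<omega>) \<le> ennreal \<epsilon>"
    if "0 \<le> t" "t \<le> s" "s \<le> T" "s - t < min d1 d2" for t s
  proof -
    have s: "0 \<le> s" using that by simp
    have "mean_square M (\<lambda>\<omega>. (x1 s \<omega> - x1 t \<omega>) - (x2 s \<omega> - x2 t \<omega>)) \<le> ennreal (4 * (\<epsilon> / 4))"
      by (rule mean_square_diff_le(1)[OF sq_integrable_diff[OF p1.x_sq_integrable p1.x_sq_integrable] d1(2)
          sq_integrable_diff[OF p2.x_sq_integrable p2.x_sq_integrable] d2(2)])
         (use that s \<epsilon> in auto)
    then show ?thesis by (simp add: gap_def algebra_simps)
  qed
  then show ?thesis using d1(1) d2(1) by (intro exI[of _ "min d1 d2"]) auto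
qed

definition excess :: "real \<Rightarrow> real" where
  "excess t = (\<integral>\<omega>. (max 0 (gap t \<omega>))\<^sup>2 \<partial>M)"

lemma pos_part_sq_integrable:
  assumes "0 \<le> t" shows "sq_integrable M (\<lambda>\<omega>. max 0 (gap t \<omega>))"
proof (rule sq_integrable_bound[OF gap_sq_integrable[OF assms]])
  have [measurable]: "gap t \<in> borel_measurable M" using gap_measurable[OF assms] .
  show "(\<lambda>\<omega>. max 0 (gap t \<omega>)) \<in> borel_measurable M" by measurable
qed auto

lemma excess_nonneg: "0 \<le> excess t"
  unfolding excess_def by simp

text \<open>Young's inequality with a small parameter \<open>\<eta>\<close>, so that mean-square continuity of the gap implies
  continuity of the excess.\<close>

lemma excess_difference:
  assumes t: "0 \<le> t" and s: "0 \<le> s" and \<eta>: "0 < \<eta>"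
  shows "\<bar>excess s - excess t\<bar> \<le> \<eta> * excess t + (1 + 1 / \<eta>) * (\<integral>\<omega>. (gap s \<omega> - gap t \<omega>)\<^sup>2 \<partial>M)"
proof -
  define p where "p = (\<lambda>u \<omega>. max 0 (gap u \<omega>))"
  have pi: "integrable M (\<lambda>\<omega>. (p s \<omega>)\<^sup>2)" "integrable M (\<lambda>\<omega>. (p t \<omega>)\<^sup>2)"
    using pos_part_sq_integrable[OF s] pos_part_sq_integrable[OF t] by (auto simp: sq_integrable_iff p_def)
  have di: "integrable M (\<lambda>\<omega>. (gap s \<omega> - gap t \<omega>)\<^sup>2)"
    using sq_integrable_diff[OF gap_sq_integrable[OF s] gap_sq_integrable[OF t]] by (simp add: sq_integrable_iff)
  have pw: "\<bar>(max 0 a)\<^sup>2 - (max 0 b)\<^sup>2\<bar> \<le> \<eta> * (max 0 b)\<^sup>2 + (1 + 1 / \<eta>) * (a - b)\<^sup>2" for a b :: real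
  proof -
    define u v d where "u = max 0 a" and "v = max 0 b" and "d = \<bar>a - b\<bar>"
    have uv: "0 \<le> u" "0 \<le> v" "\<bar>u - v\<bar> \<le> d" "0 \<le> d" by (auto simp: u_def v_def d_def max_def)
    have "\<bar>u\<^sup>2 - v\<^sup>2\<bar> = \<bar>u - v\<bar> * (u + v)"
      using uv by (simp add: power2_eq_square square_diff_square_factored abs_mult mult.commute)
    also have "\<dots> \<le> d * (2 * v + d)" using uv by (intro mult_mono) auto
    also have "\<dots> = 2 * v * d + d\<^sup>2" by (simp add: power2_eq_square algebra_simps)
    also have "2 * v * d \<le> \<eta> * v\<^sup>2 + d\<^sup>2 / \<eta>"
    proof -
      have "0 \<le> (\<eta> * v - d)\<^sup>2 / \<eta>" using \<eta> by simp
      also have "\<dots> = \<eta> * v\<^sup>2 + d\<^sup>2 / \<eta> - 2 * v * d"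
        using \<eta> by (simp add: power2_eq_square field_simps)
      finally show ?thesis by simp
    qed
    finally have "\<bar>u\<^sup>2 - v\<^sup>2\<bar> \<le> \<eta> * v\<^sup>2 + (1 + 1 / \<eta>) * d\<^sup>2" by (simp add: distrib_right)
    then show ?thesis by (simp add: u_def v_def d_def)
  qed
  have "excess s - excess t = (\<integral>\<omega>. (p s \<omega>)\<^sup>2 - (p t \<omega>)\<^sup>2 \<partial>M)"
    using Bochner_Integration.integral_diff[OF pi] by (simp add: excess_def p_def)
  then have "\<bar>excess s - excess t\<bar> \<le> (\<integral>\<omega>. \<bar>(p s \<omega>)\<^sup>2 - (p t \<omega>)\<^sup>2\<bar> \<partial>M)" by simp
  also have "\<dots> \<le> (\<integral>\<omega>. \<eta> * (p t \<omega>)\<^sup>2 + (1 + 1 / \<eta>) * (gap s \<omega> - gap t \<omega>)\<^sup>2 \<partial>M)"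
    using pi di by (intro integral_mono) (auto simp: p_def pw intro!: integrable_abs)
  also have "\<dots> = \<eta> * excess t + (1 + 1 / \<eta>) * (\<integral>\<omega>. (gap s \<omega> - gap t \<omega>)\<^sup>2 \<partial>M)"
    using pi di by (simp add: excess_def p_def)
  finally show ?thesis .
qed

lemma excess_continuous: "continuous_on {0..} excess"
  unfolding continuous_on_iff
proof (intro ballI allI impI)
  fix t e :: real assume t: "t \<in> {0..}" and e: "0 < e"
  define \<eta> where "\<eta> = e / (2 * (excess t + 1))"
  have E1: "0 < excess t + 1" using excess_nonneg[of t] by simp
  have \<eta>: "0 < \<eta>" using E1 e by (simp add: \<eta>_def)
  have \<eta>E: "\<eta> * excess t \<le> e / 2"
  proof -
    have "\<eta> * excess t \<le> \<eta> * (excess t + 1)" using \<eta> by simp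
    also have "\<dots> = e / 2" using E1 by (simp add: \<eta>_def field_simps)
    finally show ?thesis .
  qed
  define c where "c = e / (4 * (1 + 1 / \<eta>))"
  have \<eta>1: "0 < 1 + 1 / \<eta>" using \<eta> by (simp add: add_pos_pos)
  have c: "0 < c" using \<eta>1 e by (simp add: c_def)
  have cE: "(1 + 1 / \<eta>) * c = e / 4"
  proof -
    have "(1 + 1 / \<eta>) * (e / (4 * (1 + 1 / \<eta>))) = e / 4"
      using \<eta>1 by (metis (no_types, opaque_lifting) divide_divide_eq_left' less_irrefl nonzero_mult_div_cancel_left times_divide_eq_right)
    then show ?thesis by (simp add: c_def)
  qed
  obtain \<delta> where \<delta>: "0 < \<delta>" "\<And>u s. 0 \<le> u \<Longrightarrow> u \<le> s \<Longrightarrow> s \<le> t + 1 \<Longrightarrow> s - u < \<delta> \<Longrightarrow>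
      mean_square M (\<lambda>\<omega>. gap s \<omega> - gap u \<omega>) \<le> ennreal c"
    using gap_increment_small[of "t + 1", OF _ c] t by auto
  have "dist (excess s) (excess t) < e" if s: "s \<in> {0..}" "dist s t < min \<delta> 1" for s
  proof -
    have "mean_square M (\<lambda>\<omega>. gap s \<omega> - gap t \<omega>) \<le> ennreal c"
    proof (cases "t \<le> s")
      case True then show ?thesis using \<delta>(2)[of t s] s t by (simp add: dist_real_def)
    next
      case False then show ?thesis using \<delta>(2)[of s t] s t
        by (simp add: dist_real_def mean_square_commute[of M "gap s"])
    qed
    moreover have "(\<lambda>\<omega>. gap s \<omega> - gap t \<omega>) \<in> borel_measurable M"
      using gap_measurable s t by (intro borel_measurable_diff) auto
    ultimately have "(\<integral>\<omega>. (gap s \<omega> - gap t \<omega>)\<^sup>2 \<partial>M) \<le> c" using c by (intro integral_square_le(2)) auto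
    then have I: "(1 + 1 / \<eta>) * (\<integral>\<omega>. (gap s \<omega> - gap t \<omega>)\<^sup>2 \<partial>M) \<le> e / 4"
      using mult_left_mono[of _ c "1 + 1 / \<eta>"] \<eta>1 cE by force
    have "\<bar>excess s - excess t\<bar> \<le> \<eta> * excess t + (1 + 1 / \<eta>) * (\<integral>\<omega>. (gap s \<omega> - gap t \<omega>)\<^sup>2 \<partial>M)"
      using s t by (intro excess_difference \<eta>) auto
    also have "\<dots> \<le> e / 2 + e / 4" by (intro add_mono \<eta>E I)
    finally show ?thesis using e unfolding dist_real_def by linarith
  qed
  then show "\<exists>d>0. \<forall>s\<in>{0..}. dist s t < d \<longrightarrow> dist (excess s) (excess t) < e"
    using \<delta>(1) by (intro exI[of _ "min \<delta> 1"]) auto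
qed

lemma excess_0: "excess 0 = 0"
proof -
  have "AE \<omega> in M. (max 0 (gap 0 \<omega>))\<^sup>2 = 0"
    using initial_le p1.x_at_0 p2.x_at_0 by eventually_elim (simp add: gap_def)
  then show ?thesis unfolding excess_def by (subst integral_cong_AE[where g = "\<lambda>_. 0"])
     (use pos_part_sq_integrable[of 0] in \<open>auto simp: sq_integrable_iff\<close>)
qed

text \<open>The integral is finite for continuous paths, so the default value of \<open>enn2real\<close> occurs only on a
  null set; taking the integral in \<open>ennreal\<close> makes measurability in \<open>\<omega>\<close> a consequence of Tonelli's
  theorem.\<close>

definition gap_energy :: "real \<Rightarrow> real \<Rightarrow> 'a \<Rightarrow> real" where
  "gap_energy t s \<omega> = enn2real (\<integral>\<^sup>+r\<in>{t..s}. ennreal ((gap r \<omega> - gap t \<omega>)\<^sup>2) \<partial>lborel)"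

text \<open>With \<open>p = max 0 (gap t)\<close>, the integrand \<open>2 p (\<alpha>1 r - \<alpha>2 r)\<close> is at most
  \<open>2 C p \<bar>gap r\<bar> \<le> 2 C p (p + \<bar>gap r - gap t\<bar>)\<close>, because \<open>p \<bar>gap t\<bar> = p\<^sup>2\<close>. Absorbing the mixed term into
  \<open>p\<^sup>2\<close> and \<open>(gap r - gap t)\<^sup>2\<close> leaves the energy, which is negligible.\<close>

lemma drift_term_le:
  assumes ts: "0 \<le> t" "t \<le> s"
  shows "AE \<omega> in M. 2 * (max 0 (gap t \<omega>) * (p1.drift_increment t s \<omega> - p2.drift_increment t s \<omega>))
    \<le> 3 * C * (s - t) * (max 0 (gap t \<omega>))\<^sup>2
      + C * gap_energy t s \<omega>"
  using p1.drift_increment_eq[OF ts] p2.drift_increment_eq[OF ts] p1.drift_continuous p2.drift_continuous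
    p1.paths_continuous p2.paths_continuous drift_le
proof eventually_elim
  case (elim \<omega>)
  define p where "p = max 0 (gap t \<omega>)"
  have p: "0 \<le> p" by (simp add: p_def)
  have i1: "set_integrable lborel {t..s} (\<lambda>r. \<alpha>1 r \<omega>)" by (rule p1.drift_integrable[OF elim(3) ts(1)])
  have i2: "set_integrable lborel {t..s} (\<lambda>r. \<alpha>2 r \<omega>)" by (rule p2.drift_integrable[OF elim(4) ts(1)])
  have "continuous_on {t..s} (\<lambda>r. x1 r \<omega>)" "continuous_on {t..s} (\<lambda>r. x2 r \<omega>)"
    using continuous_on_subset[OF elim(5), of "{t..s}"] continuous_on_subset[OF elim(6), of "{t..s}"] ts by auto
  then have "continuous_on {t..s} (\<lambda>r. (gap r \<omega> - gap t \<omega>)\<^sup>2)"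
    unfolding gap_def by (intro continuous_intros)
  then have iY: "set_integrable lborel {t..s} (\<lambda>r. (gap r \<omega> - gap t \<omega>)\<^sup>2)" by (rule borel_integrable_atLeastAtMost')
  have ic: "set_integrable lborel {t..s} (\<lambda>r. c)" for c :: real
    by (rule borel_integrable_atLeastAtMost') (rule continuous_on_const)
  have cint: "(LBINT r:{t..s}. c) = (s - t) * c" for c :: real
    using ts by (simp add: set_lebesgue_integral_def)
  have pw: "2 * p * (\<alpha>1 r \<omega> - \<alpha>2 r \<omega>) \<le> 3 * C * p\<^sup>2 + C * (gap r \<omega> - gap t \<omega>)\<^sup>2" if "r \<in> {t..s}" for r
  proof -
    define d where "d = \<bar>gap r \<omega> - gap t \<omega>\<bar>"
    have "\<alpha>1 r \<omega> - \<alpha>2 r \<omega> \<le> C * \<bar>gap r \<omega>\<bar>" using elim(7) that ts by (simp add: gap_def)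
    then have "2 * p * (\<alpha>1 r \<omega> - \<alpha>2 r \<omega>) \<le> 2 * p * (C * \<bar>gap r \<omega>\<bar>)" using p by (intro mult_left_mono) auto
    also have "p * \<bar>gap r \<omega>\<bar> \<le> p * (p + d)"
    proof (cases "gap t \<omega> \<le> 0")
      case True then show ?thesis by (simp add: p_def)
    next
      case False
      then have "\<bar>gap r \<omega>\<bar> \<le> p + d" by (simp add: p_def d_def)
      then show ?thesis using p by (intro mult_left_mono)
    qed
    then have "2 * p * (C * \<bar>gap r \<omega>\<bar>) \<le> 2 * C * (p * (p + d))"
      using mult_left_mono[of "p * \<bar>gap r \<omega>\<bar>" "p * (p + d)" "2 * C"] p1.C_nonneg by (simp add: mult_ac)
    also have "2 * (p * (p + d)) \<le> 3 * p\<^sup>2 + d\<^sup>2"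
      using zero_le_power2[of "p - d"] by (simp add: power2_eq_square algebra_simps)
    then have "2 * C * (p * (p + d)) \<le> C * (3 * p\<^sup>2 + d\<^sup>2)"
      using mult_left_mono[of "2 * (p * (p + d))" "3 * p\<^sup>2 + d\<^sup>2" C] p1.C_nonneg by (simp add: mult_ac)
    finally show ?thesis by (simp add: d_def algebra_simps)
  qed
  have "2 * (p * (p1.drift_increment t s \<omega> - p2.drift_increment t s \<omega>))
    = (LBINT r:{t..s}. 2 * p * (\<alpha>1 r \<omega> - \<alpha>2 r \<omega>))"
    using i1 i2 elim(1,2) by (simp add: set_integral_diff(2))
  also have "\<dots> \<le> (LBINT r:{t..s}. 3 * C * p\<^sup>2 + C * (gap r \<omega> - gap t \<omega>)\<^sup>2)"
    using pw by (intro set_integral_mono set_integrable_mult_right set_integral_diff(1) set_integral_add(1) i1 i2 iY ic)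
  also have "\<dots> = (LBINT r:{t..s}. 3 * C * p\<^sup>2) + (LBINT r:{t..s}. C * (gap r \<omega> - gap t \<omega>)\<^sup>2)"
    by (intro set_integral_add(2) ic set_integrable_mult_right iY)
  also have "\<dots> = 3 * C * (s - t) * p\<^sup>2 + C * (LBINT r:{t..s}. (gap r \<omega> - gap t \<omega>)\<^sup>2)"
    by (simp add: cint)
  also have "(LBINT r:{t..s}. (gap r \<omega> - gap t \<omega>)\<^sup>2)
    = gap_energy t s \<omega>"
  proof -
    have "(\<integral>\<^sup>+r\<in>{t..s}. ennreal ((gap r \<omega> - gap t \<omega>)\<^sup>2) \<partial>lborel)
      = (\<integral>\<^sup>+r. ennreal (indicator {t..s} r *\<^sub>R (gap r \<omega> - gap t \<omega>)\<^sup>2) \<partial>lborel)"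
      by (intro nn_integral_cong) (auto simp: indicator_def)
    also have "\<dots> = ennreal (LBINT r:{t..s}. (gap r \<omega> - gap t \<omega>)\<^sup>2)"
      unfolding set_lebesgue_integral_def
      by (rule nn_integral_eq_integral[OF iY[unfolded set_integrable_def]]) auto
    finally show ?thesis by (simp add: gap_energy_def set_lebesgue_integral_def)
  qed
  finally show ?case by (simp add: p_def)
qed

lemma gap_energy_small:
  assumes t: "0 \<le> t" and \<epsilon>: "0 < (\<epsilon>::real)"
  shows "\<exists>\<delta>>0. \<forall>s. t \<le> s \<longrightarrow> s < t + \<delta> \<longrightarrow> integrable M (gap_energy t s) \<and> (\<integral>\<omega>. gap_energy t s \<omega> \<partial>M) \<le> \<epsilon> * (s - t)"
proof -
  obtain d where d: "0 < d" "\<And>r. t \<le> r \<Longrightarrow> r \<le> t + 1 \<Longrightarrow> r - t < d \<Longrightarrow>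
      mean_square M (\<lambda>\<omega>. gap r \<omega> - gap t \<omega>) \<le> ennreal \<epsilon>"
    using gap_increment_small[of "t + 1", OF _ \<epsilon>] t by fastforce
  have "integrable M (gap_energy t s) \<and> (\<integral>\<omega>. gap_energy t s \<omega> \<partial>M) \<le> \<epsilon> * (s - t)"
    if s: "t \<le> s" "s < t + min d 1" for s
  proof -
    have s0: "0 \<le> s" using s t by simp
    have jm: "jointly_measurable_on s M (\<lambda>r \<omega>. gap r \<omega> - gap t \<omega>)"
      by (intro jointly_measurable_on_diff gap_jointly_measurable jointly_measurable_on_const gap_measurable s0 t)
    have [measurable]: "gap_energy t s \<in> borel_measurable M"
      unfolding gap_energy_def[abs_def]
      by (rule borel_measurable_enn2real[OF mean_square_on_measurable[OF jm t s(1) order_refl]])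
    have "(\<integral>\<^sup>+\<omega>. ennreal (gap_energy t s \<omega>) \<partial>M) \<le> mean_square_on M t s (\<lambda>r \<omega>. gap r \<omega> - gap t \<omega>)"
      unfolding mean_square_on_def gap_energy_def by (intro nn_integral_mono) (simp add: ennreal_enn2real_if)
    also have "\<dots> \<le> ennreal (\<epsilon> * (s - t))"
      using \<epsilon> s by (intro p1.mean_square_on_le[OF jm t s(1) order_refl] d) auto
    finally have le: "(\<integral>\<^sup>+\<omega>. ennreal (gap_energy t s \<omega>) \<partial>M) \<le> ennreal (\<epsilon> * (s - t))" .
    have nonneg: "0 \<le> gap_energy t s \<omega>" for \<omega> by (simp add: gap_energy_def)
    have int: "integrable M (gap_energy t s)"
      using le nonneg by (intro integrableI_nonneg) (auto intro: le_less_trans)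
    have "ennreal (\<integral>\<omega>. gap_energy t s \<omega> \<partial>M) \<le> ennreal (\<epsilon> * (s - t))"
      using le nn_integral_eq_integral[OF int] nonneg by simp
    with int show ?thesis using \<epsilon> s by (simp add: ennreal_le_iff)
  qed
  then show ?thesis using d(1) by (intro exI[of _ "min d 1"]) auto
qed

text \<open>The increment of the gap is the sum of \<open>drift_part\<close> and \<open>martingale_part\<close>; the latter is the frozen
  increment \<open>Q\<close> plus \<open>residual_part\<close>.\<close>

definition drift_part :: "real \<Rightarrow> real \<Rightarrow> 'a \<Rightarrow> real" where
  "drift_part t s \<omega> = p1.drift_increment t s \<omega> - p2.drift_increment t s \<omega>"

definition martingale_part :: "real \<Rightarrow> real \<Rightarrow> 'a \<Rightarrow> real" where
  "martingale_part t s \<omega> = (\<Sum>k\<in>UNIV. J1 k s \<omega> - J1 k t \<omega>) - (\<Sum>k\<in>UNIV. J2 k s \<omega> - J2 k t \<omega>)"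

definition residual_part :: "real \<Rightarrow> real \<Rightarrow> 'a \<Rightarrow> real" where
  "residual_part t s \<omega> = p1.residual t s \<omega> - p2.residual t s \<omega>"

text \<open>The one-step inequality before taking expectations. The power sums on the right dominate \<open>V\<^sup>2\<close> and
  \<open>V^4\<close> by the Cauchy-Schwarz inequality, and unlike \<open>V\<close> they have explicit moments.\<close>

lemma excess_integrand_step:
  assumes ts: "0 \<le> t" "t \<le> s" and m: "m = real CARD('m)"
  shows "AE \<omega> in M. (max 0 (gap s \<omega>))\<^sup>2 \<le> (max 0 (gap t \<omega>))\<^sup>2 + 3 * C * (s - t) * (max 0 (gap t \<omega>))\<^sup>2
      + C * gap_energy t s \<omega> + 2 * (max 0 (gap t \<omega>) * martingale_part t s \<omega>)
      + 3 * C\<^sup>2 * m * ((max 0 (gap t \<omega>))\<^sup>2 * (\<Sum>k\<in>UNIV. (W k s \<omega> - W k t \<omega>) ^ 2))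
      + 2 * C ^ 4 * m ^ 3 * ((gap t \<omega>)\<^sup>2 * (\<Sum>k\<in>UNIV. (W k s \<omega> - W k t \<omega>) ^ 4))
      + 4 * (drift_part t s \<omega>)\<^sup>2 + 4 * (residual_part t s \<omega>)\<^sup>2"
proof -
  have "AE \<omega> in M. \<forall>k. \<bar>\<beta> k t (x1 t \<omega>) \<omega> - \<beta> k t (x2 t \<omega>) \<omega>\<bar> \<le> C * \<bar>gap t \<omega>\<bar>"
    unfolding AE_all_countable
  proof
    fix k
    show "AE \<omega> in M. \<bar>\<beta> k t (x1 t \<omega>) \<omega> - \<beta> k t (x2 t \<omega>) \<omega>\<bar> \<le> C * \<bar>gap t \<omega>\<bar>"
      using p1.\<beta>_lipschitz[of k] by eventually_elim (use ts in \<open>simp add: gap_def\<close>)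
  qed
  with drift_term_le[OF ts] show ?thesis
  proof eventually_elim
    case (elim \<omega>)
    define p where "p = max 0 (gap t \<omega>)"
    define w where "w = (\<lambda>k. W k s \<omega> - W k t \<omega>)"
    define V where "V = (\<Sum>k\<in>UNIV. \<bar>w k\<bar>)"
    define S2 where "S2 = (\<Sum>k\<in>UNIV. w k ^ 2)"
    define S4 where "S4 = (\<Sum>k\<in>UNIV. w k ^ 4)"
    define Q where "Q = (\<Sum>k\<in>UNIV. (\<beta> k t (x1 t \<omega>) \<omega> - \<beta> k t (x2 t \<omega>) \<omega>) * w k)"
    have N: "martingale_part t s \<omega> = Q + residual_part t s \<omega>"
      unfolding martingale_part_def Q_def residual_part_def p1.residual_def p2.residual_def w_def
      by (simp add: sum_subtractf left_diff_distrib)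
    have gap_s: "gap s \<omega> = gap t \<omega> + drift_part t s \<omega> + Q + residual_part t s \<omega>"
      using N by (simp add: gap_def drift_part_def martingale_part_def p1.drift_increment_def p2.drift_increment_def)
    have V0: "0 \<le> V" unfolding V_def by (intro sum_nonneg) auto
    have V2: "V\<^sup>2 \<le> m * S2"
      using Cauchy_Schwarz_ineq_sum[of "\<lambda>k. \<bar>w k\<bar>" "\<lambda>_. 1" UNIV]
      by (simp add: V_def S2_def m mult.commute)
    have V4: "V ^ 4 \<le> m ^ 3 * S4"
    proof -
      have "V ^ 4 = (V\<^sup>2)\<^sup>2" by simp
      also have "\<dots> \<le> (m * S2)\<^sup>2" by (intro power_mono V2) simp
      also have "\<dots> = m\<^sup>2 * S2\<^sup>2" by (simp add: power_mult_distrib)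
      also have "\<dots> \<le> m\<^sup>2 * (m * S4)"
        using Cauchy_Schwarz_ineq_sum[of "\<lambda>k. w k ^ 2" "\<lambda>_. 1" UNIV]
        by (intro mult_left_mono) (simp_all add: S4_def S2_def m mult.commute flip: power_mult)
      finally show ?thesis by (simp add: power2_eq_square power3_eq_cube mult_ac)
    qed
    have Q: "\<bar>Q\<bar> \<le> C * \<bar>gap t \<omega>\<bar> * V"
    proof -
      have "\<bar>Q\<bar> \<le> (\<Sum>k\<in>UNIV. \<bar>(\<beta> k t (x1 t \<omega>) \<omega> - \<beta> k t (x2 t \<omega>) \<omega>) * w k\<bar>)"
        unfolding Q_def by (rule sum_abs)
      also have "\<dots> \<le> (\<Sum>k\<in>UNIV. C * \<bar>gap t \<omega>\<bar> * \<bar>w k\<bar>)"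
        unfolding abs_mult using elim(2) by (intro sum_mono mult_right_mono) auto
      finally show ?thesis by (simp add: V_def sum_distrib_left)
    qed
    have "(max 0 (gap s \<omega>))\<^sup>2 \<le> p\<^sup>2 + 2 * (p * (drift_part t s \<omega> + (Q + residual_part t s \<omega>)))
        + 3 * C\<^sup>2 * (p\<^sup>2 * V\<^sup>2) + 2 * C ^ 4 * ((gap t \<omega>)\<^sup>2 * V ^ 4)
        + 4 * (drift_part t s \<omega>)\<^sup>2 + 4 * (residual_part t s \<omega>)\<^sup>2"
      unfolding gap_s by (rule sq_pos_part_step[OF Q p1.C_nonneg V0 p_def])
    also have "2 * (p * (drift_part t s \<omega> + (Q + residual_part t s \<omega>)))
        = 2 * (p * drift_part t s \<omega>) + 2 * (p * martingale_part t s \<omega>)"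
      unfolding N by (simp add: distrib_left)
    finally have "(max 0 (gap s \<omega>))\<^sup>2 \<le> p\<^sup>2 + (2 * (p * drift_part t s \<omega>) + 2 * (p * martingale_part t s \<omega>))
        + 3 * C\<^sup>2 * (p\<^sup>2 * V\<^sup>2) + 2 * C ^ 4 * ((gap t \<omega>)\<^sup>2 * V ^ 4)
        + 4 * (drift_part t s \<omega>)\<^sup>2 + 4 * (residual_part t s \<omega>)\<^sup>2" .
    moreover have "2 * (p * drift_part t s \<omega>) \<le> 3 * C * (s - t) * p\<^sup>2 + C * gap_energy t s \<omega>"
      using elim(1) by (simp add: p_def drift_part_def)
    moreover have "3 * C\<^sup>2 * (p\<^sup>2 * V\<^sup>2) \<le> 3 * C\<^sup>2 * m * (p\<^sup>2 * S2)"
      using mult_left_mono[OF V2, of "3 * C\<^sup>2 * p\<^sup>2"] by (simp add: mult_ac)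
    moreover have "2 * C ^ 4 * ((gap t \<omega>)\<^sup>2 * V ^ 4) \<le> 2 * C ^ 4 * m ^ 3 * ((gap t \<omega>)\<^sup>2 * S4)"
      using mult_left_mono[OF V4, of "2 * C ^ 4 * (gap t \<omega>)\<^sup>2"] by (simp add: mult_ac)
    moreover have "(\<Sum>k\<in>UNIV. (W k s \<omega> - W k t \<omega>) ^ 2) = S2" "(\<Sum>k\<in>UNIV. (W k s \<omega> - W k t \<omega>) ^ 4) = S4"
      by (simp_all add: S2_def S4_def w_def)
    ultimately show ?case unfolding p_def[symmetric] by (simp only:)
  qed
qed

lemma excess_step:
  assumes t: "0 \<le> t" and \<epsilon>: "0 < \<epsilon>"
  shows "\<exists>\<delta>>0. \<forall>h. 0 < h \<longrightarrow> h < \<delta> \<longrightarrow>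
    excess (t + h) \<le> excess t + ((3 * C + 3 * C\<^sup>2 * (real CARD('m))\<^sup>2) * excess t + \<epsilon>) * h"
proof -
  define m where "m = real CARD('m)"
  have m: "0 \<le> m" by (simp add: m_def)
  \<comment> \<open>The negligible terms add up to \<open>C + 1 + 16 + 16\<close> times \<open>e * h\<close>.\<close>
  define e where "e = \<epsilon> / (C + 33)"
  have e: "0 < e" "(C + 33) * e = \<epsilon>" using p1.C_nonneg \<epsilon> by (simp_all add: e_def)
  obtain d1 where d1: "0 < d1" "\<And>s. t \<le> s \<Longrightarrow> s < t + d1 \<Longrightarrow>
      integrable M (gap_energy t s) \<and> (\<integral>\<omega>. gap_energy t s \<omega> \<partial>M) \<le> e * (s - t)"
    using gap_energy_small[OF t e(1)] by auto
  obtain d2 where d2: "0 < d2" "\<And>s. t \<le> s \<Longrightarrow> s < t + d2 \<Longrightarrow> mean_square M (p1.drift_increment t s) \<le> ennreal (e * (s - t))"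
    using p1.drift_increment_small[OF t e(1)] by auto
  obtain d3 where d3: "0 < d3" "\<And>s. t \<le> s \<Longrightarrow> s < t + d3 \<Longrightarrow> mean_square M (p2.drift_increment t s) \<le> ennreal (e * (s - t))"
    using p2.drift_increment_small[OF t e(1)] by auto
  obtain d4 where d4: "0 < d4" "\<And>s. t \<le> s \<Longrightarrow> s < t + d4 \<Longrightarrow>
      sq_integrable M (p1.residual t s) \<and> mean_square M (p1.residual t s) \<le> ennreal (e * (s - t))"
    using p1.residual_small[OF t e(1)] by auto
  obtain d5 where d5: "0 < d5" "\<And>s. t \<le> s \<Longrightarrow> s < t + d5 \<Longrightarrow>
      sq_integrable M (p2.residual t s) \<and> mean_square M (p2.residual t s) \<le> ennreal (e * (s - t))"
    using p2.residual_small[OF t e(1)] by auto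
  define E2 where "E2 = (\<integral>\<omega>. (gap t \<omega>)\<^sup>2 \<partial>M)"
  define A where "A = 2 * C ^ 4 * m ^ 3 * (3 * m * E2)"
  have A: "0 \<le> A" unfolding A_def E2_def using p1.C_nonneg m by simp
  \<comment> \<open>A step shorter than \<open>d6\<close> makes the crossing term \<open>A * h\<^sup>2\<close> at most \<open>e * h\<close>.\<close>
  define d6 where "d6 = e / (A + 1)"
  have d6: "0 < d6" using e A by (simp add: d6_def)
  define \<delta> where "\<delta> = min (min (min d1 d2) (min d3 d4)) (min d5 d6)"
  have \<delta>: "0 < \<delta>" using d1 d2 d3 d4 d5 d6 by (simp add: \<delta>_def)
  have "excess (t + h) \<le> excess t + ((3 * C + 3 * C\<^sup>2 * m\<^sup>2) * excess t + \<epsilon>) * h"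
    if h: "0 < h" "h < \<delta>" for h
  proof -
    define s where "s = t + h"
    have s: "0 \<le> s" "t \<le> s" "s - t = h" using t h by (auto simp: s_def)
    have sd: "s < t + d1" "s < t + d2" "s < t + d3" "s < t + d4" "s < t + d5" "h < d6"
      using h by (auto simp: \<delta>_def s_def)
    have eh: "0 \<le> e * h" using e h by simp
    have Ah: "A * h * h \<le> e * h"
    proof -
      have "A * h \<le> (A + 1) * d6" using A sd h by (intro mult_mono) auto
      also have "\<dots> = e" using A by (simp add: d6_def)
      finally show ?thesis using h by (intro mult_right_mono) auto
    qed
    define p where "p = (\<lambda>\<omega>. max 0 (gap t \<omega>))"
    have p_sq: "sq_integrable M p" unfolding p_def by (rule pos_part_sq_integrable[OF t])
    have ep: "(\<integral>\<omega>. (p \<omega>)\<^sup>2 \<partial>M) = excess t" by (simp add: p_def excess_def)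
    have pF: "p \<in> borel_measurable (F t)"
      unfolding p_def using gap_adapted[OF t] by (intro borel_measurable_max) auto
    have p2F: "(\<lambda>\<omega>. (p \<omega>)\<^sup>2) \<in> borel_measurable (F t)" using pF by (rule borel_measurable_power)
    have g2F: "(\<lambda>\<omega>. (gap t \<omega>)\<^sup>2) \<in> borel_measurable (F t)" using gap_adapted[OF t] by (rule borel_measurable_power)
    have p2: "integrable M (\<lambda>\<omega>. (p \<omega>)\<^sup>2)" and g2: "integrable M (\<lambda>\<omega>. (gap t \<omega>)\<^sup>2)"
      and s2: "integrable M (\<lambda>\<omega>. (max 0 (gap s \<omega>))\<^sup>2)"
      using p_sq gap_sq_integrable[OF t] pos_part_sq_integrable[OF s(1)] by (auto simp: sq_integrable_iff)
    note S2 = p1.wiener_power_sum_indep[of W, OF p1.wiener t s(2) p2F p2, where n = 2 and I = UNIV]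
    note S4 = p1.wiener_power_sum_indep[of W, OF p1.wiener t s(2) g2F g2, where n = 4 and I = UNIV]
    have S2i: "(\<integral>\<omega>. (p \<omega>)\<^sup>2 * (\<Sum>k\<in>UNIV. (W k s \<omega> - W k t \<omega>) ^ 2) \<partial>M) = m * (excess t * h)"
      unfolding S2(2) by (simp add: p1.wiener_increment_moments(3)[OF p1.wiener t s(2)] s(3) m_def excess_def p_def)
    have S4i: "(\<integral>\<omega>. (gap t \<omega>)\<^sup>2 * (\<Sum>k\<in>UNIV. (W k s \<omega> - W k t \<omega>) ^ 4) \<partial>M) = m * (E2 * (3 * h\<^sup>2))"
      unfolding S4(2) by (simp add: p1.wiener_increment_moments(4)[OF p1.wiener t s(2)] s(3) m_def E2_def)
    note o1 = p1.diffusion_increment_orthogonal[OF t s(2) pF p_sq]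
    note o2 = p2.diffusion_increment_orthogonal[OF t s(2) pF p_sq]
    have N: "integrable M (\<lambda>\<omega>. p \<omega> * martingale_part t s \<omega>)" "(\<integral>\<omega>. p \<omega> * martingale_part t s \<omega> \<partial>M) = 0"
      unfolding martingale_part_def right_diff_distrib[of "p _" "sum _ _"] using o1 o2 by simp_all
    have L: "integrable M (gap_energy t s)" "(\<integral>\<omega>. gap_energy t s \<omega> \<partial>M) \<le> e * h"
      using d1(2)[OF s(2) sd(1)] s(3) by auto
    have D: "integrable M (\<lambda>\<omega>. (drift_part t s \<omega>)\<^sup>2)" "(\<integral>\<omega>. (drift_part t s \<omega>)\<^sup>2 \<partial>M) \<le> 4 * (e * h)"
      unfolding drift_part_def
      using mean_square_diff_le(2,3)[OF p1.drift_increment_sq_integrable[OF t s(2)] d2(2)[OF s(2) sd(2), unfolded s(3)]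
          p2.drift_increment_sq_integrable[OF t s(2)] d3(2)[OF s(2) sd(3), unfolded s(3)] eh] .
    have R: "integrable M (\<lambda>\<omega>. (residual_part t s \<omega>)\<^sup>2)" "(\<integral>\<omega>. (residual_part t s \<omega>)\<^sup>2 \<partial>M) \<le> 4 * (e * h)"
      unfolding residual_part_def
      using mean_square_diff_le(2,3)[OF conjunct1[OF d4(2)[OF s(2) sd(4)]] conjunct2[OF d4(2)[OF s(2) sd(4)], unfolded s(3)]
          conjunct1[OF d5(2)[OF s(2) sd(5)]] conjunct2[OF d5(2)[OF s(2) sd(5)], unfolded s(3)] eh] .
    have "excess s \<le> (\<integral>\<omega>. (p \<omega>)\<^sup>2 + 3 * C * h * (p \<omega>)\<^sup>2 + C * gap_energy t s \<omega> + 2 * (p \<omega> * martingale_part t s \<omega>)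
      + 3 * C\<^sup>2 * m * ((p \<omega>)\<^sup>2 * (\<Sum>k\<in>UNIV. (W k s \<omega> - W k t \<omega>) ^ 2))
      + 2 * C ^ 4 * m ^ 3 * ((gap t \<omega>)\<^sup>2 * (\<Sum>k\<in>UNIV. (W k s \<omega> - W k t \<omega>) ^ 4))
      + 4 * (drift_part t s \<omega>)\<^sup>2 + 4 * (residual_part t s \<omega>)\<^sup>2 \<partial>M)"
      unfolding excess_def
      using excess_integrand_step[OF t s(2) m_def, unfolded s(3)]
      by (intro integral_mono_AE s2 Bochner_Integration.integrable_add Bochner_Integration.integrable_mult_right
          p2 L(1) N(1) S2(1) S4(1) D(1) R(1)) (simp add: p_def)
    also have "\<dots> = excess t + 3 * C * h * excess t + C * (\<integral>\<omega>. gap_energy t s \<omega> \<partial>M)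
      + 3 * C\<^sup>2 * m * (m * (excess t * h)) + 2 * C ^ 4 * m ^ 3 * (m * (E2 * (3 * h\<^sup>2)))
      + 4 * (\<integral>\<omega>. (drift_part t s \<omega>)\<^sup>2 \<partial>M) + 4 * (\<integral>\<omega>. (residual_part t s \<omega>)\<^sup>2 \<partial>M)"
      using p2 L(1) N S2(1) S2i S4(1) S4i D(1) R(1) by (simp add: ep)
    also have "\<dots> \<le> excess t + 3 * C * h * excess t + C * (e * h)
      + 3 * C\<^sup>2 * m * (m * (excess t * h)) + e * h + 4 * (4 * (e * h)) + 4 * (4 * (e * h))"
    proof -
      have "2 * C ^ 4 * m ^ 3 * (m * (E2 * (3 * h\<^sup>2))) = A * h * h"
        by (simp add: A_def power2_eq_square mult_ac)
      moreover have "C * (\<integral>\<omega>. gap_energy t s \<omega> \<partial>M) \<le> C * (e * h)" by (intro mult_left_mono L(2) p1.C_nonneg)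
      ultimately show ?thesis using D(2) R(2) Ah by linarith
    qed
    also have "\<dots> = excess t + ((3 * C + 3 * C\<^sup>2 * m\<^sup>2) * excess t + (C + 33) * e) * h"
      by (simp add: power2_eq_square algebra_simps)
    finally show ?thesis unfolding e(2) s_def .
  qed
  then show ?thesis using \<delta> unfolding m_def by blast
qed

text \<open>The excess vanishes at all times. The null set on which the inequality fails depends on the time,
  so it is first chosen for all rational times together.\<close>

lemma comparison: "AE \<omega> in M. \<forall>t\<ge>0. x1 t \<omega> \<le> x2 t \<omega>"
proof -
  have "excess t \<le> 0" if "0 \<le> t" for t
    by (rule dini_gronwall[OF excess_continuous _ _ excess_step that]) (use p1.C_nonneg in \<open>auto simp: excess_0\<close>)
  then have zero: "excess t = 0" if "0 \<le> t" for t
    using excess_nonneg[of t] that by (simp add: order_antisym)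
  have le: "AE \<omega> in M. x1 t \<omega> \<le> x2 t \<omega>" if "0 \<le> t" for t
  proof -
    have "AE \<omega> in M. (max 0 (gap t \<omega>))\<^sup>2 = 0"
      using zero[OF that] pos_part_sq_integrable[OF that] unfolding excess_def
      by (subst (asm) integral_nonneg_eq_0_iff_AE) (auto simp: sq_integrable_iff)
    then show ?thesis by eventually_elim (simp add: gap_def max_def split: if_splits)
  qed
  have "AE \<omega> in M. \<forall>q::rat. 0 \<le> q \<longrightarrow> x1 (of_rat q) \<omega> \<le> x2 (of_rat q) \<omega>"
    unfolding AE_all_countable by (auto intro: le)
  then show ?thesis
    using p1.paths_continuous p2.paths_continuous
  proof eventually_elim
    case (elim \<omega>)
    show ?case
    proof (intro allI impI)
      fix t :: real assume t: "0 \<le> t"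
      show "x1 t \<omega> \<le> x2 t \<omega>"
      proof (rule ccontr)
        assume "\<not> ?thesis"
        then have pos: "0 < x1 t \<omega> - x2 t \<omega>" by simp
        have "continuous_on {0..} (\<lambda>t. x1 t \<omega> - x2 t \<omega>)" using elim(2,3) by (intro continuous_on_diff)
        then obtain d where d: "0 < d" "\<And>s. 0 \<le> s \<Longrightarrow> dist s t < d \<Longrightarrow>
            dist (x1 s \<omega> - x2 s \<omega>) (x1 t \<omega> - x2 t \<omega>) < x1 t \<omega> - x2 t \<omega>"
          using t pos unfolding continuous_on_iff by (metis atLeast_iff)
        obtain q :: rat where q: "t < of_rat q" "of_rat q < t + d"
          using of_rat_dense[of t "t + d"] d(1) by auto
        have "0 < (of_rat q :: real)" using q(1) t by linarith
        then have q0: "0 \<le> q" by simp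
        have "dist (x1 (of_rat q) \<omega> - x2 (of_rat q) \<omega>) (x1 t \<omega> - x2 t \<omega>) < x1 t \<omega> - x2 t \<omega>"
          using q q0 t by (intro d) (auto simp: dist_real_def)
        moreover have "x1 (of_rat q) \<omega> \<le> x2 (of_rat q) \<omega>" using elim(1) q0 by blast
        ultimately show False using pos by (simp add: dist_real_def)
      qed
    qed
  qed
qed

end

section \<open>One coordinate of a system of stochastic differential equations\<close>

lemma has_ito_integral_component:
  fixes H :: "real \<Rightarrow> 'a \<Rightarrow> real^'d"
  assumes "has_ito_integral M F W t H Y"
  shows "has_ito_integral M F W t (\<lambda>s \<omega>. H s \<omega> $ l) (\<lambda>\<omega>. Y \<omega> $ l)"
proof -
  from assms obtain n \<tau> \<xi> where e: "\<And>j. elementary_integrand M F (n j) (\<tau> j) (\<xi> j)"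
    and p: "(\<lambda>j::nat. \<integral>\<^sup>+\<omega>. (\<integral>\<^sup>+s\<in>{0..t}.
           ennreal ((norm (H s \<omega> - elementary_process (n j) (\<tau> j) (\<xi> j) s \<omega>))\<^sup>2) \<partial>lborel) \<partial>M) \<longlonglongrightarrow> 0"
    and i: "(\<lambda>j. \<integral>\<^sup>+\<omega>. ennreal ((norm (Y \<omega> - elementary_integral W (n j) (\<tau> j) (\<xi> j) t \<omega>))\<^sup>2) \<partial>M) \<longlonglongrightarrow> 0"
    unfolding has_ito_integral_def by blast
  define z where "z = (\<lambda>j i \<omega>. \<xi> j i \<omega> $ l)"
  have nth [measurable]: "(\<lambda>x::real^'d. x $ l) \<in> borel_measurable borel"
    by (intro borel_measurable_continuous_onI continuous_intros)
  have ez: "elementary_integrand M F (n j) (\<tau> j) (z j)" for j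
  proof -
    have "bounded (z j i ` space M)" if "i < n j" for i
    proof -
      have "bounded (\<xi> j i ` space M)" using e[of j] that by (simp add: elementary_integrand_def)
      then obtain B where "\<And>\<omega>. \<omega> \<in> space M \<Longrightarrow> norm (\<xi> j i \<omega>) \<le> B" by (auto simp: bounded_iff)
      then have "\<And>\<omega>. \<omega> \<in> space M \<Longrightarrow> norm (z j i \<omega>) \<le> B"
        using component_le_norm_cart order_trans unfolding z_def real_norm_def by blast
      then show ?thesis by (auto simp: bounded_iff)
    qed
    then show ?thesis using e[of j]
      by (auto simp: elementary_integrand_def z_def intro: measurable_compose[OF _ nth])
  qed
  have pz: "elementary_process (n j) (\<tau> j) (z j) s \<omega> = elementary_process (n j) (\<tau> j) (\<xi> j) s \<omega> $ l"
    and iz: "elementary_integral W (n j) (\<tau> j) (z j) t \<omega> = elementary_integral W (n j) (\<tau> j) (\<xi> j) t \<omega> $ l" for j s \<omega>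
    by (simp_all add: elementary_process_def elementary_integral_def z_def)
  have sq_le: "(x $ l - y $ l)\<^sup>2 \<le> (norm (x - y))\<^sup>2" for x y :: "real^'d"
    using component_le_norm_cart[of "x - y" l] by (subst abs_le_square_iff[symmetric]) simp
  then have le: "ennreal ((norm (x $ l - y $ l))\<^sup>2) \<le> ennreal ((norm (x - y))\<^sup>2)" for x y :: "real^'d"
    by (intro ennreal_leI) simp
  have pl: "(\<lambda>j. \<integral>\<^sup>+\<omega>. (\<integral>\<^sup>+s\<in>{0..t}.
           ennreal ((norm (H s \<omega> $ l - elementary_process (n j) (\<tau> j) (z j) s \<omega>))\<^sup>2) \<partial>lborel) \<partial>M) \<longlonglongrightarrow> 0"
    unfolding pz
    by (rule tendsto_sandwich[OF _ _ tendsto_const p])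
       (auto intro!: always_eventually nn_integral_mono mult_right_mono ennreal_leI sq_le)
  have il: "(\<lambda>j. \<integral>\<^sup>+\<omega>. ennreal ((norm (Y \<omega> $ l - elementary_integral W (n j) (\<tau> j) (z j) t \<omega>))\<^sup>2) \<partial>M) \<longlonglongrightarrow> 0"
    unfolding iz
    by (rule tendsto_sandwich[OF _ _ tendsto_const i])
       (auto intro!: always_eventually nn_integral_mono ennreal_leI sq_le)
  show ?thesis
    unfolding has_ito_integral_def
  proof (intro conjI exI[of _ n] exI[of _ \<tau>] exI[of _ z])
    show "(\<lambda>(s, \<omega>). H s \<omega> $ l) \<in> borel_measurable (restrict_space borel {0..t} \<Otimes>\<^sub>M M)"
    proof -
      have "(\<lambda>(s, \<omega>). H s \<omega>) \<in> borel_measurable (restrict_space borel {0..t} \<Otimes>\<^sub>M M)"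
        using assms by (simp add: has_ito_integral_def)
      from measurable_compose[OF this nth] show ?thesis by (simp add: split_beta')
    qed
    show "(\<lambda>\<omega>. Y \<omega> $ l) \<in> borel_measurable M"
    proof -
      have "Y \<in> borel_measurable M" using assms by (simp add: has_ito_integral_def)
      from measurable_compose[OF this nth] show ?thesis .
    qed
  qed (use ez in blast, rule pl, rule il)
qed

lemma continuous_on_time_space_compose:
  assumes "continuous_on ({0..} \<times> UNIV) (\<lambda>(t, x). f t x)"
    and "continuous_on S u" "continuous_on S v" "\<And>q. q \<in> S \<Longrightarrow> 0 \<le> (u q :: real)"
  shows "continuous_on S (\<lambda>q. f (u q) (v q))"
proof -
  have "continuous_on S (\<lambda>q. case (u q, v q) of (t, x) \<Rightarrow> f t x)"
    by (rule continuous_on_compose2[OF assms(1) continuous_on_Pair[OF assms(2,3)]]) (use assms(4) in auto)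
  then show ?thesis by simp
qed

text \<open>An inequality that holds almost surely at each parameter holds almost surely at all parameters
  simultaneously, if both sides are continuous in the parameter: it suffices to look at a countable
  dense set.\<close>

lemma AE_continuous_nonpos:
  fixes f :: "'b::{metric_space, second_countable_topology} \<Rightarrow> 'a \<Rightarrow> real"
  assumes cont: "AE \<omega> in M. continuous_on S (\<lambda>p. f p \<omega>)"
    and le: "\<And>p. p \<in> S \<Longrightarrow> AE \<omega> in M. f p \<omega> \<le> 0"
  shows "AE \<omega> in M. \<forall>p\<in>S. f p \<omega> \<le> 0"
proof -
  obtain T where T: "countable T" "T \<subseteq> S" "S \<subseteq> closure T"
    using separable by metis
  have "AE \<omega> in M. \<forall>p\<in>T. f p \<omega> \<le> 0"
    using T by (subst AE_ball_countable) (auto intro: le)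
  with cont show ?thesis
  proof eventually_elim
    case (elim \<omega>)
    show ?case
    proof
      fix p assume p: "p \<in> S"
      then obtain q where q: "\<And>n. q n \<in> T" "q \<longlonglongrightarrow> p"
        using T(3) closure_sequential[of p T] by blast
      have "(\<lambda>n. f (q n) \<omega>) \<longlonglongrightarrow> f p \<omega>"
        using q T(2) by (intro continuous_on_tendsto_compose[OF elim(1) q(2) p] always_eventually) auto
      then show "f p \<omega> \<le> 0" by (rule LIMSEQ_le_const2) (use elim(2) q in auto)
    qed
  qed
qed

context usual_filtered_prob_space
begin

context
  fixes C :: real and a :: "real \<Rightarrow> real^'d \<Rightarrow> 'a \<Rightarrow> real^'d"
    and b :: "'m::finite \<Rightarrow> real \<Rightarrow> real \<Rightarrow> 'a \<Rightarrow> real^'d" and l :: 'd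
  assumes coeff: "coefficient_assumptions M F C a (\<lambda>k t x. b k t (x $ l))"
begin

lemma coefficient_continuous:
  "AE \<omega> in M. continuous_on ({0..} \<times> UNIV) (\<lambda>(t, x). a t x \<omega>) \<and>
        (\<forall>k. continuous_on ({0..} \<times> UNIV) (\<lambda>(t, x::real^'d). b k t (x $ l) \<omega>))"
  using coeff by (simp add: coefficient_assumptions_def)

lemma coefficient_bound_0:
  "AE \<omega> in M. \<forall>t\<ge>0. norm (a t 0 \<omega>) + (\<Sum>k\<in>UNIV. norm (b k t 0 \<omega>)) \<le> C"
proof -
  have "AE \<omega> in M. \<forall>t\<in>{0..}. norm (a t 0 \<omega>) + (\<Sum>k\<in>UNIV. norm (b k t 0 \<omega>)) - C \<le> 0"
  proof (rule AE_continuous_nonpos)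
    show "AE \<omega> in M. continuous_on {0..} (\<lambda>t. norm (a t 0 \<omega>) + (\<Sum>k\<in>UNIV. norm (b k t 0 \<omega>)) - C)"
      using coefficient_continuous
    proof eventually_elim
      case (elim \<omega>)
      have "continuous_on {0..} (\<lambda>t. a t 0 \<omega>)"
        by (rule continuous_on_time_space_compose[OF conjunct1[OF elim]]) (auto intro: continuous_intros)
      moreover have "continuous_on {0..} (\<lambda>t. b k t ((0::real^'d) $ l) \<omega>)" for k
        by (rule continuous_on_time_space_compose[OF conjunct2[OF elim, rule_format]]) (auto intro: continuous_intros)
      then have "continuous_on {0..} (\<lambda>t. b k t 0 \<omega>)" for k by simp
      ultimately show ?case by (intro continuous_intros)
    qed
    show "AE \<omega> in M. norm (a t 0 \<omega>) + (\<Sum>k\<in>UNIV. norm (b k t 0 \<omega>)) - C \<le> 0" if "t \<in> {0..}" for t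
      using coeff that by (simp add: coefficient_assumptions_def)
  qed
  then show ?thesis by eventually_elim auto
qed

lemma coefficient_lipschitz:
  "AE \<omega> in M. \<forall>t\<ge>0. \<forall>x y. norm (a t x \<omega> - a t y \<omega>)
      + (\<Sum>k\<in>UNIV. norm (b k t (x $ l) \<omega> - b k t (y $ l) \<omega>)) \<le> C * norm (x - y)"
proof -
  have "AE \<omega> in M. \<forall>q\<in>{0..} \<times> (UNIV \<times> UNIV).
    norm (a (fst q) (fst (snd q)) \<omega> - a (fst q) (snd (snd q)) \<omega>)
      + (\<Sum>k\<in>UNIV. norm (b k (fst q) (fst (snd q) $ l) \<omega> - b k (fst q) (snd (snd q) $ l) \<omega>))
      - C * norm (fst (snd q) - snd (snd q)) \<le> 0"
  proof (rule AE_continuous_nonpos)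
    show "AE \<omega> in M. continuous_on ({0..} \<times> (UNIV \<times> UNIV)) (\<lambda>q.
      norm (a (fst q) (fst (snd q)) \<omega> - a (fst q) (snd (snd q)) \<omega>)
      + (\<Sum>k\<in>UNIV. norm (b k (fst q) (fst (snd q) $ l) \<omega> - b k (fst q) (snd (snd q) $ l) \<omega>))
      - C * norm (fst (snd q) - snd (snd q)))"
      using coefficient_continuous
    proof eventually_elim
      case (elim \<omega>)
      let ?S = "{0..} \<times> (UNIV \<times> UNIV) :: (real \<times> (real^'d) \<times> (real^'d)) set"
      have p: "continuous_on ?S fst" "continuous_on ?S (\<lambda>q. fst (snd q))" "continuous_on ?S (\<lambda>q. snd (snd q))"
        "\<And>q. q \<in> ?S \<Longrightarrow> 0 \<le> fst q"
        by (auto intro!: continuous_intros)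
      have "continuous_on ?S (\<lambda>q. a (fst q) (fst (snd q)) \<omega>)" "continuous_on ?S (\<lambda>q. a (fst q) (snd (snd q)) \<omega>)"
        by (rule continuous_on_time_space_compose[OF conjunct1[OF elim]], fact p, fact p, fact p)+
      moreover have "continuous_on ?S (\<lambda>q. b k (fst q) (fst (snd q) $ l) \<omega>)"
        "continuous_on ?S (\<lambda>q. b k (fst q) (snd (snd q) $ l) \<omega>)" for k
        by (rule continuous_on_time_space_compose[OF conjunct2[OF elim, rule_format]], fact p, fact p, fact p)+
      ultimately show ?case by (intro continuous_intros)
    qed
    fix q :: "real \<times> (real^'d) \<times> (real^'d)"
    assume "q \<in> {0..} \<times> (UNIV \<times> UNIV)"
    then have "0 \<le> fst q" by auto
    then have "AE \<omega> in M. norm (a (fst q) (fst (snd q)) \<omega> - a (fst q) (snd (snd q)) \<omega>)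
      + (\<Sum>k\<in>UNIV. norm (b k (fst q) (fst (snd q) $ l) \<omega> - b k (fst q) (snd (snd q) $ l) \<omega>))
      \<le> C * norm (fst (snd q) - snd (snd q))"
      using coeff unfolding coefficient_assumptions_def by blast
    then show "AE \<omega> in M. norm (a (fst q) (fst (snd q)) \<omega> - a (fst q) (snd (snd q)) \<omega>)
      + (\<Sum>k\<in>UNIV. norm (b k (fst q) (fst (snd q) $ l) \<omega> - b k (fst q) (snd (snd q) $ l) \<omega>))
      - C * norm (fst (snd q) - snd (snd q)) \<le> 0" by eventually_elim simp
  qed
  then show ?thesis by eventually_elim auto
qed

lemma coefficient_nonneg: "0 \<le> C"
proof -
  have "AE \<omega> in M. 0 \<le> C"
    using coefficient_bound_0
  proof eventually_elim
    case (elim \<omega>)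
    have "0 \<le> norm (a 0 0 \<omega>) + (\<Sum>k\<in>UNIV. norm (b k 0 0 \<omega>))" by (intro add_nonneg_nonneg sum_nonneg) auto
    with elim show ?case by force
  qed
  then show ?thesis by simp
qed

lemma diffusion_component_adapted:
  assumes "0 \<le> t"
  shows "(\<lambda>(z, \<omega>). b k t z \<omega> $ l) \<in> borel_measurable (borel \<Otimes>\<^sub>M F t)"
proof -
  have 1: "(\<lambda>(x::real^'d, \<omega>). b k t (x $ l) \<omega>) \<in> borel_measurable (borel \<Otimes>\<^sub>M F t)"
    using coeff assms unfolding coefficient_assumptions_def by blast
  have "(\<lambda>z. z *\<^sub>R axis l (1::real) :: real^'d) \<in> borel_measurable borel"
    by (intro borel_measurable_continuous_onI continuous_intros)
  then have 2: "(\<lambda>q. (fst q *\<^sub>R axis l (1::real) :: real^'d, snd q)) \<in> borel \<Otimes>\<^sub>M F t \<rightarrow>\<^sub>M borel \<Otimes>\<^sub>M F t"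
    by (intro measurable_Pair measurable_snd measurable_compose[OF measurable_fst])
  have 3: "(\<lambda>x::real^'d. x $ l) \<in> borel_measurable borel"
    by (intro borel_measurable_continuous_onI continuous_intros)
  from measurable_compose[OF measurable_compose[OF 2 1] 3] show ?thesis by (simp add: split_beta')
qed

lemma diffusion_component_continuous: "AE \<omega> in M. \<forall>z. continuous_on {0..} (\<lambda>t. b k t z \<omega> $ l)"
  using coefficient_continuous
proof eventually_elim
  case (elim \<omega>)
  show ?case
  proof
    fix z
    have "continuous_on {0..} (\<lambda>t. b k t ((z *\<^sub>R axis l (1::real) :: real^'d) $ l) \<omega>)"
      by (rule continuous_on_time_space_compose[OF conjunct2[OF elim, rule_format]]) (auto intro: continuous_intros)
    then have "continuous_on {0..} (\<lambda>t. b k t z \<omega>)" by simp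
    then show "continuous_on {0..} (\<lambda>t. b k t z \<omega> $ l)" by (intro continuous_intros)
  qed
qed

lemma diffusion_component_0: "AE \<omega> in M. \<forall>t\<ge>0. \<bar>b k t 0 \<omega> $ l\<bar> \<le> C"
  using coefficient_bound_0
proof eventually_elim
  case (elim \<omega>)
  show ?case
  proof (intro allI impI)
    fix t :: real assume t: "0 \<le> t"
    have "\<bar>b k t 0 \<omega> $ l\<bar> \<le> norm (b k t 0 \<omega>)" by (rule component_le_norm_cart)
    also have "\<dots> \<le> (\<Sum>k\<in>UNIV. norm (b k t 0 \<omega>))" by (rule member_le_sum) auto
    also have "\<dots> \<le> norm (a t 0 \<omega>) + (\<Sum>k\<in>UNIV. norm (b k t 0 \<omega>))" by simp
    also have "\<dots> \<le> C" using elim t by blast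
    finally show "\<bar>b k t 0 \<omega> $ l\<bar> \<le> C" .
  qed
qed

lemma diffusion_component_lipschitz:
  "AE \<omega> in M. \<forall>t\<ge>0. \<forall>z z'. \<bar>b k t z \<omega> $ l - b k t z' \<omega> $ l\<bar> \<le> C * \<bar>z - z'\<bar>"
  using coefficient_lipschitz
proof eventually_elim
  case (elim \<omega>)
  show ?case
  proof (intro allI impI)
    fix t z z' :: real assume t: "0 \<le> t"
    let ?x = "z *\<^sub>R axis l (1::real) :: real^'d" and ?y = "z' *\<^sub>R axis l (1::real) :: real^'d"
    have "\<bar>b k t z \<omega> $ l - b k t z' \<omega> $ l\<bar> \<le> norm (b k t z \<omega> - b k t z' \<omega>)"
      using component_le_norm_cart[of "b k t z \<omega> - b k t z' \<omega>" l] by simp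
    also have "\<dots> \<le> (\<Sum>k\<in>UNIV. norm (b k t z \<omega> - b k t z' \<omega>))"
      by (rule member_le_sum[where f = "\<lambda>k. norm (b k t z \<omega> - b k t z' \<omega>)"]) auto
    also have "\<dots> \<le> norm (a t ?x \<omega> - a t ?y \<omega>) + (\<Sum>k\<in>UNIV. norm (b k t (?x $ l) \<omega> - b k t (?y $ l) \<omega>))"
      by simp
    also have "\<dots> \<le> C * norm (?x - ?y)" using elim t by blast
    also have "norm (?x - ?y) = \<bar>z - z'\<bar>" by (simp flip: scaleR_left_diff_distrib)
    finally show "\<bar>b k t z \<omega> $ l - b k t z' \<omega> $ l\<bar> \<le> C * \<bar>z - z'\<bar>" .
  qed
qed

lemma drift_component_bound: "AE \<omega> in M. \<forall>t\<ge>0. \<forall>x. \<bar>a t x \<omega> $ l\<bar> \<le> C + C * norm x"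
  using coefficient_bound_0 coefficient_lipschitz
proof eventually_elim
  case (elim \<omega>)
  show ?case
  proof (intro allI impI)
    fix t :: real and x :: "real^'d" assume t: "0 \<le> t"
    have "\<bar>a t x \<omega> $ l\<bar> \<le> norm (a t x \<omega>)" by (rule component_le_norm_cart)
    also have "\<dots> \<le> norm (a t 0 \<omega>) + norm (a t x \<omega> - a t 0 \<omega>)"
      using norm_triangle_ineq[of "a t 0 \<omega>" "a t x \<omega> - a t 0 \<omega>"] by simp
    also have "norm (a t 0 \<omega>) \<le> C"
    proof -
      have "norm (a t 0 \<omega>) \<le> norm (a t 0 \<omega>) + (\<Sum>k\<in>UNIV. norm (b k t 0 \<omega>))" by (simp add: sum_nonneg)
      also have "\<dots> \<le> C" using elim(1) t by blast
      finally show ?thesis .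
    qed
    also have "norm (a t x \<omega> - a t 0 \<omega>) \<le> C * norm x"
    proof -
      have "norm (a t x \<omega> - a t 0 \<omega>) \<le> norm (a t x \<omega> - a t 0 \<omega>)
        + (\<Sum>k\<in>UNIV. norm (b k t (x $ l) \<omega> - b k t ((0::real^'d) $ l) \<omega>))" by (simp add: sum_nonneg)
      also have "\<dots> \<le> C * norm (x - 0)" using elim(2) t by blast
      finally show ?thesis by simp
    qed
    finally show "\<bar>a t x \<omega> $ l\<bar> \<le> C + C * norm x" by simp
  qed
qed

lemma diffusion_component_bound: "AE \<omega> in M. \<forall>t\<ge>0. \<forall>x::real^'d. \<bar>b k t (x $ l) \<omega> $ l\<bar> \<le> C + C * norm x"
  using diffusion_component_0[of k] diffusion_component_lipschitz[of k]
proof eventually_elim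
  case (elim \<omega>)
  show ?case
  proof (intro allI impI)
    fix t :: real and x :: "real^'d" assume t: "0 \<le> t"
    have "\<bar>b k t (x $ l) \<omega> $ l - b k t 0 \<omega> $ l\<bar> \<le> C * \<bar>x $ l - 0\<bar>" "\<bar>b k t 0 \<omega> $ l\<bar> \<le> C"
      using elim t by blast+
    moreover have "C * \<bar>x $ l\<bar> \<le> C * norm x"
      by (intro mult_left_mono component_le_norm_cart coefficient_nonneg)
    ultimately show "\<bar>b k t (x $ l) \<omega> $ l\<bar> \<le> C + C * norm x" by simp
  qed
qed

text \<open>A coordinate of a solution is an Ito process whose drift is regarded as a given random process; the
  dependence on the other coordinates survives only in the dominating process \<open>C + C |X|\<close>.\<close>

lemma sde_component_diffusion_equation:
  fixes W :: "'m \<Rightarrow> real \<Rightarrow> 'a \<Rightarrow> real"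
  assumes W: "independent_wiener_processes M F W"
    and X0: "X0 \<in> borel_measurable (F 0)" "bounded (X0 ` space M)"
    and sol: "sde_solution M F W a (\<lambda>k t x. b k t (x $ l)) X0 X"
  shows "\<exists>J. diffusion_equation M F W (\<lambda>t \<omega>. X t \<omega> $ l) (\<lambda>\<omega>. X0 \<omega> $ l) (\<lambda>t \<omega>. a t (X t \<omega>) \<omega> $ l)
    (\<lambda>k t z \<omega>. b k t z \<omega> $ l) J (\<lambda>t \<omega>. C + C * norm (X t \<omega>)) C"
proof -
  obtain I where I: "\<And>k t. 0 \<le> t \<Longrightarrow> has_ito_integral M F (W k) t (\<lambda>s \<omega>. b k s (X s \<omega> $ l) \<omega>) (I k t)"
    and eq: "\<And>t. 0 \<le> t \<Longrightarrow> AE \<omega> in M. X t \<omega> = X0 \<omega> + (LBINT s:{0..t}. a s (X s \<omega>) \<omega>) + (\<Sum>k\<in>UNIV. I k t \<omega>)"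
    using sol unfolding sde_solution_def by blast
  have X_adapted: "\<And>t. 0 \<le> t \<Longrightarrow> X t \<in> borel_measurable (F t)"
    and X_cont: "AE \<omega> in M. continuous_on {0..} (\<lambda>t. X t \<omega>)"
    and X_meas: "(\<lambda>(t, \<omega>). X t \<omega>) \<in> borel_measurable (restrict_space borel {0..} \<Otimes>\<^sub>M M)"
    and X_fin: "\<And>T. 0 \<le> T \<Longrightarrow> (\<integral>\<^sup>+\<omega>. (\<integral>\<^sup>+t\<in>{0..T}. ennreal ((norm (X t \<omega>))\<^sup>2) \<partial>lborel) \<partial>M) < \<infinity>"
    using sol unfolding sde_solution_def square_integrable_process_def adapted_def by blast+
  have nth: "(\<lambda>x::real^'d. x $ l) \<in> borel_measurable borel"
    by (intro borel_measurable_continuous_onI continuous_intros)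
  have a_cont: "AE \<omega> in M. continuous_on {0..} (\<lambda>t. a t (X t \<omega>) \<omega>)"
    using coefficient_continuous X_cont
  proof eventually_elim
    case (elim \<omega>)
    show ?case
      by (rule continuous_on_time_space_compose[OF conjunct1[OF elim(1)] _ elim(2)]) (auto intro: continuous_intros)
  qed
  have norm_jm: "jointly_measurable_on T M (\<lambda>t \<omega>. norm (X t \<omega>))"
    and comp_jm: "jointly_measurable_on T M (\<lambda>t \<omega>. X t \<omega> $ l)" for T
  proof -
    have "(\<lambda>q. (fst q, snd q)) \<in> restrict_space borel {0..T} \<Otimes>\<^sub>M M \<rightarrow>\<^sub>M restrict_space borel {0..} \<Otimes>\<^sub>M M"
    proof (intro measurable_Pair measurable_snd measurable_restrict_space2)
      show "fst \<in> restrict_space borel {0..T} \<Otimes>\<^sub>M M \<rightarrow>\<^sub>M borel"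
        by (intro measurable_fst'' measurable_restrict_space1) simp
    qed (auto simp: space_pair_measure)
    note X' = measurable_compose[OF this X_meas]
    show "jointly_measurable_on T M (\<lambda>t \<omega>. norm (X t \<omega>))"
      using measurable_compose[OF X' borel_measurable_norm] unfolding jointly_measurable_on_def by (simp add: split_beta')
    show "jointly_measurable_on T M (\<lambda>t \<omega>. X t \<omega> $ l)"
      using measurable_compose[OF X' nth] unfolding jointly_measurable_on_def by (simp add: split_beta')
  qed
  have const_jm: "jointly_measurable_on T M (\<lambda>t \<omega>. C)" for T
    by (rule jointly_measurable_on_const) simp
  have cnorm_jm: "jointly_measurable_on T M (\<lambda>t \<omega>. C * norm (X t \<omega>))" for T
    using norm_jm[of T] unfolding jointly_measurable_on_def split_beta' by (intro borel_measurable_times) auto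
  show ?thesis
  proof (intro exI, unfold_locales)
    show "wiener_process M F (W k)" for k using W by (simp add: independent_wiener_processes_def)
    show "(\<lambda>\<omega>. X t \<omega> $ l) \<in> borel_measurable (F t)" if "0 \<le> t" for t
      using measurable_compose[OF X_adapted[OF that] nth] .
    show "AE \<omega> in M. continuous_on {0..} (\<lambda>t. X t \<omega> $ l)"
      using X_cont by eventually_elim (intro continuous_intros)
    show "sq_integrable M (\<lambda>\<omega>. X0 \<omega> $ l)"
    proof -
      obtain B where B: "\<And>\<omega>. \<omega> \<in> space M \<Longrightarrow> norm (X0 \<omega>) \<le> B" using X0(2) by (auto simp: bounded_iff)
      have "sq_integrable M (\<lambda>\<omega>. B)" by (simp add: sq_integrable_iff)
      moreover have "(\<lambda>\<omega>. X0 \<omega> $ l) \<in> borel_measurable M"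
        using measurable_compose[OF measurable_F[OF order_refl X0(1)] nth] .
      moreover have "AE \<omega> in M. \<bar>X0 \<omega> $ l\<bar> \<le> \<bar>B\<bar>"
        by (intro AE_I2) (meson B abs_ge_self component_le_norm_cart order_trans)
      ultimately show ?thesis by (rule sq_integrable_bound)
    qed
    show "has_ito_integral M F (W k) t (\<lambda>t \<omega>. b k t (X t \<omega> $ l) \<omega> $ l) (\<lambda>\<omega>. I k t \<omega> $ l)" if "0 \<le> t" for t k
      by (rule has_ito_integral_component[OF I[OF that]])
    show "AE \<omega> in M. X t \<omega> $ l = X0 \<omega> $ l + (LBINT s:{0..t}. a s (X s \<omega>) \<omega> $ l) + (\<Sum>k\<in>UNIV. I k t \<omega> $ l)"
      if "0 \<le> t" for t
      using eq[OF that] a_cont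
    proof eventually_elim
      case (elim \<omega>)
      have "continuous_on {0..t} (\<lambda>s. a s (X s \<omega>) \<omega>)" by (rule continuous_on_subset[OF elim(2)]) auto
      then have "set_integrable lborel {0..t} (\<lambda>s. a s (X s \<omega>) \<omega>)" by (rule borel_integrable_atLeastAtMost')
      then have "(LBINT s:{0..t}. a s (X s \<omega>) \<omega>) $ l = (LBINT s:{0..t}. a s (X s \<omega>) \<omega> $ l)"
        unfolding set_lebesgue_integral_def set_integrable_def
        using integral_bounded_linear[OF bounded_linear_vec_nth] by fastforce
      then show ?case using elim(1) by simp
    qed
    show "AE \<omega> in M. continuous_on {0..} (\<lambda>t. a t (X t \<omega>) \<omega> $ l)"
      using a_cont by eventually_elim (intro continuous_intros)
    show "jointly_measurable_on T M (\<lambda>t \<omega>. C + C * norm (X t \<omega>))" if "0 \<le> T" for T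
      by (intro jointly_measurable_on_add const_jm cnorm_jm)
    show "mean_square_on M 0 T (\<lambda>t \<omega>. C + C * norm (X t \<omega>)) < \<infinity>" if "0 \<le> T" for T
    proof -
      have 1: "mean_square_on M 0 T (\<lambda>t \<omega>. C) < \<infinity>"
        using that by (simp add: mean_square_on_def nn_integral_cmult ennreal_mult_less_top emeasure_space_1)
      have 2: "mean_square_on M 0 T (\<lambda>t \<omega>. C * norm (X t \<omega>)) < \<infinity>"
        using mean_square_on_cmult[OF norm_jm, of 0 T T C] X_fin[OF that] that
        by (simp add: mean_square_on_def ennreal_mult_less_top)
      show ?thesis
        using mean_square_on_add[OF const_jm cnorm_jm order_refl that order_refl] ennreal_two_mult_less_top[OF 1 2]
        by (rule le_less_trans)
    qed
    show "AE \<omega> in M. \<forall>t\<ge>0. \<bar>a t (X t \<omega>) \<omega> $ l\<bar> \<le> C + C * norm (X t \<omega>)"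
      using drift_component_bound by eventually_elim auto
    show "AE \<omega> in M. \<forall>t\<ge>0. \<bar>b k t (X t \<omega> $ l) \<omega> $ l\<bar> \<le> C + C * norm (X t \<omega>)" for k
      using diffusion_component_bound[of k] by eventually_elim auto
  qed (assumption | rule comp_jm coefficient_nonneg diffusion_component_adapted diffusion_component_continuous
      diffusion_component_0 diffusion_component_lipschitz)+
qed

end

text \<open>The point \<open>g x y\<close> is \<open>y\<close> with its \<open>l\<close>-th coordinate replaced by that of \<open>x\<close>. The ordering of the
  drifts applies to \<open>x\<close> and \<open>g x y\<close>, and the Lipschitz condition to \<open>g x y\<close> and \<open>y\<close>, which are at
  distance \<open>\<bar>x $ l - y $ l\<bar>\<close>.\<close>

lemma drift_component_comparison:
  fixes a1 a2 :: "real \<Rightarrow> real^'d \<Rightarrow> 'a \<Rightarrow> real^'d" and b :: "'m::finite \<Rightarrow> real \<Rightarrow> real \<Rightarrow> 'a \<Rightarrow> real^'d"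
  assumes coeff1: "coefficient_assumptions M F C a1 (\<lambda>k t x. b k t (x $ l))"
    and coeff2: "coefficient_assumptions M F C a2 (\<lambda>k t x. b k t (x $ l))"
    and le: "\<And>t x1 x2. 0 \<le> t \<Longrightarrow> x1 $ l = x2 $ l \<Longrightarrow> AE \<omega> in M. a1 t x1 \<omega> $ l \<le> a2 t x2 \<omega> $ l"
  shows "AE \<omega> in M. \<forall>t\<ge>0. \<forall>x y. a1 t x \<omega> $ l - a2 t y \<omega> $ l \<le> C * \<bar>x $ l - y $ l\<bar>"
proof -
  define g where "g = (\<lambda>(x::real^'d) (y::real^'d). y + (x $ l - y $ l) *\<^sub>R axis l (1::real))"
  have gl: "g x y $ l = x $ l" for x y by (simp add: g_def)
  have gn: "norm (g x y - y) = \<bar>x $ l - y $ l\<bar>" for x y by (simp add: g_def)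
  have "AE \<omega> in M. \<forall>q\<in>{0..} \<times> (UNIV \<times> UNIV).
    a1 (fst q) (fst (snd q)) \<omega> $ l - a2 (fst q) (g (fst (snd q)) (snd (snd q))) \<omega> $ l \<le> 0"
  proof (rule AE_continuous_nonpos)
    show "AE \<omega> in M. continuous_on ({0..} \<times> (UNIV \<times> UNIV)) (\<lambda>q.
      a1 (fst q) (fst (snd q)) \<omega> $ l - a2 (fst q) (g (fst (snd q)) (snd (snd q))) \<omega> $ l)"
      using coefficient_continuous[OF coeff1] coefficient_continuous[OF coeff2]
    proof eventually_elim
      case (elim \<omega>)
      let ?S = "{0..} \<times> (UNIV \<times> UNIV) :: (real \<times> (real^'d) \<times> (real^'d)) set"
      have p: "continuous_on ?S fst" "continuous_on ?S (\<lambda>q. fst (snd q))"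
        "continuous_on ?S (\<lambda>q. g (fst (snd q)) (snd (snd q)))" "\<And>q. q \<in> ?S \<Longrightarrow> 0 \<le> fst q"
        unfolding g_def by (auto intro!: continuous_intros)
      have "continuous_on ?S (\<lambda>q. a1 (fst q) (fst (snd q)) \<omega>)"
        "continuous_on ?S (\<lambda>q. a2 (fst q) (g (fst (snd q)) (snd (snd q))) \<omega>)"
        by (rule continuous_on_time_space_compose[OF conjunct1[OF elim(1)]], fact p, fact p, fact p)
           (rule continuous_on_time_space_compose[OF conjunct1[OF elim(2)]], fact p, fact p, fact p)
      then show ?case by (intro continuous_intros)
    qed
    show "AE \<omega> in M. a1 (fst q) (fst (snd q)) \<omega> $ l - a2 (fst q) (g (fst (snd q)) (snd (snd q))) \<omega> $ l \<le> 0"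
      if "q \<in> {0..} \<times> (UNIV \<times> UNIV)" for q
      using le[of "fst q" "fst (snd q)" "g (fst (snd q)) (snd (snd q))"] that by (auto simp: gl)
  qed
  with coefficient_lipschitz[OF coeff2] show ?thesis
  proof eventually_elim
    case (elim \<omega>)
    show ?case
    proof (intro allI impI)
      fix t :: real and x y :: "real^'d" assume t: "0 \<le> t"
      have "a1 t x \<omega> $ l \<le> a2 t (g x y) \<omega> $ l"
        using bspec[OF elim(2), of "(t, x, y)"] t by simp
      moreover have "a2 t (g x y) \<omega> $ l - a2 t y \<omega> $ l \<le> C * \<bar>x $ l - y $ l\<bar>"
      proof -
        have "a2 t (g x y) \<omega> $ l - a2 t y \<omega> $ l \<le> norm (a2 t (g x y) \<omega> - a2 t y \<omega>)"
          using component_le_norm_cart[of "a2 t (g x y) \<omega> - a2 t y \<omega>" l] by simp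
        also have "\<dots> \<le> norm (a2 t (g x y) \<omega> - a2 t y \<omega>)
            + (\<Sum>k\<in>UNIV. norm (b k t (g x y $ l) \<omega> - b k t (y $ l) \<omega>))" by (simp add: sum_nonneg)
        also have "\<dots> \<le> C * norm (g x y - y)" using elim(1) t by blast
        finally show ?thesis by (simp add: gn)
      qed
      ultimately show "a1 t x \<omega> $ l - a2 t y \<omega> $ l \<le> C * \<bar>x $ l - y $ l\<bar>" by linarith
    qed
  qed
qed

end

theorem theorem8:
  fixes M :: "'a measure" and F :: "real \<Rightarrow> 'a measure"
    and W :: "'m::finite \<Rightarrow> real \<Rightarrow> 'a \<Rightarrow> real"
    and a1 a2 :: "real \<Rightarrow> real^'d \<Rightarrow> 'a \<Rightarrow> real^'d"
    and b :: "'m \<Rightarrow> real \<Rightarrow> real \<Rightarrow> 'a \<Rightarrow> real^'d"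
    and X01 X02 :: "'a \<Rightarrow> real^'d"
    and X1 X2 :: "real \<Rightarrow> 'a \<Rightarrow> real^'d"
    and l :: 'd and C :: real
  assumes "usual_filtered_prob_space M F"
    and "independent_wiener_processes M F W"
    and "X01 \<in> borel_measurable (F 0)" and "bounded (X01 ` space M)"
    and "X02 \<in> borel_measurable (F 0)" and "bounded (X02 ` space M)"
    and "(\<lambda>(t, x, \<omega>). a1 t x \<omega>) \<in> borel_measurable (restrict_space borel {0..} \<Otimes>\<^sub>M borel \<Otimes>\<^sub>M M)"
    and "(\<lambda>(t, x, \<omega>). a2 t x \<omega>) \<in> borel_measurable (restrict_space borel {0..} \<Otimes>\<^sub>M borel \<Otimes>\<^sub>M M)"
    and "\<And>k. (\<lambda>(t, x, \<omega>). b k t x \<omega>)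
           \<in> borel_measurable (restrict_space borel {0..} \<Otimes>\<^sub>M borel \<Otimes>\<^sub>M M)"
    and "coefficient_assumptions M F C a1 (\<lambda>k t x. b k t (x $ l))"
    and "coefficient_assumptions M F C a2 (\<lambda>k t x. b k t (x $ l))"
    and "sde_solution M F W a1 (\<lambda>k t x. b k t (x $ l)) X01 X1"
    and "sde_solution M F W a2 (\<lambda>k t x. b k t (x $ l)) X02 X2"
    and C1: "AE \<omega> in M. X01 \<omega> $ l \<le> X02 \<omega> $ l"
    and C2: "\<And>t x1 x2. 0 \<le> t \<Longrightarrow> x1 $ l = x2 $ l \<Longrightarrow> AE \<omega> in M. a1 t x1 \<omega> $ l \<le> a2 t x2 \<omega> $ l"
  shows "\<P>(\<omega> in M. \<forall>t\<ge>0. X1 t \<omega> $ l \<le> X2 t \<omega> $ l) = 1"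
proof -
  interpret usual_filtered_prob_space M F by fact
  note coeff1 = \<open>coefficient_assumptions M F C a1 (\<lambda>k t x. b k t (x $ l))\<close>
    and coeff2 = \<open>coefficient_assumptions M F C a2 (\<lambda>k t x. b k t (x $ l))\<close>
    and W = \<open>independent_wiener_processes M F W\<close>
    and sol1 = \<open>sde_solution M F W a1 (\<lambda>k t x. b k t (x $ l)) X01 X1\<close>
    and sol2 = \<open>sde_solution M F W a2 (\<lambda>k t x. b k t (x $ l)) X02 X2\<close>
  obtain J1 where J1: "diffusion_equation M F W (\<lambda>t \<omega>. X1 t \<omega> $ l) (\<lambda>\<omega>. X01 \<omega> $ l)
    (\<lambda>t \<omega>. a1 t (X1 t \<omega>) \<omega> $ l) (\<lambda>k t z \<omega>. b k t z \<omega> $ l) J1 (\<lambda>t \<omega>. C + C * norm (X1 t \<omega>)) C"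
    using sde_component_diffusion_equation[OF coeff1 W assms(3,4) sol1] by blast
  obtain J2 where J2: "diffusion_equation M F W (\<lambda>t \<omega>. X2 t \<omega> $ l) (\<lambda>\<omega>. X02 \<omega> $ l)
    (\<lambda>t \<omega>. a2 t (X2 t \<omega>) \<omega> $ l) (\<lambda>k t z \<omega>. b k t z \<omega> $ l) J2 (\<lambda>t \<omega>. C + C * norm (X2 t \<omega>)) C"
    using sde_component_diffusion_equation[OF coeff2 W assms(5,6) sol2] by blast
  have "AE \<omega> in M. \<forall>t\<ge>0. \<forall>x y. a1 t x \<omega> $ l - a2 t y \<omega> $ l \<le> C * \<bar>x $ l - y $ l\<bar>"
    by (rule drift_component_comparison[OF coeff1 coeff2]) (rule C2)
  then have drift: "AE \<omega> in M. \<forall>t\<ge>0. a1 t (X1 t \<omega>) \<omega> $ l - a2 t (X2 t \<omega>) \<omega> $ l \<le> C * \<bar>X1 t \<omega> $ l - X2 t \<omega> $ l\<bar>"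
    by eventually_elim auto
  interpret comparison_pair M F W
    "\<lambda>t \<omega>. X1 t \<omega> $ l" "\<lambda>\<omega>. X01 \<omega> $ l" "\<lambda>t \<omega>. a1 t (X1 t \<omega>) \<omega> $ l" J1 "\<lambda>t \<omega>. C + C * norm (X1 t \<omega>)"
    "\<lambda>t \<omega>. X2 t \<omega> $ l" "\<lambda>\<omega>. X02 \<omega> $ l" "\<lambda>t \<omega>. a2 t (X2 t \<omega>) \<omega> $ l" J2 "\<lambda>t \<omega>. C + C * norm (X2 t \<omega>)"
    "\<lambda>k t z \<omega>. b k t z \<omega> $ l" C
    by (intro comparison_pair.intro comparison_pair_axioms.intro J1 J2 drift C1)
  \<comment> \<open>The event involves uncountably many times; it is measurable because \<open>M\<close> is complete.\<close>
  have "{\<omega> \<in> space M. \<not> (\<forall>t\<ge>0. X1 t \<omega> $ l \<le> X2 t \<omega> $ l)} \<in> null_sets M"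
    using comparison by (simp add: AE_iff_null_sets)
  then have "space M - {\<omega> \<in> space M. \<not> (\<forall>t\<ge>0. X1 t \<omega> $ l \<le> X2 t \<omega> $ l)} \<in> sets M" by auto
  moreover have "space M - {\<omega> \<in> space M. \<not> (\<forall>t\<ge>0. X1 t \<omega> $ l \<le> X2 t \<omega> $ l)}
    = {\<omega> \<in> space M. \<forall>t\<ge>0. X1 t \<omega> $ l \<le> X2 t \<omega> $ l}" by auto
  ultimately have "{\<omega> \<in> space M. \<forall>t\<ge>0. X1 t \<omega> $ l \<le> X2 t \<omega> $ l} \<in> sets M" by simp
  then show ?thesis using comparison by (simp add: prob_Collect_eq_1)
qed

end
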